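(* Over primes $p \equiv 1 \pmod 4$, $\mathrm{FK}_4(G_p) = \Theta(p^{1/3})$; that is, there are constants $0<c_1\le c_2$ such that $c_1 p^{1/3} \le \mathrm{FK}_4(G_p) \le c_2 p^{1/3}$ for all sufficiently large primes $p\equiv 1 \pmod 4$.
   Context: For a prime $p \equiv 1 \pmod 4$, the Paley graph $G_p$ has vertex set $\mathbb{F}_p$, with distinct $a,b$ adjacent iff $a-b$ is a nonzero square in $\mathbb{F}_p$. For a graph $G$ on vertex set $V$, a degree 4 pseudoexpectation for the clique problem is a linear functional $\widetilde{\mathbb{E}}$ on real polynomials of degree at most $4$ in $(x_i)_{i\in V}$ with $\widetilde{\mathbb{E}}[1]=1$, $\widetilde{\mathbb{E}}[(x_i^2-x_i)q]=0$ and $\widetilde{\mathbb{E}}[x_ix_jq]=0$ (for distinct non-adjacent $i,j$) for all $q$ of degree at most $2$, and $\widetilde{\mathbb{E}}[q^2]\ge 0$ for all $q$ of degree at most $2$. It is given by Feige-Krauthgamer (FK) pseudomoments if there are reals $\alpha_1,\dots,\alpha_4$ (with $\alpha_0=1$) such that $\widetilde{\mathbb{E}}[\prod_{i\in T}x_i^{k_i}]=\alpha_{|T|}$ whenever the set $T$ (all $k_i\ge1$) is a clique of $G$ and $0$ otherwise. $\mathrm{FK}_4(G)$ is the maximum of $\sum_{i\in V}\widetilde{\mathbb{E}}[x_i]$ over all such pseudoexpectations given by FK pseudomoments. *)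

theory Defs
  imports
    "HOL-Analysis.Analysis"
    "HOL-Library.Poly_Mapping"
    "HOL-Number_Theory.Number_Theory"
begin

section \<open>Real polynomials in finitely many variables\<close>

text \<open>A monomial is its exponent function and a polynomial its coefficient function, both
  finitely supported; the ring operations are those of \<^theory>\<open>HOL-Library.Poly_Mapping\<close>.\<close>

type_synonym 'v monom = "'v \<Rightarrow>\<^sub>0 nat"
type_synonym 'v rpoly = "'v monom \<Rightarrow>\<^sub>0 real"

definition monomial :: "'v monom \<Rightarrow> 'v rpoly" where
  "monomial m = Poly_Mapping.single m 1"

definition xvar :: "'v \<Rightarrow> 'v rpoly" where
  "xvar i = monomial (Poly_Mapping.single i 1)"

definition const_poly :: "real \<Rightarrow> 'v rpoly" where
  "const_poly c = Poly_Mapping.single 0 c"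

definition mdeg :: "'v monom \<Rightarrow> nat" where
  "mdeg m = (\<Sum>i\<in>Poly_Mapping.keys m. Poly_Mapping.lookup m i)"

definition polys :: "'v set \<Rightarrow> nat \<Rightarrow> 'v rpoly set" where
  "polys V d = {q. \<forall>m\<in>Poly_Mapping.keys q. Poly_Mapping.keys m \<subseteq> V \<and> mdeg m \<le> d}"


section \<open>Degree 4 pseudoexpectations for the clique problem\<close>

definition clique :: "'v set \<Rightarrow> ('v \<Rightarrow> 'v \<Rightarrow> bool) \<Rightarrow> 'v set \<Rightarrow> bool" where
  "clique V adj T \<longleftrightarrow> T \<subseteq> V \<and> (\<forall>i\<in>T. \<forall>j\<in>T. i \<noteq> j \<longrightarrow> adj i j)"

text \<open>A functional is a total function on polynomials, of which only the restriction to
  \<^term>\<open>polys V 4\<close> matters.\<close>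

definition linear_on_polys :: "'v set \<Rightarrow> nat \<Rightarrow> ('v rpoly \<Rightarrow> real) \<Rightarrow> bool" where
  "linear_on_polys V d E \<longleftrightarrow>
     (\<forall>f\<in>polys V d. \<forall>g\<in>polys V d. E (f + g) = E f + E g) \<and>
     (\<forall>c. \<forall>f\<in>polys V d. E (const_poly c * f) = c * E f)"

definition pseudoexpectation4 ::
    "'v set \<Rightarrow> ('v \<Rightarrow> 'v \<Rightarrow> bool) \<Rightarrow> ('v rpoly \<Rightarrow> real) \<Rightarrow> bool" where
  "pseudoexpectation4 V adj E \<longleftrightarrow>
     linear_on_polys V 4 E \<and>
     E 1 = 1 \<and>
     (\<forall>i\<in>V. \<forall>q\<in>polys V 2. E (((xvar i)^2 - xvar i) * q) = 0) \<and>
     (\<forall>i\<in>V. \<forall>j\<in>V. \<forall>q\<in>polys V 2. i \<noteq> j \<and> \<not> adj i j \<longrightarrow> E (xvar i * xvar j * q) = 0) \<and>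
     (\<forall>q\<in>polys V 2. E (q^2) \<ge> 0)"

definition FK_pseudomoments4 ::
    "'v set \<Rightarrow> ('v \<Rightarrow> 'v \<Rightarrow> bool) \<Rightarrow> ('v rpoly \<Rightarrow> real) \<Rightarrow> bool" where
  "FK_pseudomoments4 V adj E \<longleftrightarrow>
     (\<exists>\<alpha>::nat \<Rightarrow> real. \<alpha> 0 = 1 \<and>
        (\<forall>m. Poly_Mapping.keys m \<subseteq> V \<and> mdeg m \<le> 4 \<longrightarrow>
           E (monomial m) = (if clique V adj (Poly_Mapping.keys m)
                         then \<alpha> (card (Poly_Mapping.keys m)) else 0)))"

text \<open>For finite \<^term>\<open>V\<close> the supremum is attained, as the lemma \<open>FK4_attained\<close> shows.\<close>

definition FK4 :: "'v set \<Rightarrow> ('v \<Rightarrow> 'v \<Rightarrow> bool) \<Rightarrow> real" where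
  "FK4 V adj =
     (SUP E \<in> {E. pseudoexpectation4 V adj E \<and> FK_pseudomoments4 V adj E}. \<Sum>i\<in>V. E (xvar i))"


section \<open>Paley graphs\<close>

definition paley_vertices :: "nat \<Rightarrow> int set" where
  "paley_vertices p = {0..<int p}"

definition paley_adj :: "nat \<Rightarrow> int \<Rightarrow> int \<Rightarrow> bool" where
  "paley_adj p a b \<longleftrightarrow> \<not> [a - b = 0] (mod int p) \<and> QuadRes (int p) (a - b)"


section \<open>The supremum is a maximum\<close>

lemma mdeg_superset:
  assumes "finite A" "Poly_Mapping.keys m \<subseteq> A"
  shows "mdeg m = (\<Sum>i\<in>A. Poly_Mapping.lookup m i)"
  unfolding mdeg_def using assms by (intro sum.mono_neutral_left) (auto simp: in_keys_iff)

lemma mdeg_add: "mdeg (m + n) = mdeg m + mdeg n"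
proof -
  let ?A = "Poly_Mapping.keys m \<union> Poly_Mapping.keys n"
  have "mdeg (m + n) = (\<Sum>i\<in>?A. Poly_Mapping.lookup (m + n) i)"
    by (rule mdeg_superset) (auto dest: set_mp[OF keys_add])
  also have "\<dots> = mdeg m + mdeg n"
    by (simp add: lookup_add sum.distrib mdeg_superset[of ?A])
  finally show ?thesis .
qed

lemma keys_add_nat: "Poly_Mapping.keys (m + n :: 'v monom) = Poly_Mapping.keys m \<union> Poly_Mapping.keys n"
  by (auto simp: in_keys_iff lookup_add)

lemma polys_add: "f \<in> polys V d \<Longrightarrow> g \<in> polys V d \<Longrightarrow> f + g \<in> polys V d"
  using keys_add[of f g] by (auto simp: polys_def)

lemma polys_diff: "f \<in> polys V d \<Longrightarrow> g \<in> polys V d \<Longrightarrow> f - g \<in> polys V d"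
  using keys_diff[of f g] by (auto simp: polys_def)

lemma polys_mult:
  assumes "f \<in> polys V c" "g \<in> polys V d" "c + d \<le> e"
  shows "f * g \<in> polys V e"
proof -
  have "Poly_Mapping.keys m \<subseteq> V \<and> mdeg m \<le> e" if "m \<in> Poly_Mapping.keys (f * g)" for m
  proof -
    obtain a b where m: "m = a + b" and ab: "a \<in> Poly_Mapping.keys f" "b \<in> Poly_Mapping.keys g"
      using keys_mult[of f g] \<open>m \<in> _\<close> by blast
    have "Poly_Mapping.keys a \<subseteq> V" "mdeg a \<le> c" "Poly_Mapping.keys b \<subseteq> V" "mdeg b \<le> d"
      using assms(1,2) ab by (simp_all add: polys_def)
    then show ?thesis
      using assms(3) by (simp add: m keys_add_nat mdeg_add)
  qed
  then show ?thesis by (simp add: polys_def)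
qed

lemma polys_single:
  "Poly_Mapping.keys m \<subseteq> V \<Longrightarrow> mdeg m \<le> d \<Longrightarrow> Poly_Mapping.single m c \<in> polys V d"
  by (simp add: polys_def)

lemma polys_monomial: "Poly_Mapping.keys m \<subseteq> V \<Longrightarrow> mdeg m \<le> d \<Longrightarrow> monomial m \<in> polys V d"
  unfolding monomial_def by (rule polys_single)

lemma mdeg_single: "mdeg (Poly_Mapping.single i k) = k"
  by (cases "k = 0") (simp_all add: mdeg_def)

lemma polys_xvar: "i \<in> V \<Longrightarrow> 1 \<le> d \<Longrightarrow> xvar i \<in> polys V d"
  unfolding xvar_def by (rule polys_monomial) (simp_all add: mdeg_single)

lemma polys_le: "f \<in> polys V c \<Longrightarrow> c \<le> d \<Longrightarrow> f \<in> polys V d"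
  by (auto simp: polys_def intro: order_trans)

lemma polys_0: "0 \<in> polys V d"
  by (simp add: polys_def)

lemma polys_1: "1 \<in> polys V d"
  by (simp add: polys_def mdeg_def)

lemma linear_on_polys_0:
  assumes "linear_on_polys V d E" shows "E 0 = 0"
proof -
  have "E (0 + 0) = E 0 + E 0"
    using assms polys_0 unfolding linear_on_polys_def by blast
  then show ?thesis by simp
qed

lemma linear_on_polys_sum:
  assumes "linear_on_polys V d E" "finite A" "\<And>a. a \<in> A \<Longrightarrow> f a \<in> polys V d"
  shows "(\<Sum>a\<in>A. f a) \<in> polys V d \<and> E (\<Sum>a\<in>A. f a) = (\<Sum>a\<in>A. E (f a))"
  using assms(2,3)
proof (induction A rule: finite_induct)
  case empty
  then show ?case by (simp add: polys_0 linear_on_polys_0[OF assms(1)])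
next
  case (insert a A)
  then show ?case
    using assms(1) by (auto simp: linear_on_polys_def polys_add)
qed

lemma rpoly_expand:
  fixes f :: "'v rpoly"
  shows "f = (\<Sum>m\<in>Poly_Mapping.keys f. const_poly (Poly_Mapping.lookup f m) * monomial m)"
  by (rule poly_mapping_eqI)
     (auto simp: lookup_sum const_poly_def monomial_def mult_single lookup_single when_def
       in_keys_iff)

lemma linear_on_polys_expand:
  assumes "linear_on_polys V d E" "f \<in> polys V d"
  shows "E f = (\<Sum>m\<in>Poly_Mapping.keys f. Poly_Mapping.lookup f m * E (monomial m))"
proof -
  have m: "monomial m \<in> polys V d" if "m \<in> Poly_Mapping.keys f" for m
    using assms(2) that by (intro polys_monomial) (auto simp: polys_def)
  have "E f = E (\<Sum>m\<in>Poly_Mapping.keys f. const_poly (Poly_Mapping.lookup f m) * monomial m)"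
    using rpoly_expand[of f] by simp
  also have "\<dots> = (\<Sum>m\<in>Poly_Mapping.keys f. E (const_poly (Poly_Mapping.lookup f m) * monomial m))"
  proof (rule conjunct2[OF linear_on_polys_sum[OF assms(1)]])
    fix m assume "m \<in> Poly_Mapping.keys f"
    from m[OF this] show "const_poly (Poly_Mapping.lookup f m) * monomial m \<in> polys V d"
      by (auto simp: polys_def const_poly_def monomial_def mult_single split: if_splits)
  qed simp
  also have "\<dots> = (\<Sum>m\<in>Poly_Mapping.keys f. Poly_Mapping.lookup f m * E (monomial m))"
    using assms(1) m by (intro sum.cong) (auto simp: linear_on_polys_def)
  finally show ?thesis .
qed

definition fk_coeff :: "real \<times> real \<times> real \<times> real \<Rightarrow> nat \<Rightarrow> real" where
  "fk_coeff a k = (case a of (a1, a2, a3, a4) \<Rightarrow>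
     if k = 0 then 1 else if k = 1 then a1 else if k = 2 then a2 else if k = 3 then a3 else a4)"

definition fk_moment :: "'v set \<Rightarrow> ('v \<Rightarrow> 'v \<Rightarrow> bool) \<Rightarrow> real \<times> real \<times> real \<times> real \<Rightarrow> 'v monom \<Rightarrow> real" where
  "fk_moment V adj a m = (if clique V adj (Poly_Mapping.keys m)
     then fk_coeff a (card (Poly_Mapping.keys m)) else 0)"

definition fk_functional ::
    "'v set \<Rightarrow> ('v \<Rightarrow> 'v \<Rightarrow> bool) \<Rightarrow> real \<times> real \<times> real \<times> real \<Rightarrow> 'v rpoly \<Rightarrow> real" where
  "fk_functional V adj a f =
     (\<Sum>m\<in>Poly_Mapping.keys f. Poly_Mapping.lookup f m * fk_moment V adj a m)"

lemma fk_functional_monomial: "fk_functional V adj a (monomial m) = fk_moment V adj a m"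
  by (simp add: fk_functional_def monomial_def)

lemma fk_functional_linear: "linear_on_polys V d (fk_functional V adj a)"
proof -
  have "fk_functional V adj a (f + g) = fk_functional V adj a f + fk_functional V adj a g" for f g
    unfolding fk_functional_def
    by (rule setsum_keys_plus_distrib) (simp_all add: distrib_right)
  moreover have "fk_functional V adj a (const_poly c * f) = c * fk_functional V adj a f"
    for c f
  proof (cases "c = 0")
    case True
    then show ?thesis by (simp add: const_poly_def fk_functional_def)
  next
    case False
    have l: "Poly_Mapping.lookup (const_poly c * f) m = c * Poly_Mapping.lookup f m" for m
      unfolding const_poly_def mult_map_scale_conv_mult[symmetric]
      by (simp add: Poly_Mapping.map.rep_eq when_def)
    then have "Poly_Mapping.keys (const_poly c * f) = Poly_Mapping.keys f"
      using False by (auto simp: in_keys_iff)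
    then show ?thesis by (simp add: fk_functional_def l sum_distrib_left mult.assoc)
  qed
  ultimately show ?thesis by (simp add: linear_on_polys_def)
qed

lemma continuous_fk_functional [continuous_intros]:
  "continuous_on A (\<lambda>a. fk_functional V adj a f)"
proof -
  have "continuous_on A (\<lambda>a. fk_coeff a k)" for k
    unfolding fk_coeff_def case_prod_unfold
    by (cases "k = 0"; cases "k = 1"; cases "k = 2"; cases "k = 3") (simp_all add: continuous_intros)
  then have "continuous_on A (\<lambda>a. fk_moment V adj a m)" for m
    unfolding fk_moment_def by (cases "clique V adj (Poly_Mapping.keys m)") auto
  then show ?thesis
    unfolding fk_functional_def by (intro continuous_intros)
qed

lemma FK_pseudomoments4_fk_functional: "FK_pseudomoments4 V adj (fk_functional V adj a)"
proof -
  have "fk_coeff a 0 = 1" by (simp add: fk_coeff_def case_prod_unfold)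
  then show ?thesis
    unfolding FK_pseudomoments4_def
    by (intro exI[of _ "fk_coeff a"]) (simp add: fk_functional_monomial fk_moment_def)
qed

lemma closed_pseudoexpectation4:
  "closed {a. pseudoexpectation4 V adj (fk_functional V adj a)}"
proof -
  have "{a. pseudoexpectation4 V adj (fk_functional V adj a)} =
     {a. fk_functional V adj a 1 = 1} \<inter>
     (\<Inter>i\<in>V. \<Inter>q\<in>polys V 2. {a. fk_functional V adj a (((xvar i)^2 - xvar i) * q) = 0}) \<inter>
     (\<Inter>i\<in>V. \<Inter>j\<in>{j\<in>V. i \<noteq> j \<and> \<not> adj i j}. \<Inter>q\<in>polys V 2. {a. fk_functional V adj a (xvar i * xvar j * q) = 0}) \<inter>
     (\<Inter>q\<in>polys V 2. {a. 0 \<le> fk_functional V adj a (q^2)})"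
    unfolding pseudoexpectation4_def by (auto simp: fk_functional_linear)
  also have "closed \<dots>"
    by (intro closed_Int closed_INT ballI closed_Collect_eq closed_Collect_le continuous_intros)
  finally show ?thesis .
qed

lemma pseudoexpectation4_cong:
  assumes "pseudoexpectation4 V adj E" "linear_on_polys V 4 F" "\<And>f. f \<in> polys V 4 \<Longrightarrow> F f = E f"
  shows "pseudoexpectation4 V adj F"
proof -
  have x: "xvar i * xvar j \<in> polys V 2" if "i \<in> V" "j \<in> V" for i j
    using that by (intro polys_mult[of _ V 1 _ 1] polys_xvar) auto
  have 1: "((xvar i)^2 - xvar i) * q \<in> polys V 4" if "i \<in> V" "q \<in> polys V 2" for i q
    using polys_mult[OF polys_diff[OF x[OF that(1) that(1)] polys_xvar[OF that(1)]] that(2), of 4]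
    by (simp add: power2_eq_square)
  have 2: "xvar i * xvar j * q \<in> polys V 4" if "i \<in> V" "j \<in> V" "q \<in> polys V 2" for i j q
    using polys_mult[OF x[OF that(1,2)] that(3), of 4] by simp
  have 3: "q^2 \<in> polys V 4" if "q \<in> polys V 2" for q
    using polys_mult[OF that that, of 4] by (simp add: power2_eq_square)
  show ?thesis
    using assms(1,2) unfolding pseudoexpectation4_def
    by (simp add: assms(3) 1 2 3 polys_1)
qed

definition set_monom :: "'v set \<Rightarrow> 'v monom" where
  "set_monom A = (\<Sum>i\<in>A. Poly_Mapping.single i 1)"

lemma set_monom:
  assumes "finite A"
  shows keys_set_monom: "Poly_Mapping.keys (set_monom A) = A"
    and mdeg_set_monom: "mdeg (set_monom A) = card A"
proof -
  have "Poly_Mapping.keys (set_monom A) = A \<and> mdeg (set_monom A) = card A"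
    using assms
    by (induction A rule: finite_induct)
       (auto simp: set_monom_def keys_add_nat mdeg_add mdeg_single mdeg_def[of 0])
  then show "Poly_Mapping.keys (set_monom A) = A" "mdeg (set_monom A) = card A" by auto
qed

lemma monomial_mult: "monomial m * monomial n = monomial (m + n)"
  by (simp add: monomial_def mult_single)

lemma pseudoexpectation4_monomial_bound:
  assumes E: "pseudoexpectation4 V adj E"
    and m: "Poly_Mapping.keys m \<subseteq> V" "mdeg m \<le> 2" and n: "Poly_Mapping.keys n \<subseteq> V" "mdeg n \<le> 2"
  shows "2 * \<bar>E (monomial (m + n))\<bar> \<le> E (monomial (m + m)) + E (monomial (n + n))"
proof -
  have lin: "linear_on_polys V 4 E" and pos: "\<And>q. q \<in> polys V 2 \<Longrightarrow> E (q^2) \<ge> 0"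
    using E by (auto simp: pseudoexpectation4_def)
  have P: "monomial (m + m) \<in> polys V 4" "monomial (m + n) \<in> polys V 4" "monomial (n + n) \<in> polys V 4"
    using m n by (auto intro!: polys_monomial simp: keys_add_nat mdeg_add)
  have C: "const_poly c * monomial (m + n) \<in> polys V 4" for c
    using P(2) by (auto simp: polys_def const_poly_def monomial_def mult_single split: if_splits)
  have S: "E (monomial m ^ 2 + (const_poly c * (monomial m * monomial n) + monomial n ^ 2)) =
      E (monomial (m + m)) + (c * E (monomial (m + n)) + E (monomial (n + n)))" for c
    using lin P C[of c] polys_add[OF C[of c] P(3)]
    by (simp add: linear_on_polys_def power2_eq_square monomial_mult)
  have c2: "const_poly 2 = (2 :: 'a rpoly)" "const_poly (-2) = (-2 :: 'a rpoly)"
    unfolding const_poly_def by (simp_all add: single_numeral single_uminus)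
  have mn: "monomial m \<in> polys V 2" "monomial n \<in> polys V 2"
    using m n by (auto intro: polys_monomial)
  have "(monomial m + monomial n)^2 = monomial m ^ 2 + (const_poly 2 * (monomial m * monomial n) + monomial n ^ 2)"
    "(monomial m - monomial n)^2 = monomial m ^ 2 + (const_poly (-2) * (monomial m * monomial n) + monomial n ^ 2)"
    unfolding c2 by (simp_all add: power2_eq_square algebra_simps)
  then show ?thesis
    using pos[OF polys_add[OF mn]] pos[OF polys_diff[OF mn]] by (simp add: S)
qed

lemma FK4_value_bounds:
  assumes V: "finite V" and E: "pseudoexpectation4 V adj E" and a0: "\<alpha> 0 = 1"
    and a: "\<And>m. Poly_Mapping.keys m \<subseteq> V \<Longrightarrow> mdeg m \<le> 4 \<Longrightarrow>
      E (monomial m) = (if clique V adj (Poly_Mapping.keys m) then \<alpha> (card (Poly_Mapping.keys m)) else 0)"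
    and T: "clique V adj T" "card T \<le> 4"
  shows "\<bar>\<alpha> (card T)\<bar> \<le> 1"
proof -
  have sub: "clique V adj B" if "clique V adj A" "B \<subseteq> A" for A B
    using that by (auto simp: clique_def)
  have fin: "finite A" if "clique V adj A" for A
    using that finite_subset[OF _ V] by (simp add: clique_def)
  have key: "2 * \<bar>\<alpha> (card (A \<union> B))\<bar> \<le> \<alpha> (card A) + \<alpha> (card B)"
    if "clique V adj (A \<union> B)" "card A \<le> 2" "card B \<le> 2" for A B
  proof -
    have AB: "finite A" "finite B" "clique V adj A" "clique V adj B" "A \<subseteq> V" "B \<subseteq> V"
      using sub[OF that(1), of A] sub[OF that(1), of B] fin[OF that(1)] that(1)
      by (simp_all add: clique_def)
    have "2 * \<bar>E (monomial (set_monom A + set_monom B))\<bar> \<le>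
        E (monomial (set_monom A + set_monom A)) + E (monomial (set_monom B + set_monom B))"
      using AB that by (intro pseudoexpectation4_monomial_bound[OF E]) (auto simp: set_monom)
    then show ?thesis
      using AB that by (simp add: a keys_add_nat mdeg_add set_monom)
  qed
  have one: "\<bar>\<alpha> (card A)\<bar> \<le> 1" if "clique V adj A" "card A \<le> 1" for A
    using key[of A "{}"] key[of A A] that a0 by simp
  have two: "\<bar>\<alpha> (card A)\<bar> \<le> 1" if A: "clique V adj A" "card A \<le> 2" for A
  proof -
    obtain B where B: "B \<subseteq> A" "card B = card A div 2"
      by (rule obtain_subset_with_card_n[OF div_le_dividend, of A 2])
    have "card (A - B) = card A - card A div 2"
      using B fin[OF A(1)] by (simp add: card_Diff_subset finite_subset)
    then have c: "card B \<le> 1" "card (A - B) \<le> 1" "B \<union> (A - B) = A"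
      using A(2) B by auto
    have "\<bar>\<alpha> (card B)\<bar> \<le> 1" "\<bar>\<alpha> (card (A - B))\<bar> \<le> 1"
      using one[OF sub[OF A(1) B(1)] c(1)] one[OF sub[OF A(1) Diff_subset] c(2)] by auto
    then show ?thesis using key[of B "A - B"] c A(1) by simp
  qed
  obtain B where B: "B \<subseteq> T" "card B = card T div 2"
    by (rule obtain_subset_with_card_n[OF div_le_dividend, of T 2])
  have "card (T - B) = card T - card T div 2"
    using B fin[OF T(1)] by (simp add: card_Diff_subset finite_subset)
  then have c: "card B \<le> 2" "card (T - B) \<le> 2" "B \<union> (T - B) = T"
    using T(2) B by auto
  have "\<bar>\<alpha> (card B)\<bar> \<le> 1" "\<bar>\<alpha> (card (T - B))\<bar> \<le> 1"
    using two[OF sub[OF T(1) B(1)] c(1)] two[OF sub[OF T(1) Diff_subset] c(2)] by auto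
  then show ?thesis using key[of B "T - B"] c T(1) by simp
qed

lemma FK_as_fk_functional:
  assumes V: "finite V" and E: "pseudoexpectation4 V adj E" and F: "FK_pseudomoments4 V adj E"
  obtains a where "a \<in> {-1..1} \<times> {-1..1} \<times> {-1..1} \<times> {-1..1}"
    "\<And>f. f \<in> polys V 4 \<Longrightarrow> fk_functional V adj a f = E f"
proof -
  obtain \<alpha> where a0: "\<alpha> 0 = 1" and a: "\<And>m. Poly_Mapping.keys m \<subseteq> V \<Longrightarrow> mdeg m \<le> 4 \<Longrightarrow>
      E (monomial m) = (if clique V adj (Poly_Mapping.keys m) then \<alpha> (card (Poly_Mapping.keys m)) else 0)"
    using F unfolding FK_pseudomoments4_def by blast
  define b where "b k = (if \<exists>T. clique V adj T \<and> card T = k then \<alpha> k else 0)" for k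
  define a' where "a' = (b 1, b 2, b 3, b 4)"
  have b: "b k \<in> {-1..1}" if "k \<le> 4" for k
    using FK4_value_bounds[OF V E a0 a] that by (auto simp: b_def abs_le_iff)
  have cf: "fk_coeff a' k = b k" if "k \<le> 4" for k
  proof -
    have "clique V adj {}" by (simp add: clique_def)
    then have "b 0 = 1" using a0 by (auto simp: b_def intro: exI[of _ "{}"])
    moreover have "k = 0 \<or> k = 1 \<or> k = 2 \<or> k = 3 \<or> k = 4" using that by linarith
    ultimately show ?thesis by (auto simp: fk_coeff_def a'_def)
  qed
  have mm: "fk_moment V adj a' m = E (monomial m)" if m: "Poly_Mapping.keys m \<subseteq> V" "mdeg m \<le> 4" for m
  proof -
    have "card (Poly_Mapping.keys m) = (\<Sum>i\<in>Poly_Mapping.keys m. 1)" by simp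
    also have "\<dots> \<le> mdeg m"
      unfolding mdeg_def by (intro sum_mono) (simp add: in_keys_iff)
    finally have "card (Poly_Mapping.keys m) \<le> 4" using m by simp
    then show ?thesis using a[OF m] by (auto simp: fk_moment_def cf b_def)
  qed
  have "fk_functional V adj a' f = E f" if f: "f \<in> polys V 4" for f
  proof -
    have "linear_on_polys V 4 E" using E by (simp add: pseudoexpectation4_def)
    from linear_on_polys_expand[OF this f] show ?thesis
      unfolding fk_functional_def using f by (auto simp: polys_def mm intro!: sum.cong)
  qed
  moreover have "a' \<in> {-1..1} \<times> {-1..1} \<times> {-1..1} \<times> {-1..1}"
    using b[of 1] b[of 2] b[of 3] b[of 4] by (simp add: a'_def)
  ultimately show ?thesis using that by blast
qed

lemma lookup_mult_0:
  fixes f g :: "'v rpoly"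
  shows "Poly_Mapping.lookup (f * g) 0 = Poly_Mapping.lookup f 0 * Poly_Mapping.lookup g 0"
proof -
  have z: "(0 = l + q) \<longleftrightarrow> l = 0 \<and> q = 0" for l q :: "'v monom"
  proof
    assume "0 = l + q"
    then have "Poly_Mapping.keys l \<union> Poly_Mapping.keys q = {}"
      using keys_add_nat[of l q] by simp
    then show "l = 0 \<and> q = 0" by simp
  qed simp
  have "Poly_Mapping.lookup (f * g) 0 =
      (\<Sum>l. Poly_Mapping.lookup f l * (\<Sum>q. Poly_Mapping.lookup g q when l = 0 \<and> q = 0))"
    unfolding lookup_mult z ..
  also have "\<dots> = (\<Sum>l. (Poly_Mapping.lookup f l * Poly_Mapping.lookup g 0) when l = 0)"
  proof (rule Sum_any.cong)
    fix l
    show "Poly_Mapping.lookup f l * (\<Sum>q. Poly_Mapping.lookup g q when l = 0 \<and> q = 0) =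
        ((Poly_Mapping.lookup f l * Poly_Mapping.lookup g 0) when l = 0)"
      by (cases "l = 0") simp_all
  qed
  also have "\<dots> = Poly_Mapping.lookup f 0 * Poly_Mapping.lookup g 0" by simp
  finally show ?thesis .
qed

lemma pseudoexpectation4_0: "pseudoexpectation4 V adj (fk_functional V adj (0, 0, 0, 0))"
proof -
  have "fk_functional V adj (0, 0, 0, 0) f = Poly_Mapping.lookup f 0" for f
  proof -
    have "fk_moment V adj (0, 0, 0, 0) m = (if m = 0 then 1 else 0)" for m
      by (auto simp: fk_moment_def fk_coeff_def clique_def)
    then have "fk_functional V adj (0, 0, 0, 0) f =
        (\<Sum>m\<in>Poly_Mapping.keys f. if m = 0 then Poly_Mapping.lookup f m else 0)"
      unfolding fk_functional_def by (intro sum.cong) auto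
    also have "\<dots> = Poly_Mapping.lookup f 0"
      by (simp add: in_keys_iff)
    finally show ?thesis .
  qed
  moreover have "Poly_Mapping.lookup (xvar i) 0 = 0" for i :: 'a
  proof -
    have "mdeg (Poly_Mapping.single i (1::nat)) \<noteq> mdeg 0"
      by (simp only: mdeg_single) (simp add: mdeg_def)
    then have "Poly_Mapping.single i (1::nat) \<noteq> 0" by metis
    then show ?thesis by (simp add: xvar_def monomial_def lookup_single)
  qed
  ultimately show ?thesis
    unfolding pseudoexpectation4_def
    by (auto simp: fk_functional_linear lookup_mult_0 power2_eq_square lookup_minus)
qed

lemma FK4_attained:
  assumes V: "finite V"
  obtains E where "pseudoexpectation4 V adj E" "FK_pseudomoments4 V adj E"
    "(\<Sum>i\<in>V. E (xvar i)) = FK4 V adj"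
    "\<And>F. pseudoexpectation4 V adj F \<Longrightarrow> FK_pseudomoments4 V adj F \<Longrightarrow>
       (\<Sum>i\<in>V. F (xvar i)) \<le> (\<Sum>i\<in>V. E (xvar i))"
proof -
  let ?B = "{-1..1::real} \<times> {-1..1::real} \<times> {-1..1::real} \<times> {-1..1::real}"
  define K where "K = ?B \<inter> {a. pseudoexpectation4 V adj (fk_functional V adj a)}"
  have "compact K"
    unfolding K_def
    by (intro compact_Int_closed compact_Times compact_Icc closed_pseudoexpectation4)
  moreover have "(0, 0, 0, 0) \<in> K" by (simp add: K_def pseudoexpectation4_0)
  moreover have "continuous_on K (\<lambda>a. \<Sum>i\<in>V. fk_functional V adj a (xvar i))"
    by (intro continuous_intros)
  ultimately obtain a where a: "a \<in> K" and max: "\<And>b. b \<in> K \<Longrightarrow>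
      (\<Sum>i\<in>V. fk_functional V adj b (xvar i)) \<le> (\<Sum>i\<in>V. fk_functional V adj a (xvar i))"
    using continuous_attains_sup[of K "\<lambda>a. \<Sum>i\<in>V. fk_functional V adj a (xvar i)"] by blast
  let ?E = "fk_functional V adj a"
  have E: "pseudoexpectation4 V adj ?E" "FK_pseudomoments4 V adj ?E"
    using a by (auto simp: K_def FK_pseudomoments4_fk_functional)
  have le: "(\<Sum>i\<in>V. F (xvar i)) \<le> (\<Sum>i\<in>V. ?E (xvar i))"
    if F: "pseudoexpectation4 V adj F" "FK_pseudomoments4 V adj F" for F
  proof -
    obtain b where b: "b \<in> ?B" and eq: "\<And>f. f \<in> polys V 4 \<Longrightarrow> fk_functional V adj b f = F f"
      using FK_as_fk_functional[OF V F] by blast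
    have "b \<in> K"
      using b pseudoexpectation4_cong[OF F(1) fk_functional_linear eq] by (simp add: K_def)
    from max[OF this] show ?thesis by (simp add: eq polys_xvar)
  qed
  have "FK4 V adj = (\<Sum>i\<in>V. ?E (xvar i))"
    unfolding FK4_def by (rule cSup_eq_maximum) (use E le in auto)
  then show ?thesis using that[OF E] le by simp
qed

end

theory Submission
  imports Defs "HOL-Real_Asymp.Real_Asymp"
begin

text \<open>
  Write \<open>S\<close> for the matrix of Legendre symbols of differences, so that \<open>S\<^sup>2 = p I - J\<close>.  For Feige-Krauthgamer
  moments, the expectation of the square of \<open>y\<^sub>0 + \<Sum> y\<^sub>i x\<^sub>i + \<Sum> Y\<^sub>i\<^sub>j x\<^sub>i x\<^sub>j\<close> is an explicit quadratic form; expanding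
  adjacency as \<open>(1 + S) / 2\<close> splits it into the sums, the degrees of \<open>Y\<close>, the wedges \<open>\<Sum> Y\<^sub>k\<^sub>l S\<^sub>i\<^sub>k S\<^sub>i\<^sub>l\<close>
  and small remainders, all of which are controlled by \<open>S\<^sup>2 = p I - J\<close> except the form with kernel
  \<open>S\<^sub>i\<^sub>k S\<^sub>i\<^sub>l S\<^sub>j\<^sub>k S\<^sub>j\<^sub>l\<close>.

  That four-cycle form has norm \<open>O(p\<^bsup>5/4\<^esup>)\<close>.  The square of its kernel has entries \<open>c\<^sup>2\<close> with \<open>c\<close> a complete
  character sum of a split monic quartic, and the fourth moment of \<open>c\<close> is \<open>O(p\<^sup>6)\<close> because it is at most a
  constant times the fourth moment over all monic quartics, whose values at four points are independent.
  Dilation invariance makes all nonzero frequencies carry equal mass, which gains a factor \<open>p\<close>; the zero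
  frequency is moved away by the inversion \<open>x \<mapsto> 1/x\<close>, under which the kernel is invariant.

  With moments of order \<open>\<kappa>\<^sup>k\<close> for \<open>\<kappa> = c p\<^bsup>-2/3\<^esup>\<close> every remainder is dominated, which gives the lower bound.
  For the upper bound, testing positivity on \<open>x \<cdot> x\<^sub>c + q \<Sum> S\<^sub>c\<^sub>i S\<^sub>c\<^sub>j x\<^sub>i x\<^sub>j + p \<Sum> x\<^sub>c x\<^sub>j\<close> correlates the wedges
  with the lower-order terms and forces \<open>\<alpha>\<^sub>1 = O(p\<^bsup>-2/3\<^esup>)\<close>.
\<close>

section \<open>The quadratic character modulo a prime\<close>

text \<open>The exponents come from one comparison of scales. With moments of order
  \<open>\<kappa>^k\<close> the wedges couple \<open>y\<close> and \<open>Y\<close> with strength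
  \<open>\<kappa>^3 p\<close>, against diagonal terms of order \<open>\<kappa>\<close> and
  \<open>\<kappa>^2\<close>. Positivity therefore needs \<open>\<kappa>^(3/2) p\<close> bounded,
  that is \<open>\<kappa> = O(p^(-2/3))\<close>, and the value \<open>p \<kappa>\<close> is then
  \<open>O(p^(1/3))\<close>. The four-cycle form enters as \<open>\<kappa>^4\<close> times its norm,
  against \<open>\<kappa>^2\<close>, so at this scale it is harmless as long as its norm is
  \<open>O(p^(4/3))\<close>. Cauchy-Schwarz with the fourth moment alone gives
  \<open>p^(3/2)\<close>, and the same argument would then leave a gap between
  \<open>p^(1/4)\<close> and \<open>p^(1/2)\<close>. This is the obstacle behind the Fourier
  analysis along translations and the inversion: together they lower the exponent to 5/4, which is
  less than 4/3.\<close>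

locale paley =
  fixes p :: nat
  assumes prime_p: "prime p" and p_mod_4: "[p = 1] (mod 4)"
begin

abbreviation P :: int where "P \<equiv> int p"
abbreviation V :: "int set" where "V \<equiv> paley_vertices p"

definition chi :: "int \<Rightarrow> real" where "chi a = of_int (Legendre a P)"

lemma p_ge_5: "p \<ge> 5"
proof -
  have "p mod 4 = 1" "p \<ge> 2" using p_mod_4 prime_ge_2_nat[OF prime_p] by (simp_all add: cong_def)
  then show ?thesis by presburger
qed

lemma P_pos: "P > 0" and prime_P: "prime P"
  using p_ge_5 prime_p by simp_all

lemma dvd_mult_P: "P dvd a * b \<longleftrightarrow> P dvd a \<or> P dvd b"
  using prime_P by (rule prime_dvd_mult_iff)

lemma in_V_iff: "x \<in> V \<longleftrightarrow> 0 \<le> x \<and> x < P"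
  by (simp add: paley_vertices_def)

lemma finite_V [simp]: "finite V" and card_V [simp]: "card V = p"
  by (simp_all add: paley_vertices_def)

lemma mod_in_V [simp]: "a mod P \<in> V" using P_pos by (simp add: in_V_iff)

lemma zero_in_V [simp]: "0 \<in> V" using P_pos by (simp add: in_V_iff)

lemma mod_V [simp]: "x \<in> V \<Longrightarrow> x mod P = x" by (simp add: in_V_iff)

lemma V_eq_iff: "x \<in> V \<Longrightarrow> y \<in> V \<Longrightarrow> x = y \<longleftrightarrow> P dvd x - y"
  by (metis mod_V mod_eq_dvd_iff)

lemma coprime_P: "coprime a P \<longleftrightarrow> \<not> P dvd a"
  using prime_P by (metis coprime_commute prime_imp_coprime_int not_prime_unit coprime_absorb_left)

lemma bij_affine:
  assumes "\<not> P dvd a"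
  shows "bij_betw (\<lambda>x. (a * x + b) mod P) V V"
proof -
  have "inj_on (\<lambda>x. (a * x + b) mod P) V"
  proof (rule inj_onI)
    fix x y assume xy: "x \<in> V" "y \<in> V" and eq: "(a * x + b) mod P = (a * y + b) mod P"
    from eq have "P dvd (a * x + b) - (a * y + b)" by (simp add: mod_eq_dvd_iff)
    also have "(a * x + b) - (a * y + b) = a * (x - y)" by (simp add: algebra_simps)
    finally show "x = y" using assms by (simp add: V_eq_iff[OF xy] dvd_mult_P)
  qed
  moreover have "(\<lambda>x. (a * x + b) mod P) ` V = V"
    by (rule endo_inj_surj) (use calculation in auto)
  ultimately show ?thesis by (simp add: bij_betw_def)
qed

lemma sum_affine:
  fixes f :: "int \<Rightarrow> 'b::comm_monoid_add"
  assumes "\<not> P dvd a" "\<And>x. f (x mod P) = f x"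
  shows "(\<Sum>x\<in>V. f (a * x + b)) = (\<Sum>x\<in>V. f x)"
  using sum.reindex_bij_betw[OF bij_affine[OF assms(1), of b], of f] assms(2) by simp

lemma sum_shift:
  fixes f :: "int \<Rightarrow> 'b::comm_monoid_add"
  assumes "\<And>x. f (x mod P) = f x"
  shows "(\<Sum>x\<in>V. f (x + b)) = (\<Sum>x\<in>V. f x)"
  using sum_affine[of 1 f b] assms p_ge_5 by simp

lemma chi_mod [simp]: "chi (a mod P) = chi a"
  by (simp add: chi_def Legendre_def QuadRes_def cong_def)

lemma chi_cong: "a mod P = b mod P \<Longrightarrow> chi a = chi b"
  by (metis chi_mod)

lemma chi_eq_0_iff: "chi a = 0 \<longleftrightarrow> P dvd a"
  by (simp add: chi_def Legendre_def cong_0_iff)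

lemma chi_values: "chi a = 0 \<or> chi a = 1 \<or> chi a = -1"
  by (simp add: chi_def Legendre_def)

lemma abs_chi_le: "\<bar>chi a\<bar> \<le> 1"
  using chi_values[of a] by auto

lemma chi_square: "\<not> P dvd a \<Longrightarrow> chi a ^ 2 = 1"
  using chi_values[of a] chi_eq_0_iff[of a] by auto

text \<open>Euler's criterion gives the identity only modulo \<open>P\<close>. The two sides are
  integers at distance at most 2 and \<open>p \<ge> 5\<close>, so they agree.\<close>

lemma chi_mult: "chi (a * b) = chi a * chi b"
proof -
  let ?k = "(p - 1) div 2"
  have e: "[Legendre x P = x ^ ?k] (mod P)" for x
    using euler_criterion[OF prime_p] p_ge_5 by simp
  have "[Legendre (a * b) P = Legendre a P * Legendre b P] (mod P)"
    using cong_trans[OF e[of "a * b"]] cong_sym[OF cong_mult[OF e[of a] e[of b]]]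
    by (simp add: power_mult_distrib)
  then have d: "P dvd Legendre (a * b) P - Legendre a P * Legendre b P"
    by (simp add: cong_iff_dvd_diff)
  have "\<bar>Legendre (a * b) P - Legendre a P * Legendre b P\<bar> \<le> 2"
    by (simp add: Legendre_def)
  then have "Legendre (a * b) P - Legendre a P * Legendre b P = 0"
    using zdvd_not_zless[of "\<bar>Legendre (a * b) P - Legendre a P * Legendre b P\<bar>" P] d p_ge_5 by auto
  then show ?thesis unfolding chi_def by (metis eq_iff_diff_eq_0 of_int_mult)
qed

lemma chi_1 [simp]: "chi 1 = 1"
  using p_ge_5 by (auto simp: chi_def Legendre_def QuadRes_def cong_def intro: exI[of _ 1])

text \<open>As \<open>p\<close> is 1 modulo 4, the exponent \<open>(p - 1) div 2\<close> in Euler's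
  criterion is even. The symmetry of the matrix \<open>chi (i - j)\<close> rests on this.\<close>

lemma chi_minus_1: "chi (-1) = 1"
proof -
  let ?k = "(p - 1) div 2"
  have "p mod 4 = 1" using p_mod_4 by (simp add: cong_def)
  then have "even ?k" by presburger
  then have "[Legendre (-1) P = 1] (mod P)"
    using euler_criterion[OF prime_p, of "-1"] p_ge_5 by simp
  then have "P dvd Legendre (-1) P - 1" by (simp add: cong_iff_dvd_diff)
  moreover have "\<bar>Legendre (-1) P - 1\<bar> \<le> 2" by (simp add: Legendre_def)
  ultimately have "Legendre (-1) P - 1 = 0"
    using zdvd_not_zless[of "\<bar>Legendre (-1) P - 1\<bar>" P] p_ge_5 by auto
  then show ?thesis by (simp add: chi_def)
qed

lemma chi_minus: "chi (- a) = chi a"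
  using chi_mult[of "-1" a] by (simp add: chi_minus_1)

lemma chi_diff_commute: "chi (a - b) = chi (b - a)"
  using chi_minus[of "a - b"] by simp

text \<open>The three values of the right-hand side count the single root 0, the two roots
  \<open>y\<close> and \<open>-y\<close> (distinct because \<open>p\<close> is odd), and no root.
  This converts between counts of solutions and character sums.\<close>

lemma card_sqrt: "real (card {s\<in>V. P dvd s^2 - m}) = 1 + chi m"
proof (cases "P dvd m")
  case True
  have "{s\<in>V. P dvd s^2 - m} = {0}"
  proof -
    have "P dvd s^2 - m \<longleftrightarrow> P dvd s" for s
      using True by (simp add: power2_eq_square dvd_mult_P dvd_diff_left_iff)
    then show ?thesis using V_eq_iff[of _ 0] by auto
  qed
  then show ?thesis using True chi_eq_0_iff by simp
next
  case nd: False
  show ?thesis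
  proof (cases "QuadRes P m")
    case True
    then obtain y0 where y0: "[y0^2 = m] (mod P)" by (auto simp: QuadRes_def)
    define y where "y = y0 mod P"
    have y: "y \<in> V" "P dvd y^2 - m"
      using y0 by (auto simp: y_def cong_def mod_eq_dvd_iff[symmetric] power_mod)
    have ny: "\<not> P dvd y"
    proof
      assume "P dvd y" then have "P dvd y^2" by (simp add: power2_eq_square)
      then show False using y(2) nd by (metis dvd_diff_right_iff)
    qed
    have "{s\<in>V. P dvd s^2 - m} = {y, (- y) mod P}"
    proof -
      have "P dvd s^2 - m \<longleftrightarrow> s = y \<or> s = (-y) mod P" if s: "s \<in> V" for s
      proof -
        have "P dvd s^2 - m \<longleftrightarrow> P dvd (s^2 - m) - (y^2 - m)"
          using y(2) by (metis dvd_diff_left_iff)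
        also have "(s^2 - m) - (y^2 - m) = (s - y) * (s - (- y))"
          by (simp add: power2_eq_square algebra_simps)
        also have "P dvd \<dots> \<longleftrightarrow> P dvd s - y \<or> P dvd s - (-y)" by (rule dvd_mult_P)
        also have "P dvd s - (-y) \<longleftrightarrow> s mod P = (-y) mod P" by (rule mod_eq_dvd_iff[symmetric])
        finally show ?thesis using s V_eq_iff[OF s y(1)] by auto
      qed
      then show ?thesis using y(1) by auto
    qed
    moreover have "y \<noteq> (-y) mod P"
    proof
      assume "y = (-y) mod P"
      then have "y mod P = (-y) mod P" by (metis mod_mod_trivial)
      then have "P dvd y - (- y)" by (simp only: mod_eq_dvd_iff)
      then have "P dvd 2 * y" by simp
      then have "P dvd 2" using ny dvd_mult_P by blast
      then show False using p_ge_5 zdvd_not_zless[of 2 P] by simp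
    qed
    moreover have "chi m = 1" using True nd by (simp add: chi_def Legendre_def cong_0_iff)
    ultimately show ?thesis by simp
  next
    case False
    then have "{s\<in>V. P dvd s^2 - m} = {}"
      by (auto simp: QuadRes_def cong_iff_dvd_diff)
    moreover have "chi m = -1" using False nd by (simp add: chi_def Legendre_def cong_0_iff)
    ultimately show ?thesis by simp
  qed
qed

text \<open>Double counting of the pairs \<open>(s, m)\<close> with \<open>m = s^2\<close>: grouped
  by \<open>s\<close> there are \<open>p\<close> of them, grouped by \<open>m\<close> there are
  \<open>p\<close> plus the character sum.\<close>

lemma sum_chi: "(\<Sum>x\<in>V. chi x) = 0"
proof -
  have "(\<Sum>m\<in>V. real (card {s\<in>V. P dvd s^2 - m})) = real (\<Sum>m\<in>V. \<Sum>s\<in>V. if P dvd s^2 - m then 1 else 0)"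
    by (simp add: sum.If_cases Int_def conj_commute)
  also have "(\<Sum>m\<in>V. \<Sum>s\<in>V. if P dvd s^2 - m then 1 else (0::nat)) = (\<Sum>s\<in>V. \<Sum>m\<in>V. if P dvd s^2 - m then 1 else 0)"
    by (rule sum.swap)
  also have "\<dots> = (\<Sum>s\<in>V. 1)"
  proof (rule sum.cong[OF refl])
    fix s
    have "P dvd s^2 - m \<longleftrightarrow> m = s^2 mod P" if "m \<in> V" for m
      using that mod_eq_dvd_iff[of "s^2" P m] by auto
    then have "(\<Sum>m\<in>V. if P dvd s^2 - m then 1 else (0::nat)) = (\<Sum>m\<in>V. if m = s^2 mod P then 1 else 0)"
      by (intro sum.cong) auto
    then show "(\<Sum>m\<in>V. if P dvd s^2 - m then 1 else (0::nat)) = 1" using P_pos by simp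
  qed
  finally show ?thesis by (simp add: card_sqrt sum.distrib)
qed

lemma sum_chi_affine: "\<not> P dvd a \<Longrightarrow> (\<Sum>x\<in>V. chi (a * x + b)) = 0"
  by (simp add: sum_affine sum_chi)

section \<open>Inverses modulo \<open>P\<close> and sums of two shifted characters\<close>

definition minv :: "int \<Rightarrow> int" where "minv a = modular_inverse P a"

lemma minv:
  assumes "\<not> P dvd a"
  shows "minv a \<in> V" "P dvd a * minv a - 1" "\<not> P dvd minv a"
proof -
  show "minv a \<in> V" using P_pos by (simp add: in_V_iff minv_def modular_inverse_int_nonneg modular_inverse_int_less)
  show *: "P dvd a * minv a - 1"
    using cong_modular_inverse1[of a P] assms unfolding coprime_P minv_def cong_iff_dvd_diff by blast
  show "\<not> P dvd minv a"
  proof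
    assume "P dvd minv a"
    then have "P dvd 1" using * by (metis dvd_mult dvd_diff_right_iff)
    then show False using p_ge_5 by simp
  qed
qed

lemma chi_minv: "\<not> P dvd a \<Longrightarrow> chi (minv a) = chi a"
proof -
  assume a: "\<not> P dvd a"
  have "chi (a * minv a) = 1"
    using minv(2)[OF a] chi_cong[of "a * minv a" 1] by (simp add: mod_eq_dvd_iff)
  then show ?thesis using chi_values[of a] chi_values[of "minv a"] by (auto simp: chi_mult)
qed

lemma minv_minv:
  assumes "a \<in> V" "a \<noteq> 0"
  shows "minv (minv a) = a"
  unfolding minv_def[of "minv a"]
proof (rule modular_inverse_int_eqI)
  have "\<not> P dvd a" using V_eq_iff[of a 0] assms by simp
  from minv(2)[OF this] show "[minv a * a = 1] (mod P)" by (simp add: cong_iff_dvd_diff mult.commute)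
qed (use assms in \<open>auto simp: in_V_iff\<close>)

lemma nonzero_V: "a \<in> V - {0} \<Longrightarrow> \<not> P dvd a"
  using V_eq_iff[of a 0] by simp

lemma minv_nonzero: "a \<in> V - {0} \<Longrightarrow> minv a \<in> V - {0}"
  using minv(1,3)[OF nonzero_V, of a] by auto

lemma bij_minv: "bij_betw minv (V - {0}) (V - {0})"
  by (rule bij_betw_byWitness[of _ minv]) (use minv_minv minv_nonzero in auto)

text \<open>For \<open>x \<noteq> 0\<close>, replacing \<open>chi x\<close> by
  \<open>chi (minv x)\<close> turns the product into \<open>chi (1 + c / x)\<close>. Inversion
  permutes the nonzero residues, so what remains is a complete linear sum, which is zero, without
  its term \<open>chi 1 = 1\<close>.\<close>

lemma sum_chi_shift:
  assumes "\<not> P dvd c"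
  shows "(\<Sum>x\<in>V. chi x * chi (x + c)) = -1"
proof -
  have "(\<Sum>x\<in>V. chi x * chi (x + c)) = (\<Sum>x\<in>V-{0}. chi x * chi (x + c))"
    using P_pos chi_eq_0_iff[of 0] by (intro sum.mono_neutral_right) auto
  also have "\<dots> = (\<Sum>x\<in>V-{0}. chi (c * minv x + 1))"
  proof (rule sum.cong[OF refl])
    fix x assume "x \<in> V - {0}"
    then have x: "\<not> P dvd x" by (rule nonzero_V)
    have "chi x * chi (x + c) = chi (minv x * (x + c))" by (simp add: chi_mult chi_minv x)
    also have "\<dots> = chi (c * minv x + 1)"
    proof (rule chi_cong)
      have "minv x * (x + c) - (c * minv x + 1) = x * minv x - 1" by (simp add: algebra_simps)
      then show "minv x * (x + c) mod P = (c * minv x + 1) mod P"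
        using minv(2)[OF x] unfolding mod_eq_dvd_iff by (simp only:)
    qed
    finally show "chi x * chi (x + c) = chi (c * minv x + 1)" .
  qed
  also have "\<dots> = (\<Sum>x\<in>V-{0}. chi (c * x + 1))"
    using sum.reindex_bij_betw[OF bij_minv, of "\<lambda>x. chi (c * x + 1)"] .
  also have "\<dots> = (\<Sum>x\<in>V. chi (c * x + 1)) - chi (c * 0 + 1)"
    using P_pos by (subst sum_diff1) auto
  also have "\<dots> = -1" using sum_chi_affine[OF assms, of 1] by simp
  finally show ?thesis .
qed

text \<open>The entrywise form of \<open>S^2 = p I - J\<close>; off the diagonal it is
  \<open>sum_chi_shift\<close> after a translation.\<close>

lemma sum_chi_two:
  assumes "i \<in> V" "j \<in> V"
  shows "(\<Sum>k\<in>V. chi (i - k) * chi (j - k)) = (if i = j then real p else 0) - 1"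
proof (cases "i = j")
  case True
  have "(\<Sum>k\<in>V. chi (i - k) * chi (j - k)) = (\<Sum>k\<in>V. if k = i then 0 else 1)"
  proof (rule sum.cong[OF refl])
    fix k assume k: "k \<in> V"
    show "chi (i - k) * chi (j - k) = (if k = i then 0 else 1)"
      using chi_square[of "i - k"] chi_eq_0_iff[of "i - k"] V_eq_iff[OF assms(1) k] True
      by (auto simp: power2_eq_square)
  qed
  also have "\<dots> = real p - 1"
    using assms p_ge_5 sum.remove[of V i "\<lambda>k. if k = i then 0 else (1::real)"]
    by (simp add: card_Diff_singleton of_nat_diff)
  finally show ?thesis using True by simp
next
  case False
  have "(\<Sum>k\<in>V. chi (i - k) * chi (j - k)) = (\<Sum>k\<in>V. chi (k + (-i)) * chi (k + (-i) + (i - j)))"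
    by (intro sum.cong) (simp_all add: chi_diff_commute[of _ "_::int"] chi_diff_commute)
  also have "\<dots> = (\<Sum>k\<in>V. chi k * chi (k + (i - j)))"
    by (rule sum_shift[where f = "\<lambda>k. chi k * chi (k + (i - j))"])
       (simp add: chi_cong[OF mod_add_left_eq])
  also have "\<dots> = -1" using False V_eq_iff[OF assms] by (intro sum_chi_shift) simp
  finally show ?thesis using False by simp
qed

end

section \<open>The fourth moment of quartic character sums\<close>

lemma sum_tuple4:
  "(\<Sum>(a, b, c, d)\<in>A \<times> B \<times> C \<times> D. f a b c d) = (\<Sum>a\<in>A. \<Sum>b\<in>B. \<Sum>c\<in>C. \<Sum>d\<in>D. f a b c d)"
  by (simp add: sum.cartesian_product)

context paley
begin

abbreviation V4 :: "(int \<times> int \<times> int \<times> int) set" where "V4 \<equiv> V \<times> V \<times> V \<times> V"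

definition c4 :: "int \<Rightarrow> int \<Rightarrow> int \<Rightarrow> int \<Rightarrow> real" where
  "c4 i j k l = (\<Sum>x\<in>V. chi (x - i) * chi (x - j) * chi (x - k) * chi (x - l))"

definition quartic :: "int \<times> int \<times> int \<times> int \<Rightarrow> int \<Rightarrow> int" where
  "quartic = (\<lambda>(a, b, c, d) x. x^4 + a * x^3 + b * x^2 + c * x + d)"

text \<open>Shifted coefficients may leave \<open>V\<close>. Periodicity of \<open>F\<close> in each
  coefficient takes the place of a reduction modulo \<open>P\<close>, one coordinate at a
  time.\<close>

lemma sum_quartic_shift:
  fixes F :: "int \<Rightarrow> int \<Rightarrow> int \<Rightarrow> int \<Rightarrow> real"
  assumes "\<And>a b c d. F (a mod P) b c d = F a b c d" "\<And>a b c d. F a (b mod P) c d = F a b c d"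
    "\<And>a b c d. F a b (c mod P) d = F a b c d" "\<And>a b c d. F a b c (d mod P) = F a b c d"
  shows "(\<Sum>(a, b, c, d)\<in>V4. F (a + a') (b + b') (c + c') (d + d')) = (\<Sum>(a, b, c, d)\<in>V4. F a b c d)"
proof -
  have "(\<Sum>d\<in>V. F a b c (d + d')) = (\<Sum>d\<in>V. F a b c d)" for a b c
    by (rule sum_shift) (rule assms)
  moreover have "(\<Sum>c\<in>V. \<Sum>d\<in>V. F a b (c + c') d) = (\<Sum>c\<in>V. \<Sum>d\<in>V. F a b c d)" for a b
    by (rule sum_shift[where f = "\<lambda>c. \<Sum>d\<in>V. F a b c d"]) (simp add: assms)
  moreover have "(\<Sum>b\<in>V. \<Sum>c\<in>V. \<Sum>d\<in>V. F a (b + b') c d) = (\<Sum>b\<in>V. \<Sum>c\<in>V. \<Sum>d\<in>V. F a b c d)" for a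
    by (rule sum_shift[where f = "\<lambda>b. \<Sum>c\<in>V. \<Sum>d\<in>V. F a b c d"]) (simp add: assms)
  moreover have "(\<Sum>a\<in>V. \<Sum>b\<in>V. \<Sum>c\<in>V. \<Sum>d\<in>V. F (a + a') b c d) = (\<Sum>a\<in>V. \<Sum>b\<in>V. \<Sum>c\<in>V. \<Sum>d\<in>V. F a b c d)"
    by (rule sum_shift[where f = "\<lambda>a. \<Sum>b\<in>V. \<Sum>c\<in>V. \<Sum>d\<in>V. F a b c d"]) (simp add: assms)
  ultimately show ?thesis unfolding sum_tuple4 by simp
qed

lemma chi_quartic_mod:
  "chi (quartic (a mod P, b, c, d) x) = chi (quartic (a, b, c, d) x)"
  "chi (quartic (a, b mod P, c, d) x) = chi (quartic (a, b, c, d) x)"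
  "chi (quartic (a, b, c mod P, d) x) = chi (quartic (a, b, c, d) x)"
  "chi (quartic (a, b, c, d mod P) x) = chi (quartic (a, b, c, d) x)"
proof -
  have *: "P dvd a - b \<Longrightarrow> chi a = chi b" for a b by (metis chi_cong mod_eq_dvd_iff)
  have m: "P dvd a mod P - a" for a by (metis mod_eq_dvd_iff mod_mod_trivial)
  show "chi (quartic (a mod P, b, c, d) x) = chi (quartic (a, b, c, d) x)"
  proof (rule *)
    have "quartic (a mod P, b, c, d) x - quartic (a, b, c, d) x = (a mod P - a) * x^3"
      by (simp add: quartic_def algebra_simps)
    then show "P dvd quartic (a mod P, b, c, d) x - quartic (a, b, c, d) x" using m by simp
  qed
  show "chi (quartic (a, b mod P, c, d) x) = chi (quartic (a, b, c, d) x)"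
  proof (rule *)
    have "quartic (a, b mod P, c, d) x - quartic (a, b, c, d) x = (b mod P - b) * x^2"
      by (simp add: quartic_def algebra_simps)
    then show "P dvd quartic (a, b mod P, c, d) x - quartic (a, b, c, d) x" using m by simp
  qed
  show "chi (quartic (a, b, c mod P, d) x) = chi (quartic (a, b, c, d) x)"
  proof (rule *)
    have "quartic (a, b, c mod P, d) x - quartic (a, b, c, d) x = (c mod P - c) * x"
      by (simp add: quartic_def algebra_simps)
    then show "P dvd quartic (a, b, c mod P, d) x - quartic (a, b, c, d) x" using m by simp
  qed
  show "chi (quartic (a, b, c, d mod P) x) = chi (quartic (a, b, c, d) x)"
  proof (rule *)
    have "quartic (a, b, c, d mod P) x - quartic (a, b, c, d) x = (d mod P - d)"
      by (simp add: quartic_def algebra_simps)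
    then show "P dvd quartic (a, b, c, d mod P) x - quartic (a, b, c, d) x" using m by simp
  qed
qed

text \<open>Adding a multiple of \<open>(X - x) (X - y) (X - z)\<close> to the quartic changes only its value at \<open>w\<close>.\<close>

lemma sum_quartic_unique_point:
  assumes "x \<in> V" "y \<in> V" "z \<in> V" "w \<in> V" "w \<noteq> x" "w \<noteq> y" "w \<noteq> z"
  shows "(\<Sum>e\<in>V4. chi (quartic e x) * chi (quartic e y) * chi (quartic e z) * chi (quartic e w)) = 0"
proof -
  let ?T = "\<Sum>e\<in>V4. chi (quartic e x) * chi (quartic e y) * chi (quartic e z) * chi (quartic e w)"
  let ?g = "(w - x) * (w - y) * (w - z)"
  have g: "\<not> P dvd ?g" using assms by (simp add: dvd_mult_P flip: V_eq_iff)
  have q: "quartic (a + t, b + - t * (x + y + z), c + t * (x * y + y * z + x * z), d + - t * (x * y * z)) u =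
      quartic (a, b, c, d) u + t * ((u - x) * (u - y) * (u - z))" for a b c d t u
    by (simp add: quartic_def algebra_simps power3_eq_cube power2_eq_square)
  have T: "?T = (\<Sum>e\<in>V4. chi (quartic e x) * chi (quartic e y) * chi (quartic e z) * chi (quartic e w + t * ?g))" for t
  proof -
    let ?F = "\<lambda>a b c d. chi (quartic (a, b, c, d) x) * chi (quartic (a, b, c, d) y) *
        chi (quartic (a, b, c, d) z) * chi (quartic (a, b, c, d) w)"
    have "?T = (\<Sum>(a, b, c, d)\<in>V4. ?F a b c d)"
      by (rule sum.cong) auto
    also have "\<dots> = (\<Sum>(a, b, c, d)\<in>V4. ?F (a + t) (b + - t * (x + y + z)) (c + t * (x * y + y * z + x * z)) (d + - t * (x * y * z)))"
      by (rule sum_quartic_shift[of ?F, symmetric]) (simp_all only: chi_quartic_mod)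
    also have "\<dots> = (\<Sum>e\<in>V4. chi (quartic e x) * chi (quartic e y) * chi (quartic e z) * chi (quartic e w + t * ?g))"
    proof (rule sum.cong[OF refl], clarify)
      fix a b c d
      show "?F (a + t) (b + - t * (x + y + z)) (c + t * (x * y + y * z + x * z)) (d + - t * (x * y * z)) =
        chi (quartic (a, b, c, d) x) * chi (quartic (a, b, c, d) y) * chi (quartic (a, b, c, d) z) *
        chi (quartic (a, b, c, d) w + t * ?g)"
        unfolding q by simp
    qed
    finally show ?thesis .
  qed
  \<comment> \<open>\<open>?T\<close> does not depend on \<open>t\<close>, while on the right
    \<open>t\<close> moves the value at \<open>w\<close> through all residues because
    \<open>?g\<close> is invertible; there the character sums to zero.\<close>
  have "(\<Sum>t\<in>V. ?T) = (\<Sum>t\<in>V. \<Sum>e\<in>V4. chi (quartic e x) * chi (quartic e y) * chi (quartic e z) * chi (quartic e w + t * ?g))"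
    by (rule sum.cong[OF refl T])
  also have "\<dots> = (\<Sum>e\<in>V4. chi (quartic e x) * chi (quartic e y) * chi (quartic e z) * (\<Sum>t\<in>V. chi (?g * t + quartic e w)))"
    by (subst sum.swap) (simp add: sum_distrib_left ac_simps)
  also have "\<dots> = 0" by (simp add: sum_chi_affine[OF g])
  finally show ?thesis using p_ge_5 by simp
qed

text \<open>Four points that do not match in pairs include one that occurs exactly once, and
  \<open>sum_quartic_unique_point\<close> applies to it. Otherwise every summand is bounded by
  1.\<close>

lemma sum_quartic_le:
  assumes "x \<in> V" "y \<in> V" "z \<in> V" "w \<in> V"
  shows "(\<Sum>e\<in>V4. chi (quartic e x) * chi (quartic e y) * chi (quartic e z) * chi (quartic e w))
     \<le> real p ^ 4 * (of_bool (x = y \<and> z = w) + of_bool (x = z \<and> y = w) + of_bool (x = w \<and> y = z))"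
    (is "?T \<le> _ * ?I")
proof (cases "x = y \<and> z = w \<or> x = z \<and> y = w \<or> x = w \<and> y = z")
  case True
  have "?T \<le> (\<Sum>e\<in>V4. 1)"
  proof (rule sum_mono)
    fix e
    have "\<bar>chi (quartic e x) * chi (quartic e y) * chi (quartic e z) * chi (quartic e w)\<bar> \<le> 1 * 1 * 1 * 1"
      unfolding abs_mult by (intro mult_mono abs_chi_le) auto
    then show "chi (quartic e x) * chi (quartic e y) * chi (quartic e z) * chi (quartic e w) \<le> 1" by simp
  qed
  also have "\<dots> = real p ^ 4 * 1" by (simp add: card_cartesian_product power4_eq_xxxx)
  also have "\<dots> \<le> real p ^ 4 * ?I" using True by (intro mult_left_mono) auto
  finally show ?thesis .
next
  case False
  then consider "w \<noteq> x" "w \<noteq> y" "w \<noteq> z" | "x \<noteq> y" "x \<noteq> z" "x \<noteq> w"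
    | "y \<noteq> x" "y \<noteq> z" "y \<noteq> w" | "z \<noteq> x" "z \<noteq> y" "z \<noteq> w" by blast
  then have T: "?T = 0"
  proof cases
    case 1 then show ?thesis using assms by (intro sum_quartic_unique_point) auto
  next
    case 2 then show ?thesis using sum_quartic_unique_point[of y z w x] assms by (simp only: mult.commute mult.left_commute mult.assoc not_False_eq_True simp_thms)
  next
    case 3 then show ?thesis using sum_quartic_unique_point[of x z w y] assms by (simp only: mult.commute mult.left_commute mult.assoc not_False_eq_True simp_thms)
  next
    case 4 then show ?thesis using sum_quartic_unique_point[of x y w z] assms by (simp only: mult.commute mult.left_commute mult.assoc not_False_eq_True simp_thms)
  qed
  have "0 \<le> real p ^ 4 * ?I"
    by (intro mult_nonneg_nonneg add_nonneg_nonneg) auto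
  then show ?thesis unfolding T .
qed

lemma power4_sum:
  fixes f :: "'a \<Rightarrow> real"
  shows "(\<Sum>x\<in>A. f x)^4 = (\<Sum>(x, y, z, w)\<in>A \<times> A \<times> A \<times> A. f x * f y * f z * f w)"
proof -
  have "(\<Sum>x\<in>A. f x)^4 = (\<Sum>x\<in>A. f x * (\<Sum>y\<in>A. f y * (\<Sum>z\<in>A. f z * (\<Sum>w\<in>A. f w))))"
    by (simp add: power4_eq_xxxx mult.assoc flip: sum_distrib_right)
  then show ?thesis unfolding sum_tuple4 by (simp add: sum_distrib_left mult.assoc)
qed

text \<open>Only the three ways of matching four points in pairs survive. Each has
  \<open>p^2\<close> quadruples, and each quadruple contributes at most \<open>p^4\<close>.\<close>

lemma fourth_moment_quartics: "(\<Sum>e\<in>V4. (\<Sum>x\<in>V. chi (quartic e x))^4) \<le> 3 * real p ^ 6"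
proof -
  have "(\<Sum>e\<in>V4. (\<Sum>x\<in>V. chi (quartic e x))^4) =
     (\<Sum>(x, y, z, w)\<in>V4. \<Sum>e\<in>V4. chi (quartic e x) * chi (quartic e y) * chi (quartic e z) * chi (quartic e w))"
    unfolding power4_sum by (subst sum.swap) (simp add: case_prod_unfold)
  also have "\<dots> \<le> (\<Sum>(x, y, z, w)\<in>V4. real p ^ 4 * (of_bool (x = y \<and> z = w) + of_bool (x = z \<and> y = w) + of_bool (x = w \<and> y = z)))"
    by (intro sum_mono) (auto intro!: sum_quartic_le)
  also have "\<dots> = real p ^ 4 * (\<Sum>x\<in>V. \<Sum>y\<in>V. \<Sum>z\<in>V. \<Sum>w\<in>V.
      (of_bool (x = y) * of_bool (z = w) + of_bool (x = z) * of_bool (y = w) + of_bool (x = w) * of_bool (y = z)))"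
    unfolding sum_tuple4 sum_distrib_left by (simp add: of_bool_conj)
  also have "(\<Sum>x\<in>V. \<Sum>y\<in>V. \<Sum>z\<in>V. \<Sum>w\<in>V.
      (of_bool (x = y) * of_bool (z = w) + of_bool (x = z) * of_bool (y = w) + of_bool (x = w) * of_bool (y = z)))
      = 3 * real p ^ 2"
  proof -
    have d: "(\<Sum>w\<in>V. of_bool (z = w)) = (1::real)" if "z \<in> V" for z
      using that by (simp add: of_bool_def)
    have "(\<Sum>w\<in>V. (of_bool (x = y) * of_bool (z = w) + of_bool (x = z) * of_bool (y = w) + of_bool (x = w) * of_bool (y = z)))
      = of_bool (x = y) + of_bool (x = z) + (of_bool (y = z) :: real)" if "x \<in> V" "y \<in> V" "z \<in> V" for x y z
      using that by (simp add: sum.distrib d flip: sum_distrib_left sum_distrib_right)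
    then have "(\<Sum>x\<in>V. \<Sum>y\<in>V. \<Sum>z\<in>V. \<Sum>w\<in>V.
      (of_bool (x = y) * of_bool (z = w) + of_bool (x = z) * of_bool (y = w) + of_bool (x = w) * of_bool (y = z)))
      = (\<Sum>x\<in>V. \<Sum>y\<in>V. \<Sum>z\<in>V. of_bool (x = y) + of_bool (x = z) + (of_bool (y = z) :: real))"
      by simp
    also have "\<dots> = (\<Sum>x\<in>V. \<Sum>y\<in>V. real p * of_bool (x = y) + 2)"
      by (simp add: sum.distrib d)
    also have "\<dots> = (\<Sum>x\<in>V. 3 * real p)"
      by (simp add: sum.distrib d flip: sum_distrib_left)
    also have "\<dots> = 3 * real p ^ 2" by (simp add: power2_eq_square)
    finally show ?thesis .
  qed
  also have "real p ^ 4 * (3 * real p ^ 2) = 3 * real p ^ 6" by (simp flip: power_add)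
  finally show ?thesis .
qed

text \<open>Vieta's formulas for \<open>(X - i) (X - j) (X - k) (X - l)\<close>, reduced so that the
  coefficients lie in \<open>V\<close>.\<close>

definition root_coeffs :: "int \<times> int \<times> int \<times> int \<Rightarrow> int \<times> int \<times> int \<times> int" where
  "root_coeffs = (\<lambda>(i, j, k, l). ((- (i + j + k + l)) mod P, (i*j + i*k + i*l + j*k + j*l + k*l) mod P,
     (- (i*j*k + i*j*l + i*k*l + j*k*l)) mod P, (i*j*k*l) mod P))"

lemma quartic_root_coeffs:
  "P dvd quartic (root_coeffs (i, j, k, l)) x - (x - i) * (x - j) * (x - k) * (x - l)"
proof -
  have m: "[a mod P = a] (mod P)" for a by (simp add: cong_def)
  have "[quartic (root_coeffs (i, j, k, l)) x =
    quartic (- (i + j + k + l), i*j + i*k + i*l + j*k + j*l + k*l, - (i*j*k + i*j*l + i*k*l + j*k*l), i*j*k*l) x] (mod P)"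
    unfolding root_coeffs_def quartic_def prod.case
    by (intro cong_add cong_mult m cong_refl)
  also have "quartic (- (i + j + k + l), i*j + i*k + i*l + j*k + j*l + k*l, - (i*j*k + i*j*l + i*k*l + j*k*l), i*j*k*l) x
     = (x - i) * (x - j) * (x - k) * (x - l)"
    by (simp add: quartic_def algebra_simps power4_eq_xxxx power3_eq_cube power2_eq_square)
  finally show ?thesis by (simp add: cong_iff_dvd_diff)
qed

lemma c4_quartic: "c4 i j k l = (\<Sum>x\<in>V. chi (quartic (root_coeffs (i, j, k, l)) x))"
  unfolding c4_def
proof (rule sum.cong[OF refl])
  fix x
  have "chi ((x - i) * (x - j) * (x - k) * (x - l)) = chi (quartic (root_coeffs (i, j, k, l)) x)"
    using quartic_root_coeffs[of i j k l x] by (intro chi_cong) (simp only: mod_eq_dvd_iff dvd_diff_commute)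
  then show "chi (x - i) * chi (x - j) * chi (x - k) * chi (x - l) = chi (quartic (root_coeffs (i, j, k, l)) x)"
    by (simp only: chi_mult)
qed

text \<open>Equal coefficients mean equal values modulo \<open>P\<close>, so every entry of another
  quadruple in the fibre is a root of the same quartic and lies in \<open>{i, j, k, l}\<close>. Four
  choices for each of four entries give \<open>4^4 = 256\<close>.\<close>

lemma card_root_coeffs_fibre: "card {r \<in> V4. root_coeffs r = e} \<le> 256"
proof (cases "{r \<in> V4. root_coeffs r = e} = {}")
  case True
  show ?thesis unfolding True by simp
next
  case False
  then obtain i j k l where ijkl: "i \<in> V" "j \<in> V" "k \<in> V" "l \<in> V" "root_coeffs (i, j, k, l) = e" by auto
  let ?R = "{i, j, k, l}"
  have root: "x \<in> ?R" if "x \<in> V" "P dvd quartic e x" for x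
  proof -
    have "P dvd (x - i) * (x - j) * (x - k) * (x - l)"
      using quartic_root_coeffs[of i j k l x] that(2) unfolding ijkl(5) by (metis dvd_diff_right_iff)
    then show ?thesis using V_eq_iff[OF that(1)] ijkl by (auto simp: dvd_mult_P)
  qed
  have sub: "r \<in> ?R \<times> ?R \<times> ?R \<times> ?R" if r: "r \<in> V4" "root_coeffs r = e" for r
  proof -
    obtain a b c d where abcd: "r = (a, b, c, d)" by (cases r)
    have "P dvd quartic e x" if "x \<in> {a, b, c, d}" for x
      using quartic_root_coeffs[of a b c d x] that r(2) unfolding abcd by auto
    then show ?thesis
      using root[of a] root[of b] root[of c] root[of d] r(1) unfolding abcd by blast
  qed
  have "card {r \<in> V4. root_coeffs r = e} \<le> card (?R \<times> ?R \<times> ?R \<times> ?R)"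
  proof (rule card_mono)
    show "{r \<in> V4. root_coeffs r = e} \<subseteq> ?R \<times> ?R \<times> ?R \<times> ?R"
    proof
      fix r assume "r \<in> {r \<in> V4. root_coeffs r = e}"
      then show "r \<in> ?R \<times> ?R \<times> ?R \<times> ?R" by (intro sub) auto
    qed
  qed simp
  also have "\<dots> = card ?R ^ 4" by (simp only: card_cartesian_product power4_eq_xxxx mult.assoc)
  also have "\<dots> \<le> 4 ^ 4"
    by (intro power_mono) (auto simp: card_insert_if)
  finally show ?thesis by simp
qed

lemma fourth_moment_c4: "(\<Sum>(i, j, k, l)\<in>V4. c4 i j k l ^ 4) \<le> 768 * real p ^ 6"
proof -
  let ?F = "\<lambda>e. (\<Sum>x\<in>V. chi (quartic e x))^4"
  have F: "?F e \<ge> 0" for e by simp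
  have card: "real (card {r \<in> V4. root_coeffs r = e}) \<le> 256" for e
    using card_root_coeffs_fibre[of e] by linarith
  have "(\<Sum>(i, j, k, l)\<in>V4. c4 i j k l ^ 4) = (\<Sum>r\<in>V4. ?F (root_coeffs r))"
    by (intro sum.cong) (auto simp: c4_quartic)
  also have "\<dots> = (\<Sum>e\<in>V4. \<Sum>r\<in>{r \<in> V4. root_coeffs r = e}. ?F (root_coeffs r))"
    by (rule sum.group[symmetric]) (auto simp: root_coeffs_def)
  also have "\<dots> = (\<Sum>e\<in>V4. real (card {r \<in> V4. root_coeffs r = e}) * ?F e)"
    by (intro sum.cong) auto
  \<comment> \<open>Fourth powers are nonnegative, so the sum may run over all monic quartics, split
    or not, at the price of the fibre size. Hence \<open>768 = 256 * 3\<close>.\<close>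
  also have "\<dots> \<le> (\<Sum>e\<in>V4. 256 * ?F e)"
    using card by (intro sum_mono mult_right_mono F)
  also have "\<dots> \<le> 256 * (3 * real p ^ 6)"
    unfolding sum_distrib_left[symmetric] using fourth_moment_quartics by simp
  finally show ?thesis by simp
qed

end

section \<open>The four-cycle form\<close>

lemma sum_square_tuple4:
  fixes f :: "'a \<Rightarrow> 'b \<Rightarrow> real"
  shows "(\<Sum>i\<in>A. \<Sum>j\<in>B. f i j)^2 = (\<Sum>(i, j, k, l)\<in>A \<times> B \<times> A \<times> B. f i j * f k l)"
  unfolding sum_tuple4 power2_eq_square by (simp only: sum_distrib_right) (simp only: sum_distrib_left)

lemma Cauchy_Schwarz_sum2:
  fixes f g :: "'a \<Rightarrow> 'b \<Rightarrow> real"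
  shows "(\<Sum>i\<in>A. \<Sum>j\<in>B. f i j * g i j)^2 \<le> (\<Sum>i\<in>A. \<Sum>j\<in>B. f i j ^ 2) * (\<Sum>i\<in>A. \<Sum>j\<in>B. g i j ^ 2)"
  using Cauchy_Schwarz_ineq_sum[of "\<lambda>(i, j). f i j" "\<lambda>(i, j). g i j" "A \<times> B"]
  by (simp add: sum.cartesian_product case_prod_unfold)

context paley
begin

definition nrm2 :: "(int \<Rightarrow> int \<Rightarrow> real) \<Rightarrow> real" where
  "nrm2 v = (\<Sum>i\<in>V. \<Sum>j\<in>V. v i j ^ 2)"

text \<open>The sign product around the four-cycle \<open>i, k, j, l\<close>, to be read as a matrix
  with rows \<open>(i, j)\<close> and columns \<open>(k, l)\<close>. \<open>Hop\<close> is its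
  operator and \<open>BH\<close> its bilinear form.\<close>

definition cyc :: "int \<Rightarrow> int \<Rightarrow> int \<Rightarrow> int \<Rightarrow> real" where
  "cyc i j k l = chi (i - k) * chi (i - l) * chi (j - k) * chi (j - l)"

definition Hop :: "(int \<Rightarrow> int \<Rightarrow> real) \<Rightarrow> int \<Rightarrow> int \<Rightarrow> real" where
  "Hop v k l = (\<Sum>i\<in>V. \<Sum>j\<in>V. v i j * cyc i j k l)"

definition BH :: "(int \<Rightarrow> int \<Rightarrow> real) \<Rightarrow> (int \<Rightarrow> int \<Rightarrow> real) \<Rightarrow> real" where
  "BH u v = (\<Sum>i\<in>V. \<Sum>j\<in>V. u i j * Hop v i j)"

lemma nrm2_nonneg: "nrm2 v \<ge> 0"
  unfolding nrm2_def by (intro sum_nonneg) auto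

lemma cyc_commute: "cyc i j k l = cyc k l i j"
  unfolding cyc_def by (simp add: chi_diff_commute[of i] chi_diff_commute[of j])

lemma BH_commute: "BH u v = BH v u"
proof -
  have "BH u v = (\<Sum>(i, j, k, l)\<in>V4. u i j * v k l * cyc k l i j)"
    unfolding sum_tuple4 BH_def Hop_def by (simp add: sum_distrib_left mult.assoc)
  also have "\<dots> = (\<Sum>(k, l, i, j)\<in>V4. u i j * v k l * cyc k l i j)"
    by (rule sum.reindex_bij_witness[where i = "\<lambda>(i, j, k, l). (k, l, i, j)" and j = "\<lambda>(i, j, k, l). (k, l, i, j)"]) auto
  also have "\<dots> = BH v u"
    unfolding sum_tuple4 BH_def Hop_def by (simp add: sum_distrib_left cyc_commute mult.assoc mult.left_commute)
  finally show ?thesis .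
qed

lemma Hop_add: "Hop (\<lambda>i j. u i j + v i j) k l = Hop u k l + Hop v k l"
  unfolding Hop_def by (simp add: distrib_right sum.distrib)

lemma Hop_scale: "Hop (\<lambda>i j. c * v i j) k l = c * Hop v k l"
  unfolding Hop_def by (simp add: sum_distrib_left mult.assoc)

lemma BH_add_right: "BH u (\<lambda>i j. v i j + w i j) = BH u v + BH u w"
  unfolding BH_def Hop_add by (simp add: distrib_left sum.distrib)

lemma BH_scale_right: "BH u (\<lambda>i j. c * v i j) = c * BH u v"
  unfolding BH_def Hop_scale by (simp add: sum_distrib_left ac_simps)

lemma BH_add_left: "BH (\<lambda>i j. v i j + w i j) u = BH v u + BH w u"
  using BH_add_right BH_commute by metis

text \<open>In the squared norm the two output points \<open>x\<close> and \<open>y\<close>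
  decouple, and each produces one copy of the same sum \<open>c4 i j k l\<close>.\<close>

lemma nrm2_Hop: "nrm2 (Hop v) = (\<Sum>(i, j, k, l)\<in>V4. v i j * v k l * c4 i j k l ^ 2)"
proof -
  let ?f = "\<lambda>i j k l x. chi (x - i) * chi (x - j) * chi (x - k) * chi (x - l)"
  have "nrm2 (Hop v) = (\<Sum>x\<in>V. \<Sum>y\<in>V. \<Sum>(i, j, k, l)\<in>V4. v i j * cyc i j x y * (v k l * cyc k l x y))"
    unfolding nrm2_def Hop_def sum_square_tuple4 ..
  also have "\<dots> = (\<Sum>x\<in>V. \<Sum>y\<in>V. \<Sum>(i, j, k, l)\<in>V4. v i j * v k l * (?f i j k l x * ?f i j k l y))"
  proof (intro sum.cong refl, clarify)
    fix x y i j k l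
    show "v i j * cyc i j x y * (v k l * cyc k l x y) = v i j * v k l * (?f i j k l x * ?f i j k l y)"
      unfolding cyc_def chi_diff_commute[of i] chi_diff_commute[of j] chi_diff_commute[of k] chi_diff_commute[of l]
      by (simp add: ac_simps)
  qed
  also have "\<dots> = (\<Sum>(i, j, k, l)\<in>V4. \<Sum>x\<in>V. \<Sum>y\<in>V. v i j * v k l * (?f i j k l x * ?f i j k l y))"
    by (simp add: case_prod_unfold sum.swap[of _ V4])
  also have "\<dots> = (\<Sum>(i, j, k, l)\<in>V4. v i j * v k l * c4 i j k l ^ 2)"
    unfolding c4_def power2_eq_square sum_product by (simp add: sum_distrib_left)
  finally show ?thesis .
qed

text \<open>Cauchy-Schwarz bounds the squared operator by the Frobenius norm of its kernel, which is
  the fourth moment of \<open>c4\<close>. The constant 28 comes from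
  \<open>28^2 = 784 \<ge> 768\<close>.\<close>

lemma nrm2_Hop_le: "nrm2 (Hop v) \<le> 28 * real p ^ 3 * nrm2 v"
proof -
  have "(nrm2 (Hop v))^2 \<le> (\<Sum>(i, j, k, l)\<in>V4. (v i j * v k l)^2) * (\<Sum>(i, j, k, l)\<in>V4. (c4 i j k l ^ 2)^2)"
    unfolding nrm2_Hop
    using Cauchy_Schwarz_ineq_sum[of "\<lambda>(i, j, k, l). v i j * v k l" "\<lambda>(i, j, k, l). c4 i j k l ^ 2" V4]
    by (simp add: case_prod_unfold)
  also have "(\<Sum>(i, j, k, l)\<in>V4. (v i j * v k l)^2) = nrm2 v ^ 2"
    unfolding nrm2_def sum_square_tuple4 by (simp add: power_mult_distrib)
  also have "(\<Sum>(i, j, k, l)\<in>V4. (c4 i j k l ^ 2)^2) \<le> (28 * real p ^ 3)^2"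
  proof -
    have "(\<Sum>(i, j, k, l)\<in>V4. (c4 i j k l ^ 2)^2) = (\<Sum>(i, j, k, l)\<in>V4. c4 i j k l ^ 4)"
      by (simp flip: power_mult)
    also have "\<dots> \<le> 768 * real p ^ 6" by (rule fourth_moment_c4)
    also have "\<dots> \<le> 784 * real p ^ 6" by simp
    also have "\<dots> = (28 * real p ^ 3)^2" by (simp add: power_mult_distrib flip: power_mult)
    finally show ?thesis .
  qed
  finally have "(nrm2 (Hop v))^2 \<le> nrm2 v ^ 2 * (28 * real p ^ 3)^2"
    by (simp add: mult_left_mono del: power_mult_distrib)
  then have "(nrm2 (Hop v))^2 \<le> (28 * real p ^ 3 * nrm2 v)^2"
    by (simp only: power_mult_distrib mult.commute)
  then show ?thesis by (rule power2_le_imp_le) (simp add: nrm2_nonneg)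
qed

lemma BH_le:
  assumes "nrm2 (Hop v) \<le> c^2 * nrm2 v" "c \<ge> 0"
  shows "\<bar>BH u v\<bar> \<le> c * sqrt (nrm2 u) * sqrt (nrm2 v)"
proof -
  have "BH u v ^ 2 \<le> nrm2 u * nrm2 (Hop v)"
    unfolding BH_def nrm2_def by (rule Cauchy_Schwarz_sum2)
  also have "\<dots> \<le> nrm2 u * (c^2 * nrm2 v)" by (intro mult_left_mono assms nrm2_nonneg)
  also have "\<dots> = (c * sqrt (nrm2 u) * sqrt (nrm2 v))^2"
    by (simp add: power_mult_distrib nrm2_nonneg)
  finally show ?thesis
    using assms(2) nrm2_nonneg by (simp add: abs_le_square_iff[symmetric] abs_mult)
qed

text \<open>The exponent 3/2 is too large for the main part of the form. It serves for error terms
  in which one argument has a squared norm smaller by a factor \<open>p\<close>.\<close>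

lemma BH_le_generic: "\<bar>BH u v\<bar> \<le> 6 * real p * sqrt (real p) * sqrt (nrm2 u) * sqrt (nrm2 v)"
proof (rule BH_le)
  have "nrm2 (Hop v) \<le> 28 * real p ^ 3 * nrm2 v" by (rule nrm2_Hop_le)
  also have "\<dots> \<le> 36 * real p ^ 3 * nrm2 v" by (intro mult_right_mono nrm2_nonneg) simp_all
  also have "\<dots> = (6 * real p * sqrt (real p))^2 * nrm2 v"
    by (simp add: power_mult_distrib power3_eq_cube power2_eq_square)
  finally show "nrm2 (Hop v) \<le> (6 * real p * sqrt (real p))^2 * nrm2 v" .
qed simp

subsection \<open>Fourier analysis along translations\<close>

definition ee :: "int \<Rightarrow> complex" where "ee x = cis (2 * pi * of_int x / real p)"

lemma ee_add: "ee (x + y) = ee x * ee y"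
  by (simp add: ee_def cis_mult add_divide_distrib distrib_left)

lemma ee_0 [simp]: "ee 0 = 1" by (simp add: ee_def)

lemma cnj_ee: "cnj (ee x) = ee (- x)" by (simp add: ee_def cis_cnj)

lemma ee_power: "ee (x * int k) = ee x ^ k"
  unfolding ee_def Complex.DeMoivre by (rule arg_cong[of _ _ cis]) (simp add: ac_simps)

lemma ee_eq_1_iff: "ee x = 1 \<longleftrightarrow> P dvd x"
proof
  assume "ee x = 1"
  then obtain n where n: "2 * pi * of_int x / real p = of_int n * 2 * pi"
    unfolding ee_def cis_conv_exp exp_eq_1 by (auto simp: complex_eq_iff)
  have "real_of_int x = real_of_int n * real p"
    using n p_ge_5 by (simp add: field_simps)
  then have "real_of_int x = real_of_int (n * P)" by simp
  then have "x = n * P" by (simp only: of_int_eq_iff)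
  then show "P dvd x" by simp
next
  assume "P dvd x"
  then obtain n where n: "x = P * n" by (auto simp: dvd_def)
  have "2 * pi * of_int x / real p = 2 * pi * of_int n" using p_ge_5 by (simp add: n)
  then show "ee x = 1" unfolding ee_def using cis_multiple_2pi[of "of_int n"] by (simp add: mult.commute)
qed

lemma ee_mod [simp]: "ee (x mod P) = ee x"
proof -
  have "ee x = ee (x mod P + (x - x mod P))" by simp
  also have "\<dots> = ee (x mod P)" unfolding ee_add using ee_eq_1_iff[of "x - x mod P"] by (simp add: dvd_minus_mod)
  finally show ?thesis ..
qed

lemma sum_V_nat: "(\<Sum>x\<in>V. f x) = (\<Sum>k<p. f (int k))"
proof -
  have "V = int ` {..<p}"
    unfolding paley_vertices_def using image_int_atLeastLessThan[of 0 p] by (simp add: atLeast0LessThan)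
  then show ?thesis by (simp add: sum.reindex)
qed

lemma sum_ee: "(\<Sum>x\<in>V. ee (a * x)) = (if P dvd a then of_nat p else 0)"
proof (cases "P dvd a")
  case True
  then have "ee (a * x) = 1" for x by (simp add: ee_eq_1_iff)
  then show ?thesis using True by simp
next
  case False
  then have "ee a \<noteq> 1" by (simp add: ee_eq_1_iff)
  have "ee a ^ p = ee (a * P)" by (rule ee_power[symmetric])
  also have "\<dots> = 1" by (simp add: ee_eq_1_iff)
  finally have "(\<Sum>k<p. ee a ^ k) = 0" using \<open>ee a \<noteq> 1\<close> by (simp add: geometric_sum)
  then show ?thesis using False by (simp add: sum_V_nat ee_power)
qed

definition hat :: "(int \<Rightarrow> real) \<Rightarrow> int \<Rightarrow> complex" where
  "hat f \<omega> = (\<Sum>s\<in>V. of_real (f s) * ee (\<omega> * s))"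

lemma sum_ee_delta:
  assumes "s \<in> V" "t \<in> V"
  shows "(\<Sum>\<omega>\<in>V. ee (\<omega> * s) * ee (- (\<omega> * t))) = (if s = t then of_nat p else 0)"
proof -
  have "(\<Sum>\<omega>\<in>V. ee (\<omega> * s) * ee (- (\<omega> * t))) = (\<Sum>\<omega>\<in>V. ee ((s - t) * \<omega>))"
    by (simp add: algebra_simps flip: ee_add)
  then show ?thesis by (simp add: sum_ee V_eq_iff[OF assms])
qed

lemma hat_inversion:
  assumes "t \<in> V"
  shows "(\<Sum>\<omega>\<in>V. hat f \<omega> * ee (- (\<omega> * t))) = of_nat p * of_real (f t)"
proof -
  have "(\<Sum>\<omega>\<in>V. hat f \<omega> * ee (- (\<omega> * t))) = (\<Sum>\<omega>\<in>V. \<Sum>s\<in>V. of_real (f s) * (ee (\<omega> * s) * ee (- (\<omega> * t))))"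
    unfolding hat_def by (simp add: sum_distrib_right mult.assoc)
  also have "\<dots> = (\<Sum>s\<in>V. of_real (f s) * (\<Sum>\<omega>\<in>V. ee (\<omega> * s) * ee (- (\<omega> * t))))"
    by (subst sum.swap) (simp add: sum_distrib_left)
  also have "\<dots> = (\<Sum>s\<in>V. if s = t then of_nat p * of_real (f s) else 0)"
    by (intro sum.cong) (auto simp: sum_ee_delta assms)
  also have "\<dots> = of_nat p * of_real (f t)" using assms by simp
  finally show ?thesis .
qed

lemma parseval: "(\<Sum>\<omega>\<in>V. norm (hat f \<omega>) ^ 2) = real p * (\<Sum>s\<in>V. f s ^ 2)"
proof -
  have cnj_hat: "cnj (hat f \<omega>) = (\<Sum>t\<in>V. of_real (f t) * ee (- (\<omega> * t)))" for \<omega>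
    unfolding hat_def by (simp add: cnj_ee)
  have "complex_of_real (\<Sum>\<omega>\<in>V. norm (hat f \<omega>) ^ 2) = (\<Sum>\<omega>\<in>V. hat f \<omega> * cnj (hat f \<omega>))"
    by (simp only: of_real_sum complex_norm_square)
  also have "\<dots> = (\<Sum>\<omega>\<in>V. \<Sum>t\<in>V. of_real (f t) * (hat f \<omega> * ee (- (\<omega> * t))))"
    unfolding cnj_hat sum_distrib_left by (simp add: ac_simps)
  also have "\<dots> = (\<Sum>t\<in>V. of_real (f t) * (\<Sum>\<omega>\<in>V. hat f \<omega> * ee (- (\<omega> * t))))"
    by (subst sum.swap) (simp add: sum_distrib_left)
  also have "\<dots> = (\<Sum>t\<in>V. of_real (f t) * (of_nat p * of_real (f t)))"
    by (intro sum.cong refl) (simp add: hat_inversion)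
  also have "\<dots> = complex_of_real (real p * (\<Sum>s\<in>V. f s ^ 2))"
    by (simp add: sum_distrib_left power2_eq_square ac_simps)
  finally show ?thesis by (simp only: of_real_eq_iff)
qed

text \<open>The convolution theorem: a kernel that depends only on \<open>t - s\<close> acts
  diagonally on frequencies.\<close>

lemma hat_correlation:
  "(\<Sum>\<omega>\<in>V. hat b \<omega> * (hat f \<omega> * cnj (hat g \<omega>))) =
     of_nat p * of_real (\<Sum>s\<in>V. \<Sum>t\<in>V. f s * g t * b ((t - s) mod P))"
proof -
  have e: "ee (\<omega> * s) * ee (- (\<omega> * t)) = ee (- (\<omega> * ((t - s) mod P)))" for \<omega> s t
  proof -
    have "ee (- (\<omega> * ((t - s) mod P))) = ee ((- \<omega> * ((t - s) mod P)) mod P)" by simp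
    also have "(- \<omega> * ((t - s) mod P)) mod P = (- \<omega> * (t - s)) mod P" by (rule mod_mult_right_eq)
    finally show ?thesis by (simp add: algebra_simps flip: ee_add)
  qed
  have "hat f \<omega> * cnj (hat g \<omega>) = (\<Sum>s\<in>V. \<Sum>t\<in>V. of_real (f s * g t) * ee (- (\<omega> * ((t - s) mod P))))" for \<omega>
    unfolding hat_def by (simp add: cnj_ee sum_product e[symmetric] ac_simps)
  then have "(\<Sum>\<omega>\<in>V. hat b \<omega> * (hat f \<omega> * cnj (hat g \<omega>))) =
      (\<Sum>\<omega>\<in>V. \<Sum>s\<in>V. \<Sum>t\<in>V. of_real (f s * g t) * (hat b \<omega> * ee (- (\<omega> * ((t - s) mod P)))))"
    by (simp add: sum_distrib_left ac_simps)
  also have "\<dots> = (\<Sum>s\<in>V. \<Sum>t\<in>V. \<Sum>\<omega>\<in>V. of_real (f s * g t) * (hat b \<omega> * ee (- (\<omega> * ((t - s) mod P)))))"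
    by (subst sum.swap) (intro sum.cong refl sum.swap)
  also have "\<dots> = (\<Sum>s\<in>V. \<Sum>t\<in>V. of_real (f s * g t) * (of_nat p * of_real (b ((t - s) mod P))))"
    by (simp only: sum_distrib_left[symmetric] hat_inversion[OF mod_in_V])
  also have "\<dots> = of_nat p * of_real (\<Sum>s\<in>V. \<Sum>t\<in>V. f s * g t * b ((t - s) mod P))"
    by (simp add: sum_distrib_left ac_simps)
  finally show ?thesis .
qed

section \<open>The squared kernel along diagonals and its frequencies\<close>

lemma sum_mod_shift: "(\<Sum>d\<in>V. F ((s + d) mod P)) = (\<Sum>j\<in>V. F j)"
  using sum.reindex_bij_betw[OF bij_affine[of 1 s], of F] p_ge_5 by (simp add: add.commute)

lemma chi_diff_mod [simp]: "chi (x - i mod P) = chi (x - i)" "chi (i mod P - x) = chi (i - x)"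
  by (rule chi_cong, simp add: mod_diff_left_eq mod_diff_right_eq)+

lemma c4_mod [simp]: "c4 (i mod P) j k l = c4 i j k l" "c4 i (j mod P) k l = c4 i j k l"
  "c4 i j (k mod P) l = c4 i j k l" "c4 i j k (l mod P) = c4 i j k l"
  by (simp_all add: c4_def)

lemma c4_translate: "c4 (i + t) (j + t) (k + t) (l + t) = c4 i j k l"
proof -
  have "c4 i j k l = (\<Sum>x\<in>V. (\<lambda>x. chi (x - i) * chi (x - j) * chi (x - k) * chi (x - l)) (x + (- t)))"
    unfolding c4_def by (rule sum_shift[symmetric]) simp
  then show ?thesis by (simp add: c4_def algebra_simps)
qed

lemma c4_scale:
  assumes "\<not> P dvd a"
  shows "c4 (a * i) (a * j) (a * k) (a * l) = c4 i j k l"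
proof -
  have "c4 (a * i) (a * j) (a * k) (a * l) =
      (\<Sum>x\<in>V. (\<lambda>x. chi (x - a * i) * chi (x - a * j) * chi (x - a * k) * chi (x - a * l)) (a * x + 0))"
    unfolding c4_def by (rule sum_affine[OF assms, symmetric]) simp
  also have "\<dots> = (\<Sum>x\<in>V. (chi a ^ 2) ^ 2 * (chi (x - i) * chi (x - j) * chi (x - k) * chi (x - l)))"
    unfolding add_0_right right_diff_distrib[symmetric] chi_mult by (simp add: power2_eq_square ac_simps)
  finally show ?thesis by (simp add: c4_def chi_square[OF assms])
qed

text \<open>The kernel of the squared operator between the diagonals \<open>(s, s + d)\<close> and
  \<open>(t, t + d')\<close>. By translation invariance it depends only on \<open>h = t - s\<close>,
  as \<open>c4_bt\<close> records.\<close>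

definition bt :: "int \<Rightarrow> int \<Rightarrow> int \<Rightarrow> real" where
  "bt d d' h = c4 0 d h (h + d') ^ 2"

lemma bt_mod [simp]: "bt (d mod P) d' h = bt d d' h" "bt d (d' mod P) h = bt d d' h"
  "bt d d' (h mod P) = bt d d' h"
proof -
  have c: "a mod P = b mod P \<Longrightarrow> c4 i j k a = c4 i j k b" for a b i j k by (metis c4_mod(4))
  have "c4 i j k (h + d' mod P) = c4 i j k (h + d')" for i j k by (rule c) (simp add: mod_add_right_eq)
  moreover have "c4 i j k (h mod P + d') = c4 i j k (h + d')" for i j k by (rule c) (simp add: mod_add_left_eq)
  ultimately show "bt (d mod P) d' h = bt d d' h" "bt d (d' mod P) h = bt d d' h" "bt d d' (h mod P) = bt d d' h"
    by (simp_all add: bt_def)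
qed

lemma c4_bt: "c4 s ((s + d) mod P) t ((t + d') mod P) ^ 2 = bt d d' (t - s)"
  using c4_translate[of s "- s" "s + d" t "t + d'"] by (simp add: bt_def algebra_simps)

lemma bt_scale: "\<not> P dvd a \<Longrightarrow> bt (a * d) (a * d') (a * h) = bt d d' h"
  using c4_scale[of a 0 d h "h + d'"] by (simp add: bt_def distrib_left)

lemma hat_bt:
  assumes "\<not> P dvd a"
  shows "hat (bt d d') a = hat (bt (a * d) (a * d')) 1"
proof -
  have "hat (bt (a * d) (a * d')) 1 = (\<Sum>h\<in>V. (\<lambda>h. of_real (bt (a * d) (a * d') h) * ee (1 * h)) (a * h + 0))"
    unfolding hat_def by (rule sum_affine[OF assms, symmetric]) simp
  then show ?thesis by (simp add: hat_def bt_scale[OF assms])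
qed

text \<open>After a Fourier transform along each diagonal the squared operator is block diagonal,
  with one block per frequency, indexed by \<open>d\<close> and \<open>d'\<close>. This is the
  squared Frobenius norm of the block at \<open>\<omega>\<close>.\<close>

definition Nt :: "int \<Rightarrow> real" where
  "Nt \<omega> = (\<Sum>d\<in>V. \<Sum>d'\<in>V. norm (hat (bt d d') \<omega>) ^ 2)"

text \<open>Dilations permute the nonzero frequencies, so all of them carry the same mass.\<close>

lemma Nt_eq:
  assumes "\<not> P dvd \<omega>"
  shows "Nt \<omega> = Nt 1"
proof -
  have b: "bt (d mod P) = bt d" "bt d (d' mod P) = bt d d'" for d d' by (simp_all add: fun_eq_iff)
  have 1: "(\<Sum>d'\<in>V. norm (hat (bt d (\<omega> * d')) 1) ^ 2) = (\<Sum>d'\<in>V. norm (hat (bt d d') 1) ^ 2)" for d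
    using sum_affine[OF assms, of "\<lambda>d'. norm (hat (bt d d') 1) ^ 2" 0] by (simp add: b)
  have "Nt \<omega> = (\<Sum>d\<in>V. \<Sum>d'\<in>V. norm (hat (bt (\<omega> * d) (\<omega> * d')) 1) ^ 2)"
    unfolding Nt_def hat_bt[OF assms] ..
  also have "\<dots> = (\<Sum>d\<in>V. \<Sum>d'\<in>V. norm (hat (bt (\<omega> * d) d') 1) ^ 2)" by (simp add: 1)
  also have "\<dots> = Nt 1"
    unfolding Nt_def
    using sum_affine[OF assms, of "\<lambda>d. \<Sum>d'\<in>V. norm (hat (bt d d') 1) ^ 2" 0] by (simp add: b)
  finally show ?thesis .
qed

lemma sum_diagonals: "(\<Sum>i\<in>V. \<Sum>j\<in>V. F i j) = (\<Sum>d\<in>V. \<Sum>s\<in>V. F s ((s + d) mod P))"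
  by (subst sum.swap) (simp add: sum_mod_shift)

lemma sum_V4_diagonals:
  "(\<Sum>(i, j, k, l)\<in>V4. F i j k l) = (\<Sum>d\<in>V. \<Sum>d'\<in>V. \<Sum>s\<in>V. \<Sum>t\<in>V. F s ((s + d) mod P) t ((t + d') mod P))"
proof -
  have "(\<Sum>(i, j, k, l)\<in>V4. F i j k l) = (\<Sum>i\<in>V. \<Sum>j\<in>V. \<Sum>k\<in>V. \<Sum>l\<in>V. F i j k l)" by (rule sum_tuple4)
  also have "\<dots> = (\<Sum>d\<in>V. \<Sum>s\<in>V. \<Sum>d'\<in>V. \<Sum>t\<in>V. F s ((s + d) mod P) t ((t + d') mod P))"
    by (subst sum_diagonals) (subst (2) sum_diagonals, rule refl)
  also have "\<dots> = (\<Sum>d\<in>V. \<Sum>d'\<in>V. \<Sum>s\<in>V. \<Sum>t\<in>V. F s ((s + d) mod P) t ((t + d') mod P))"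
    by (intro sum.cong refl sum.swap)
  finally show ?thesis .
qed

text \<open>By Parseval the \<open>Nt \<omega>\<close> add up to the fourth moment of
  \<open>c4\<close>, at most \<open>768 p^6\<close>, and the \<open>p - 1\<close> nonzero
  frequencies have equal shares. The constant is \<open>1024 = 768 * 4 / 3\<close>, since
  \<open>p - 1 \<ge> 3 p / 4\<close>.\<close>

lemma Nt_1_le: "Nt 1 \<le> 1024 * real p ^ 5"
proof -
  have 1: "(\<Sum>s\<in>V. \<Sum>t\<in>V. bt d d' (t - s) ^ 2) = real p * (\<Sum>h\<in>V. bt d d' h ^ 2)" for d d'
  proof -
    have "(\<Sum>t\<in>V. bt d d' (t - s) ^ 2) = (\<Sum>t\<in>V. bt d d' t ^ 2)" for s
      using sum_shift[of "\<lambda>t. bt d d' t ^ 2" "- s"] by simp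
    then show ?thesis by simp
  qed
  have "(real p - 1) * Nt 1 = (\<Sum>\<omega>\<in>V-{0}. Nt 1)" using p_ge_5 by (simp add: of_nat_diff)
  also have "\<dots> = (\<Sum>\<omega>\<in>V-{0}. Nt \<omega>)" by (intro sum.cong refl Nt_eq[symmetric] nonzero_V)
  also have "\<dots> \<le> (\<Sum>\<omega>\<in>V. Nt \<omega>)"
    by (intro sum_mono2) (auto simp: Nt_def intro!: sum_nonneg)
  also have "\<dots> = (\<Sum>d\<in>V. \<Sum>d'\<in>V. \<Sum>\<omega>\<in>V. norm (hat (bt d d') \<omega>) ^ 2)"
    unfolding Nt_def by (subst sum.swap) (intro sum.cong refl sum.swap)
  also have "\<dots> = (\<Sum>d\<in>V. \<Sum>d'\<in>V. \<Sum>s\<in>V. \<Sum>t\<in>V. bt d d' (t - s) ^ 2)"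
    by (simp only: parseval 1)
  also have "\<dots> = (\<Sum>(i, j, k, l)\<in>V4. (c4 i j k l ^ 2) ^ 2)"
    unfolding sum_V4_diagonals c4_bt ..
  also have "\<dots> = (\<Sum>(i, j, k, l)\<in>V4. c4 i j k l ^ 4)" by (simp flip: power_mult)
  also have "\<dots> \<le> 768 * real p ^ 6" by (rule fourth_moment_c4)
  finally have "(real p - 1) * Nt 1 \<le> 768 * real p ^ 6" .
  moreover have "(3/4 * real p) * Nt 1 \<le> (real p - 1) * Nt 1"
    using p_ge_5 by (intro mult_right_mono) (auto simp: Nt_def intro!: sum_nonneg)
  ultimately have "real p * Nt 1 \<le> real p * (1024 * real p ^ 5)" by (simp add: power_eq_if)
  then show ?thesis using p_ge_5 by simp
qed

text \<open>Mean zero on every diagonal removes frequency 0, and every other block has Frobenius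
  norm at most \<open>sqrt (1024 p^5)\<close>. Compared with the \<open>28 p^3\<close> of
  \<open>nrm2_Hop_le\<close> this saves a factor of order \<open>sqrt p\<close>.\<close>

lemma nrm2_Hop_mean_zero:
  assumes "\<And>d. d \<in> V \<Longrightarrow> (\<Sum>s\<in>V. v s ((s + d) mod P)) = 0"
  shows "nrm2 (Hop v) \<le> 32 * real p ^ 2 * sqrt (real p) * nrm2 v"
proof -
  define vd where "vd = (\<lambda>d s. v s ((s + d) mod P))"
  define n where "n = (\<lambda>\<omega>. \<Sum>d\<in>V. norm (hat (vd d) \<omega>) ^ 2)"
  let ?B = "\<lambda>\<omega>. \<Sum>d\<in>V. \<Sum>d'\<in>V. hat (bt d d') \<omega> * (hat (vd d) \<omega> * cnj (hat (vd d') \<omega>))"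
  have n0: "n 0 = 0"
    unfolding n_def hat_def vd_def using assms by (simp flip: of_real_sum)
  have "n \<omega> \<ge> 0" for \<omega> unfolding n_def by (intro sum_nonneg) auto
  have B: "norm (?B \<omega>) \<le> sqrt (Nt \<omega>) * n \<omega>" for \<omega>
  proof -
    let ?S = "\<Sum>d\<in>V. \<Sum>d'\<in>V. norm (hat (bt d d') \<omega>) * (norm (hat (vd d) \<omega>) * norm (hat (vd d') \<omega>))"
    have "norm (?B \<omega>) \<le> ?S"
      by (intro order_trans[OF norm_sum] sum_mono) (simp add: norm_mult)
    then have "norm (?B \<omega>)^2 \<le> ?S^2" by (rule power_mono) simp
    also have "\<dots> \<le> Nt \<omega> * (\<Sum>d\<in>V. \<Sum>d'\<in>V. (norm (hat (vd d) \<omega>) * norm (hat (vd d') \<omega>))^2)"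
      unfolding Nt_def by (rule Cauchy_Schwarz_sum2)
    also have "(\<Sum>d\<in>V. \<Sum>d'\<in>V. (norm (hat (vd d) \<omega>) * norm (hat (vd d') \<omega>))^2) = n \<omega> ^ 2"
      unfolding n_def power2_eq_square[of "sum _ _"] sum_product by (simp add: power_mult_distrib)
    finally have "norm (?B \<omega>)^2 \<le> Nt \<omega> * n \<omega> ^ 2" .
    then have "sqrt (norm (?B \<omega>)^2) \<le> sqrt (Nt \<omega> * n \<omega> ^ 2)" by (rule real_sqrt_le_mono)
    then show ?thesis using \<open>n \<omega> \<ge> 0\<close> by (simp add: real_sqrt_mult)
  qed
  have "nrm2 (Hop v) = (\<Sum>d\<in>V. \<Sum>d'\<in>V. \<Sum>s\<in>V. \<Sum>t\<in>V. vd d s * vd d' t * bt d d' ((t - s) mod P))"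
    unfolding nrm2_Hop sum_V4_diagonals c4_bt vd_def by simp
  then have "complex_of_real (real p * nrm2 (Hop v)) = (\<Sum>d\<in>V. \<Sum>d'\<in>V. \<Sum>\<omega>\<in>V. hat (bt d d') \<omega> * (hat (vd d) \<omega> * cnj (hat (vd d') \<omega>)))"
    unfolding hat_correlation by (simp add: sum_distrib_left)
  also have "\<dots> = (\<Sum>\<omega>\<in>V. ?B \<omega>)"
    by (rule sym, subst sum.swap) (intro sum.cong refl sum.swap)
  finally have "real p * nrm2 (Hop v) = Re (\<Sum>\<omega>\<in>V. ?B \<omega>)" by (metis Re_complex_of_real)
  also have "\<dots> \<le> norm (\<Sum>\<omega>\<in>V. ?B \<omega>)" by (rule complex_Re_le_cmod)
  also have "\<dots> \<le> (\<Sum>\<omega>\<in>V. sqrt (Nt \<omega>) * n \<omega>)" by (intro order_trans[OF norm_sum] sum_mono B)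
  also have "\<dots> \<le> (\<Sum>\<omega>\<in>V. sqrt (1024 * real p ^ 5) * n \<omega>)"
  proof (rule sum_mono)
    fix \<omega> assume w: "\<omega> \<in> V"
    show "sqrt (Nt \<omega>) * n \<omega> \<le> sqrt (1024 * real p ^ 5) * n \<omega>"
    proof (cases "\<omega> = 0")
      case True then show ?thesis by (simp add: n0)
    next
      case False
      then have "Nt \<omega> \<le> 1024 * real p ^ 5" using Nt_1_le Nt_eq[OF nonzero_V, of \<omega>] w by simp
      then show ?thesis using \<open>n \<omega> \<ge> 0\<close> by (intro mult_right_mono real_sqrt_le_mono)
    qed
  qed
  also have "\<dots> = sqrt (1024 * real p ^ 5) * (\<Sum>\<omega>\<in>V. n \<omega>)" by (simp add: sum_distrib_left)
  also have "(\<Sum>\<omega>\<in>V. n \<omega>) = real p * nrm2 v"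
  proof -
    have "(\<Sum>\<omega>\<in>V. n \<omega>) = (\<Sum>d\<in>V. \<Sum>\<omega>\<in>V. norm (hat (vd d) \<omega>) ^ 2)"
      unfolding n_def by (rule sum.swap)
    also have "\<dots> = real p * (\<Sum>d\<in>V. \<Sum>s\<in>V. vd d s ^ 2)"
      by (simp only: parseval sum_distrib_left)
    also have "(\<Sum>d\<in>V. \<Sum>s\<in>V. vd d s ^ 2) = nrm2 v"
      unfolding nrm2_def vd_def by (rule sum_diagonals[symmetric])
    finally show ?thesis .
  qed
  also have "sqrt (1024 * real p ^ 5) = 32 * real p ^ 2 * sqrt (real p)"
  proof -
    have "1024 * real p ^ 5 = (32 * real p ^ 2)^2 * real p" by (simp add: power_mult_distrib power_eq_if)
    then show ?thesis by (simp only: real_sqrt_mult real_sqrt_abs) simp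
  qed
  finally have "real p * nrm2 (Hop v) \<le> real p * (32 * real p ^ 2 * sqrt (real p) * nrm2 v)"
    by (simp add: ac_simps)
  then show ?thesis using p_ge_5 by simp
qed

end

context paley
begin

section \<open>Splitting off the circulant part\<close>

abbreviation R :: real where "R \<equiv> real p powr (5/4)"

lemma R_square: "R^2 = real p ^ 2 * sqrt (real p)"
proof -
  have "R^2 = real p powr (2 + 1/2)" using p_ge_5 by (simp add: powr_power)
  also have "\<dots> = real p powr 2 * real p powr (1/2)" by (rule powr_add)
  finally show ?thesis using p_ge_5 by (simp add: powr_half_sqrt)
qed

lemma p_le_R: "real p \<le> R"
  using powr_mono[of 1 "5/4" "real p"] p_ge_5 by simp

lemma BH_le_mean_zero:
  assumes "\<And>d. d \<in> V \<Longrightarrow> (\<Sum>s\<in>V. v s ((s + d) mod P)) = 0"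
  shows "\<bar>BH u v\<bar> \<le> 6 * R * sqrt (nrm2 u) * sqrt (nrm2 v)"
proof (rule BH_le)
  have "nrm2 (Hop v) \<le> 32 * real p ^ 2 * sqrt (real p) * nrm2 v" by (rule nrm2_Hop_mean_zero) (rule assms)
  also have "\<dots> \<le> 36 * real p ^ 2 * sqrt (real p) * nrm2 v" by (intro mult_right_mono nrm2_nonneg) simp_all
  also have "\<dots> = (6 * R)^2 * nrm2 v"
    by (simp add: power_mult_distrib R_square)
  finally show "nrm2 (Hop v) \<le> (6 * R)^2 * nrm2 v" .
qed simp

definition diagf :: "(int \<Rightarrow> real) \<Rightarrow> int \<Rightarrow> int \<Rightarrow> real" where
  "diagf y i j = y ((j - i) mod P)"

text \<open>The means over the diagonals; \<open>diagf (dmean v)\<close> is the orthogonal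
  projection of \<open>v\<close> to the functions that are constant along diagonals, that is,
  circulant.\<close>

definition dmean :: "(int \<Rightarrow> int \<Rightarrow> real) \<Rightarrow> int \<Rightarrow> real" where
  "dmean v d = (\<Sum>s\<in>V. v s ((s + d) mod P)) / real p"

lemma diagf_diagonal: "d \<in> V \<Longrightarrow> diagf y s ((s + d) mod P) = y d"
  by (simp add: diagf_def mod_diff_left_eq)

lemma nrm2_diagonals: "nrm2 v = (\<Sum>d\<in>V. \<Sum>s\<in>V. v s ((s + d) mod P) ^ 2)"
  unfolding nrm2_def by (rule sum_diagonals)

lemma nrm2_diagf: "nrm2 (diagf y) = real p * (\<Sum>d\<in>V. y d ^ 2)"
  unfolding nrm2_diagonals by (simp add: diagf_diagonal sum_distrib_left)

lemma mean_zero_diff_dmean: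
  "d \<in> V \<Longrightarrow> (\<Sum>s\<in>V. v s ((s + d) mod P) - diagf (dmean v) s ((s + d) mod P)) = 0"
  using p_ge_5 by (simp add: sum_subtractf diagf_diagonal dmean_def)

lemma nrm2_dmean_le: "nrm2 (diagf (dmean v)) \<le> nrm2 v"
proof -
  have "real p * dmean v d ^ 2 \<le> (\<Sum>s\<in>V. v s ((s + d) mod P) ^ 2)" for d
  proof -
    have "(\<Sum>s\<in>V. v s ((s + d) mod P) * 1)^2 \<le> (\<Sum>s\<in>V. v s ((s + d) mod P)^2) * (\<Sum>s\<in>V. 1^2)"
      by (rule Cauchy_Schwarz_ineq_sum)
    then show ?thesis using p_ge_5 by (simp add: dmean_def power_divide field_simps power2_eq_square)
  qed
  then show ?thesis unfolding nrm2_diagf nrm2_diagonals[of v] sum_distrib_left by (rule sum_mono)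
qed

lemma nrm2_diff_le: "nrm2 (\<lambda>i j. u i j - v i j) \<le> 2 * nrm2 u + 2 * nrm2 v"
proof -
  have "(u i j - v i j)^2 \<le> 2 * u i j ^ 2 + 2 * v i j ^ 2" for i j
    using sum_squares_ge_zero[of "u i j + v i j" 0] by (simp add: power2_eq_square algebra_simps)
  then show ?thesis unfolding nrm2_def sum_distrib_left sum.distrib[symmetric] by (intro sum_mono)
qed

text \<open>The difference of \<open>v\<close> and its circulant part has mean zero on each
  diagonal, and \<open>BH_le_mean_zero\<close> asks this of one argument only. Subtracting the
  projection at most doubles the norm in this estimate, hence \<open>12 = 6 * 2\<close>.\<close>

lemma BH_dmean: "\<bar>BH u v - BH u (diagf (dmean v))\<bar> \<le> 12 * R * sqrt (nrm2 u) * sqrt (nrm2 v)"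
proof -
  let ?z = "\<lambda>i j. v i j - diagf (dmean v) i j"
  have "BH u v = BH u (\<lambda>i j. ?z i j + diagf (dmean v) i j)" by simp
  then have "BH u v - BH u (diagf (dmean v)) = BH u ?z" unfolding BH_add_right by simp
  moreover have "\<bar>BH u ?z\<bar> \<le> 6 * R * sqrt (nrm2 u) * sqrt (nrm2 ?z)"
    by (rule BH_le_mean_zero) (rule mean_zero_diff_dmean)
  moreover have "sqrt (nrm2 ?z) \<le> 2 * sqrt (nrm2 v)"
  proof -
    have "nrm2 ?z \<le> 4 * nrm2 v" using nrm2_diff_le[of v "diagf (dmean v)"] nrm2_dmean_le[of v] by simp
    then have "sqrt (nrm2 ?z) \<le> sqrt (4 * nrm2 v)" by (rule real_sqrt_le_mono)
    then show ?thesis by (simp add: real_sqrt_mult)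
  qed
  then have "6 * R * sqrt (nrm2 u) * sqrt (nrm2 ?z) \<le> 6 * R * sqrt (nrm2 u) * (2 * sqrt (nrm2 v))"
    by (intro mult_left_mono) (auto simp: nrm2_nonneg)
  ultimately have "\<bar>BH u v - BH u (diagf (dmean v))\<bar> \<le> 6 * R * sqrt (nrm2 u) * (2 * sqrt (nrm2 v))"
    by linarith
  then show ?thesis by (simp add: ac_simps)
qed

subsection \<open>Inversion\<close>

text \<open>Translation-invariant functions carry only the frequency zero.  The form is invariant under
  inverting all four points, and inversion spreads such a function over the other frequencies.\<close>

lemma chi_minv_diff:
  assumes "i \<in> V - {0}" "k \<in> V - {0}"
  shows "chi (minv i - minv k) = chi i * chi k * chi (i - k)"
proof -
  note i = nonzero_V[OF assms(1)] and k = nonzero_V[OF assms(2)]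
  have "P dvd minv k * (i * minv i - 1) - minv i * (k * minv k - 1)"
    by (rule dvd_diff[OF dvd_mult[OF minv(2)[OF i]] dvd_mult[OF minv(2)[OF k]]])
  also have "minv k * (i * minv i - 1) - minv i * (k * minv k - 1) = minv i * minv k * (i - k) - (minv k - minv i)"
    by (simp add: algebra_simps)
  finally have "chi (minv k - minv i) = chi (minv i * minv k * (i - k))"
    by (intro chi_cong) (metis mod_eq_dvd_iff)
  then show ?thesis by (simp add: chi_mult chi_minv i k chi_diff_commute[of "minv i"])
qed

text \<open>Each vertex lies on two edges of the four-cycle, so the factors \<open>chi i\<close>
  produced by \<open>chi_minv_diff\<close> occur squared and disappear.\<close>

lemma cyc_minv:
  assumes "i \<in> V - {0}" "j \<in> V - {0}" "k \<in> V - {0}" "l \<in> V - {0}"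
  shows "cyc (minv i) (minv j) (minv k) (minv l) = cyc i j k l"
proof -
  have "cyc (minv i) (minv j) (minv k) (minv l) = chi i ^ 2 * chi j ^ 2 * chi k ^ 2 * chi l ^ 2 * cyc i j k l"
    unfolding cyc_def using assms by (simp add: chi_minv_diff power2_eq_square)
  then show ?thesis using assms[THEN nonzero_V] by (simp add: chi_square)
qed

text \<open>Inversion is undefined at 0, so the two axes get the default value 0. The form is
  therefore preserved only for functions that vanish on the axes.\<close>

definition flip :: "(int \<Rightarrow> int \<Rightarrow> real) \<Rightarrow> int \<Rightarrow> int \<Rightarrow> real" where
  "flip f i j = (if i = 0 \<or> j = 0 then 0 else f (minv i) (minv j))"

lemma sum_nonzero: "F 0 = 0 \<Longrightarrow> (\<Sum>x\<in>V. F x) = (\<Sum>x\<in>V-{0}. F x)" for F :: "int \<Rightarrow> real"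
  by (rule sum.mono_neutral_right) auto

lemma sum_minv: "(\<Sum>x\<in>V-{0}. F (minv x)) = (\<Sum>x\<in>V-{0}. F x)"
  by (rule sum.reindex_bij_betw[OF bij_minv])

lemma sum2_minv: "(\<Sum>x\<in>V-{0}. \<Sum>y\<in>V-{0}. F x y) = (\<Sum>x\<in>V-{0}. \<Sum>y\<in>V-{0}. F (minv x) (minv y))"
proof -
  have "(\<Sum>x\<in>V-{0}. \<Sum>y\<in>V-{0}. F x y) = (\<Sum>x\<in>V-{0}. \<Sum>y\<in>V-{0}. F (minv x) y)"
    by (rule sum_minv[of "\<lambda>x. \<Sum>y\<in>V-{0}. F x y", symmetric])
  also have "\<dots> = (\<Sum>x\<in>V-{0}. \<Sum>y\<in>V-{0}. F (minv x) (minv y))"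
    by (rule sum.cong[OF refl]) (rule sum_minv[symmetric])
  finally show ?thesis .
qed

lemma sum2_nonzero:
  fixes F :: "int \<Rightarrow> int \<Rightarrow> real"
  assumes "\<And>j. F 0 j = 0" "\<And>i. F i 0 = 0"
  shows "(\<Sum>i\<in>V. \<Sum>j\<in>V. F i j) = (\<Sum>i\<in>V-{0}. \<Sum>j\<in>V-{0}. F i j)"
  using assms by (simp add: sum_nonzero)

lemma flip_preserves:
  assumes "\<And>j. f 0 j = 0" "\<And>i. f i 0 = 0"
  shows "BH (flip f) (flip f) = BH f f" and "nrm2 (flip f) = nrm2 f"
proof -
  let ?W = "V - {0}"
  have f0: "flip f 0 j = 0" "flip f i 0 = 0" for i j by (simp_all add: flip_def)
  have e: "BH g g = (\<Sum>i\<in>?W. \<Sum>j\<in>?W. \<Sum>k\<in>?W. \<Sum>l\<in>?W. g i j * g k l * cyc k l i j)"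
    if "\<And>j. g 0 j = 0" "\<And>i. g i 0 = 0" for g
    unfolding BH_def Hop_def using that by (simp add: sum2_nonzero sum_distrib_left mult.assoc)
  have "BH f f = (\<Sum>i\<in>?W. \<Sum>j\<in>?W. \<Sum>k\<in>?W. \<Sum>l\<in>?W. f i j * f k l * cyc k l i j)"
    by (rule e) (simp_all add: assms)
  also have "\<dots> = (\<Sum>i\<in>?W. \<Sum>j\<in>?W. \<Sum>k\<in>?W. \<Sum>l\<in>?W.
      f (minv i) (minv j) * f (minv k) (minv l) * cyc (minv k) (minv l) (minv i) (minv j))"
    by (rule trans[OF sum2_minv]) (intro sum.cong[OF refl] sum2_minv)
  also have "\<dots> = (\<Sum>i\<in>?W. \<Sum>j\<in>?W. \<Sum>k\<in>?W. \<Sum>l\<in>?W. flip f i j * flip f k l * cyc k l i j)"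
    by (intro sum.cong refl) (subst cyc_minv, auto simp: flip_def)
  also have "\<dots> = BH (flip f) (flip f)"
    by (rule e[symmetric]) (simp_all add: f0)
  finally show "BH (flip f) (flip f) = BH f f" ..
  have "nrm2 f = (\<Sum>i\<in>?W. \<Sum>j\<in>?W. f i j ^ 2)"
    unfolding nrm2_def using assms by (intro sum2_nonzero) auto
  also have "\<dots> = (\<Sum>i\<in>?W. \<Sum>j\<in>?W. f (minv i) (minv j) ^ 2)"
    by (rule sum2_minv)
  also have "\<dots> = (\<Sum>i\<in>?W. \<Sum>j\<in>?W. flip f i j ^ 2)"
    by (intro sum.cong refl) (auto simp: flip_def)
  also have "\<dots> = nrm2 (flip f)"
    unfolding nrm2_def by (rule sum2_nonzero[symmetric]) (simp_all add: f0)
  finally show "nrm2 (flip f) = nrm2 f" ..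
qed

text \<open>Clearing denominators in \<open>1 / (s + d) - 1 / s = z\<close> gives the quadratic
  equation \<open>z s (s + d) + d = 0\<close> in \<open>s\<close>. Its discriminant is
  \<open>d z (d z - 4)\<close>, and \<open>card_sqrt\<close> counts the roots.\<close>

lemma card_inverse_difference:
  assumes d: "d \<in> V - {0}" and z: "z \<in> V - {0}"
  shows "real (card {s\<in>V. s \<noteq> 0 \<and> (s + d) mod P \<noteq> 0 \<and> (minv ((s + d) mod P) - minv s) mod P = z})
     = 1 + chi (d * z * (d * z - 4))"
proof -
  note nd = nonzero_V[OF d] and nz = nonzero_V[OF z]
  have n2: "\<not> P dvd 2" using p_ge_5 zdvd_not_zless[of 2 P] by simp
  have n4: "\<not> P dvd 4" using dvd_mult_P[of 2 2] n2 by simp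
  have eq: "s \<noteq> 0 \<and> (s + d) mod P \<noteq> 0 \<and> (minv ((s + d) mod P) - minv s) mod P = z \<longleftrightarrow> P dvd z * (s * (s + d)) + d"
    if s: "s \<in> V" for s
  proof (cases "P dvd s \<or> P dvd s + d")
    case True
    have "P dvd s * (s + d)" using True by auto
    then have "\<not> P dvd z * (s * (s + d)) + d" using nd by (simp add: dvd_add_right_iff)
    moreover have "s = 0 \<or> (s + d) mod P = 0" using True V_eq_iff[OF s, of 0] by (auto simp: mod_eq_0_iff_dvd)
    ultimately show ?thesis by auto
  next
    case False
    let ?t = "(s + d) mod P"
    have nt: "\<not> P dvd ?t" using False by (simp add: dvd_eq_mod_eq_0)
    have ns: "\<not> P dvd s" using False by simp
    have t: "[?t = s + d] (mod P)" by (simp add: cong_def)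
    have ms: "[s * minv s = 1] (mod P)" using minv(2)[OF ns] by (simp add: cong_iff_dvd_diff)
    have "[?t * minv ?t = 1] (mod P)" using minv(2)[OF nt] by (simp add: cong_iff_dvd_diff)
    then have mt: "[(s + d) * minv ?t = 1] (mod P)"
      using t by (metis cong_scalar_right cong_sym cong_trans)
    have "[(minv ?t - minv s) * (s * (s + d)) = s * ((s + d) * minv ?t) - (s + d) * (s * minv s)] (mod P)"
      by (simp add: algebra_simps)
    also have "[s * ((s + d) * minv ?t) - (s + d) * (s * minv s) = s * 1 - (s + d) * 1] (mod P)"
      using ms mt by (intro cong_diff cong_mult cong_refl)
    finally have m: "P dvd (minv ?t - minv s) * (s * (s + d)) + d"
      by (simp add: cong_iff_dvd_diff)
    have "(minv ?t - minv s) mod P = z \<longleftrightarrow> P dvd z - (minv ?t - minv s)"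
      using mod_eq_dvd_iff[of z P "minv ?t - minv s"] z by auto
    also have "\<dots> \<longleftrightarrow> P dvd (z - (minv ?t - minv s)) * (s * (s + d))"
      using False by (simp add: dvd_mult_P)
    also have "(z - (minv ?t - minv s)) * (s * (s + d)) =
        (z * (s * (s + d)) + d) - ((minv ?t - minv s) * (s * (s + d)) + d)"
      by (simp add: algebra_simps)
    also have "P dvd \<dots> \<longleftrightarrow> P dvd z * (s * (s + d)) + d" using m by (rule dvd_diff_left_iff)
    finally have "(minv ?t - minv s) mod P = z \<longleftrightarrow> P dvd z * (s * (s + d)) + d" .
    moreover have "s \<noteq> 0" using ns by auto
    moreover have "?t \<noteq> 0" using False by (simp add: mod_eq_0_iff_dvd)
    ultimately show ?thesis by blast
  qed
  \<comment> \<open>Completing the square: \<open>?g s\<close> is the derivative of the quadratic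
    polynomial, and its square minus the discriminant is \<open>4 z\<close> times that
    polynomial.\<close>
  let ?g = "\<lambda>s. ((2 * z) * s + z * d) mod P"
  have g: "bij_betw ?g V V" using n2 nz by (intro bij_affine) (simp add: dvd_mult_P)
  have eq2: "P dvd z * (s * (s + d)) + d \<longleftrightarrow> P dvd (?g s)^2 - d * z * (d * z - 4)" for s
  proof -
    have "P dvd (?g s)^2 - d * z * (d * z - 4) \<longleftrightarrow> P dvd ((2 * z) * s + z * d)^2 - d * z * (d * z - 4)"
      by (simp add: mod_eq_dvd_iff[symmetric] power_mod)
    also have "((2 * z) * s + z * d)^2 - d * z * (d * z - 4) = 4 * z * (z * (s * (s + d)) + d)"
      by (simp add: power2_eq_square algebra_simps)
    finally show ?thesis using n4 nz by (simp add: dvd_mult_P)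
  qed
  have eq3: "{s\<in>V. s \<noteq> 0 \<and> (s + d) mod P \<noteq> 0 \<and> (minv ((s + d) mod P) - minv s) mod P = z}
     = {s\<in>V. P dvd (?g s)^2 - d * z * (d * z - 4)}"
    by (intro Collect_cong conj_cong[OF refl]) (simp only: eq eq2)
  have surj: "?g ` V = V" using g by (rule bij_betw_imp_surj_on)
  have "?g ` {s\<in>V. P dvd (?g s)^2 - d * z * (d * z - 4)} = {t\<in>?g ` V. P dvd t^2 - d * z * (d * z - 4)}"
    by blast
  then have im: "?g ` {s\<in>V. P dvd (?g s)^2 - d * z * (d * z - 4)} = {t\<in>V. P dvd t^2 - d * z * (d * z - 4)}"
    unfolding surj .
  have cd: "card (?g ` {s\<in>V. P dvd (?g s)^2 - d * z * (d * z - 4)}) = card {s\<in>V. P dvd (?g s)^2 - d * z * (d * z - 4)}"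
    by (rule card_image, rule inj_on_subset[OF bij_betw_imp_inj_on[OF g]]) blast
  show ?thesis unfolding eq3 cd[symmetric] im by (rule card_sqrt)
qed

definition offaxis :: "(int \<Rightarrow> int \<Rightarrow> real) \<Rightarrow> int \<Rightarrow> int \<Rightarrow> real" where
  "offaxis u i j = (if i = 0 \<or> j = 0 then 0 else u i j)"

text \<open>Grouping a diagonal by the value \<open>z\<close> of the difference of inverses weights
  \<open>y z\<close> by the count of \<open>card_inverse_difference\<close>. The constant 1 in that
  count cancels because \<open>y\<close> has sum zero, and \<open>y 0 = 0\<close> disposes of
  \<open>z = 0\<close>.\<close>

lemma sum_flip_diagonal:
  assumes y0: "y 0 = 0" and y: "(\<Sum>z\<in>V. y z) = 0" and d: "d \<in> V"
  shows "(\<Sum>s\<in>V. flip (offaxis (diagf y)) s ((s + d) mod P)) = (\<Sum>z\<in>V. y z * (chi (d * z) * chi (d * z - 4)))"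
proof -
  define S where "S = {s\<in>V. s \<noteq> 0 \<and> (s + d) mod P \<noteq> 0}"
  let ?val = "\<lambda>s. (minv ((s + d) mod P) - minv s) mod P"
  have "(\<Sum>s\<in>V. flip (offaxis (diagf y)) s ((s + d) mod P)) = (\<Sum>s\<in>S. y (?val s))"
  proof (rule sum.mono_neutral_cong_right)
    show "flip (offaxis (diagf y)) s ((s + d) mod P) = y (?val s)" if "s \<in> S" for s
    proof -
      define t where "t = (s + d) mod P"
      have st: "s \<in> V - {0}" "t \<in> V - {0}" using that by (auto simp: S_def t_def)
      have "minv s \<noteq> 0" "minv t \<noteq> 0" "s \<noteq> 0" "t \<noteq> 0"
        using st minv_nonzero[OF st(1)] minv_nonzero[OF st(2)] by blast+
      then show ?thesis unfolding t_def[symmetric] by (simp only: flip_def offaxis_def diagf_def if_False simp_thms)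
    qed
    show "\<forall>s\<in>V - S. flip (offaxis (diagf y)) s ((s + d) mod P) = 0"
    proof
      fix s assume "s \<in> V - S"
      then have "s = 0 \<or> (s + d) mod P = 0" unfolding S_def by blast
      then show "flip (offaxis (diagf y)) s ((s + d) mod P) = 0" by (simp only: flip_def if_True)
    qed
  qed (auto simp: S_def)
  also have "\<dots> = (\<Sum>z\<in>V. \<Sum>s\<in>{s \<in> S. ?val s = z}. y (?val s))"
    by (rule sum.group[symmetric]) (auto simp: S_def)
  also have "\<dots> = (\<Sum>z\<in>V. y z * real (card {s \<in> S. ?val s = z}))"
    by (rule sum.cong[OF refl]) simp
  also have "\<dots> = (\<Sum>z\<in>V. y z * (chi (d * z) * chi (d * z - 4)))"
  proof (cases "d = 0")
    case True
    have "y z * real (card {s \<in> S. ?val s = z}) = 0" for z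
    proof (cases "z = 0")
      case False
      have "(minv (s mod P) - minv s) mod P = 0" if "s \<in> V" for s using that by simp
      then have "{s \<in> S. ?val s = z} = {}" using False by (auto simp: S_def True)
      then show ?thesis by (simp only: card.empty)
    qed (simp add: y0)
    then have "(\<Sum>z\<in>V. y z * real (card {s \<in> S. ?val s = z})) = 0" by (intro sum.neutral ballI)
    then show ?thesis using chi_eq_0_iff[of 0] by (simp add: True)
  next
    case False
    have "(\<Sum>z\<in>V. y z * real (card {s \<in> S. ?val s = z})) = (\<Sum>z\<in>V. y z * (1 + chi (d * z) * chi (d * z - 4)))"
    proof (rule sum.cong[OF refl])
      fix z assume z: "z \<in> V"
      show "y z * real (card {s \<in> S. ?val s = z}) = y z * (1 + chi (d * z) * chi (d * z - 4))"
      proof (cases "z = 0")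
        case True then show ?thesis by (simp add: y0)
      next
        case nz: False
        have e: "{s \<in> S. ?val s = z} = {s\<in>V. s \<noteq> 0 \<and> (s + d) mod P \<noteq> 0 \<and> ?val s = z}"
          unfolding S_def by (simp only: mem_Collect_eq conj_assoc)
        have "d \<in> V - {0}" "z \<in> V - {0}" using d z False nz by auto
        then show ?thesis
          unfolding e by (simp only: card_inverse_difference chi_mult[of "d * z"])
      qed
    qed
    then show ?thesis by (simp add: distrib_left sum.distrib y)
  qed
  finally show ?thesis .
qed

text \<open>Since \<open>d z - 4 = z (d - 4 / z)\<close>, this is an off-diagonal case of
  \<open>sum_chi_two\<close> at the distinct points \<open>4 / z\<close> and \<open>4 / w\<close>,
  times a sign.\<close>

lemma sum_chi_linear_two:
  assumes "z \<in> V - {0}" "w \<in> V - {0}" "z \<noteq> w"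
  shows "\<bar>\<Sum>d\<in>V. chi (d * z - 4) * chi (d * w - 4)\<bar> \<le> 1"
proof -
  let ?a = "\<lambda>z. (4 * minv z) mod P"
  have c: "chi (d * z - 4) = chi z * chi (?a z - d)" if "z \<in> V - {0}" for d z
  proof -
    note nz = nonzero_V[OF that]
    have "P dvd 4 * (z * minv z - 1)" using minv(2)[OF nz] by (rule dvd_mult)
    also have "4 * (z * minv z - 1) = (d * z - 4) - z * (d - 4 * minv z)" by (simp add: algebra_simps)
    finally have "chi (d * z - 4) = chi (z * (d - 4 * minv z))"
      by (intro chi_cong) (simp only: mod_eq_dvd_iff)
    then show ?thesis by (simp add: chi_mult chi_diff_commute[of d])
  qed
  have ne: "?a z \<noteq> ?a w"
  proof
    assume "?a z = ?a w"
    then have "P dvd 4 * minv z - 4 * minv w" by (simp only: mod_eq_dvd_iff)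
    also have "4 * minv z - 4 * minv w = 2 * (2 * (minv z - minv w))" by simp
    finally have "P dvd 2 \<or> P dvd minv z - minv w" by (auto simp only: dvd_mult_P)
    moreover have "\<not> P dvd 2" using p_ge_5 zdvd_not_zless[of 2 P] by simp
    ultimately have "minv z = minv w" using V_eq_iff[of "minv z" "minv w"] minv(1) nonzero_V assms by blast
    then show False using bij_minv assms by (metis bij_betw_def inj_on_def)
  qed
  have "(\<Sum>d\<in>V. chi (d * z - 4) * chi (d * w - 4)) = chi z * chi w * (\<Sum>d\<in>V. chi (?a z - d) * chi (?a w - d))"
    unfolding sum_distrib_left c[OF assms(1)] c[OF assms(2)] by (simp only: ac_simps)
  also have "\<dots> = - (chi z * chi w)" using ne by (subst sum_chi_two) auto
  finally show ?thesis using mult_mono[OF abs_chi_le[of z] abs_chi_le[of w]] by (simp add: abs_mult)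
qed

text \<open>Almost orthogonality: the vectors \<open>chi (d z) chi (d z - 4)\<close>, indexed by
  \<open>z\<close> with coordinate \<open>d\<close>, have squared norm at most \<open>p\<close> and
  mutual inner products at most 2, one from \<open>sum_chi_linear_two\<close> and one from the
  missing coordinate \<open>d = 0\<close>. The off-diagonal part costs \<open>2 p\<close> by
  Cauchy-Schwarz, in total \<open>3 p\<close>.\<close>

lemma sum_square_flip_le:
  "(\<Sum>d\<in>V. (\<Sum>z\<in>V. y z * (chi (d * z) * chi (d * z - 4)))^2) \<le> 3 * real p * (\<Sum>z\<in>V. y z ^ 2)"
proof -
  let ?c = "\<lambda>d z. chi (d * z) * chi (d * z - 4)"
  have inner: "\<bar>\<Sum>d\<in>V. ?c d z * ?c d w\<bar> \<le> (if z = w then real p else 0) + 2" if zw: "z \<in> V" "w \<in> V" for z w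
  proof (cases "z = w \<or> z = 0 \<or> w = 0")
    case True
    have c1: "\<bar>?c d z\<bar> \<le> 1" for d z using mult_mono[OF abs_chi_le[of "d * z"] abs_chi_le[of "d * z - 4"]] by (simp add: abs_mult)
    have "\<bar>\<Sum>d\<in>V. ?c d z * ?c d w\<bar> \<le> (\<Sum>d\<in>V. 1)"
      by (intro order_trans[OF sum_abs] sum_mono) (use mult_mono[OF c1 c1] in \<open>simp add: abs_mult\<close>)
    moreover have "(\<Sum>d\<in>V. ?c d z * ?c d w) = 0" if "z = 0 \<or> w = 0"
      using that chi_eq_0_iff[of 0] by auto
    ultimately show ?thesis using True by (cases "z = w") auto
  next
    case False
    then have zw': "z \<in> V - {0}" "w \<in> V - {0}" "z \<noteq> w" using zw by auto
    let ?X = "\<lambda>d. chi (d * z - 4) * chi (d * w - 4)"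
    have "(\<Sum>d\<in>V. ?c d z * ?c d w) = (\<Sum>d\<in>V-{0}. chi z * chi w * ?X d)"
    proof (rule sum.mono_neutral_cong_right)
      fix d assume "d \<in> V - {0}"
      then have "chi d * chi d = 1" using chi_square[OF nonzero_V, of d] by (simp add: power2_eq_square)
      moreover have "?c d z * ?c d w = chi d * chi d * (chi z * chi w * ?X d)" by (simp only: chi_mult ac_simps)
      ultimately show "?c d z * ?c d w = chi z * chi w * ?X d" by simp
    qed (use chi_eq_0_iff[of 0] in auto)
    also have "\<dots> = chi z * chi w * ((\<Sum>d\<in>V. ?X d) - ?X 0)"
      by (simp add: sum_diff1 right_diff_distrib flip: sum_distrib_left)
    finally have "\<bar>\<Sum>d\<in>V. ?c d z * ?c d w\<bar> = \<bar>chi z\<bar> * \<bar>chi w\<bar> * \<bar>(\<Sum>d\<in>V. ?X d) - ?X 0\<bar>"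
      by (simp only: abs_mult)
    also have "\<dots> \<le> 1 * 1 * \<bar>(\<Sum>d\<in>V. ?X d) - ?X 0\<bar>"
      by (intro mult_mono abs_chi_le) auto
    also have "\<dots> \<le> \<bar>\<Sum>d\<in>V. ?X d\<bar> + \<bar>?X 0\<bar>" unfolding mult_1 by (rule abs_triangle_ineq4)
    also have "\<dots> \<le> 1 + 1"
    proof (rule add_mono)
      show "\<bar>\<Sum>d\<in>V. ?X d\<bar> \<le> 1" by (rule sum_chi_linear_two[OF zw'])
      show "\<bar>?X 0\<bar> \<le> 1" using mult_mono[OF abs_chi_le[of "-4"] abs_chi_le[of "-4"]] by (simp add: abs_mult)
    qed
    finally show ?thesis using False by simp
  qed
  have "(\<Sum>d\<in>V. (\<Sum>z\<in>V. y z * ?c d z)^2) = (\<Sum>d\<in>V. \<Sum>z\<in>V. \<Sum>w\<in>V. y z * y w * (?c d z * ?c d w))"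
    unfolding power2_eq_square sum_product by (intro sum.cong refl) (simp only: ac_simps)
  also have "\<dots> = (\<Sum>z\<in>V. \<Sum>w\<in>V. \<Sum>d\<in>V. y z * y w * (?c d z * ?c d w))"
    by (subst sum.swap) (intro sum.cong refl sum.swap)
  also have "\<dots> = (\<Sum>z\<in>V. \<Sum>w\<in>V. y z * y w * (\<Sum>d\<in>V. ?c d z * ?c d w))"
    by (simp only: sum_distrib_left)
  also have "\<dots> \<le> (\<Sum>z\<in>V. \<Sum>w\<in>V. \<bar>y z\<bar> * \<bar>y w\<bar> * ((if z = w then real p else 0) + 2))"
  proof (intro sum_mono)
    fix z w assume "z \<in> V" "w \<in> V"
    have "y z * y w * (\<Sum>d\<in>V. ?c d z * ?c d w) \<le> \<bar>y z\<bar> * \<bar>y w\<bar> * \<bar>\<Sum>d\<in>V. ?c d z * ?c d w\<bar>"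
      by (simp only: abs_mult[symmetric] abs_ge_self)
    also have "\<dots> \<le> \<bar>y z\<bar> * \<bar>y w\<bar> * ((if z = w then real p else 0) + 2)"
      by (intro mult_left_mono inner \<open>z \<in> V\<close> \<open>w \<in> V\<close>) simp
    finally show "y z * y w * (\<Sum>d\<in>V. ?c d z * ?c d w) \<le> \<bar>y z\<bar> * \<bar>y w\<bar> * ((if z = w then real p else 0) + 2)" .
  qed
  also have "\<dots> = (\<Sum>z\<in>V. \<Sum>w\<in>V. (if z = w then real p * y z ^ 2 else 0) + 2 * (\<bar>y z\<bar> * \<bar>y w\<bar>))"
    by (intro sum.cong refl) (auto simp: algebra_simps power2_eq_square)
  also have "\<dots> = real p * (\<Sum>z\<in>V. y z ^ 2) + 2 * (\<Sum>z\<in>V. \<bar>y z\<bar>)^2"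
  proof -
    have "(\<Sum>z\<in>V. \<Sum>w\<in>V. 2 * (\<bar>y z\<bar> * \<bar>y w\<bar>)) = 2 * (\<Sum>z\<in>V. \<bar>y z\<bar>)^2"
      unfolding power2_eq_square sum_product by (simp only: sum_distrib_left)
    then show ?thesis by (simp add: sum.distrib flip: sum_distrib_left)
  qed
  also have "(\<Sum>z\<in>V. \<bar>y z\<bar>)^2 \<le> real p * (\<Sum>z\<in>V. y z ^ 2)"
    using Cauchy_Schwarz_ineq_sum[of "\<lambda>z. \<bar>y z\<bar>" "\<lambda>_. 1" V] by (simp add: mult.commute)
  finally show ?thesis by (simp add: algebra_simps)
qed

text \<open>A gain of a factor \<open>p\<close> over \<open>nrm2_diagf\<close>: inverting a
  circulant function leaves almost nothing of it at frequency zero.\<close>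

lemma nrm2_dmean_flip_le:
  assumes "y 0 = 0" "(\<Sum>z\<in>V. y z) = 0"
  shows "nrm2 (diagf (dmean (flip (offaxis (diagf y))))) \<le> 3 * (\<Sum>z\<in>V. y z ^ 2)"
proof -
  let ?v = "flip (offaxis (diagf y))"
  have "real p * nrm2 (diagf (dmean ?v)) = (\<Sum>d\<in>V. (real p * dmean ?v d)^2)"
    unfolding nrm2_diagf by (simp add: sum_distrib_left power2_eq_square ac_simps)
  also have "\<dots> = (\<Sum>d\<in>V. (\<Sum>z\<in>V. y z * (chi (d * z) * chi (d * z - 4)))^2)"
    unfolding dmean_def using p_ge_5 by (intro sum.cong refl) (simp add: sum_flip_diagonal[OF assms])
  also have "\<dots> \<le> 3 * real p * (\<Sum>z\<in>V. y z ^ 2)" by (rule sum_square_flip_le)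
  finally show ?thesis using p_ge_5 by simp
qed

lemma sqrt_mult_le: "a \<ge> 0 \<Longrightarrow> b \<ge> 0 \<Longrightarrow> c \<ge> 0 \<Longrightarrow> a * b \<le> c^2 \<Longrightarrow> sqrt a * sqrt b \<le> c"
  by (simp add: real_le_lsqrt flip: real_sqrt_mult)

lemma nrm2_offaxis_le: "nrm2 (offaxis u) \<le> nrm2 u"
  unfolding nrm2_def by (intro sum_mono) (simp add: offaxis_def)

lemma nrm2_axis_le: "nrm2 (\<lambda>i j. diagf y i j - offaxis (diagf y) i j) \<le> 2 * (\<Sum>d\<in>V. y d ^ 2)"
proof -
  have "nrm2 (\<lambda>i j. diagf y i j - offaxis (diagf y) i j) \<le>
      (\<Sum>i\<in>V. \<Sum>j\<in>V. of_bool (i = 0) * y j ^ 2 + of_bool (j = 0) * y ((- i) mod P) ^ 2)"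
    unfolding nrm2_def by (intro sum_mono) (auto simp: offaxis_def diagf_def)
  also have "\<dots> = (\<Sum>j\<in>V. y j ^ 2) + (\<Sum>i\<in>V. y ((- i) mod P) ^ 2)"
    by (simp add: sum.distrib sum.swap[of "\<lambda>i j. of_bool (i = 0) * y j ^ 2" V V] of_bool_def
        flip: sum_distrib_left sum_distrib_right)
  also have "(\<Sum>i\<in>V. y ((- i) mod P) ^ 2) = (\<Sum>i\<in>V. y i ^ 2)"
    using sum.reindex_bij_betw[OF bij_affine[of "-1" 0], of "\<lambda>i. y i ^ 2"] p_ge_5 by simp
  finally show ?thesis by simp
qed

text \<open>Off the axes \<open>diagf y\<close> is inverted to \<open>v\<close>, whose circulant
  part \<open>w\<close> is small, so \<open>BH_dmean\<close> applies to \<open>v\<close>. The axis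
  part \<open>u1\<close> has small norm too. All pairings with a small factor are left to the
  generic bound; the total is \<open>60 = 12 + 48\<close>.\<close>

lemma BH_diagf_le:
  assumes "y 0 = 0" "(\<Sum>z\<in>V. y z) = 0"
  shows "\<bar>BH (diagf y) (diagf y)\<bar> \<le> 60 * R * nrm2 (diagf y)"
proof -
  define Y where "Y = (\<Sum>d\<in>V. y d ^ 2)"
  define u0 where "u0 = offaxis (diagf y)"
  define u1 where "u1 = (\<lambda>i j. diagf y i j - u0 i j)"
  define v where "v = flip u0"
  define w where "w = diagf (dmean v)"
  have Y: "Y \<ge> 0" unfolding Y_def by (intro sum_nonneg) simp
  have n: "nrm2 (diagf y) = real p * Y" by (simp add: nrm2_diagf Y_def)
  have n0: "nrm2 u0 \<le> real p * Y" using nrm2_offaxis_le[of "diagf y"] n by (simp add: u0_def)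
  have n1: "nrm2 u1 \<le> 2 * Y" unfolding u1_def u0_def Y_def by (rule nrm2_axis_le)
  have u0z: "u0 0 j = 0" "u0 i 0 = 0" for i j by (simp_all add: u0_def offaxis_def)
  have nv: "nrm2 v \<le> real p * Y" using flip_preserves(2)[of u0, OF u0z] n0 by (simp add: v_def)
  have nw: "nrm2 w \<le> 3 * Y"
    unfolding w_def v_def u0_def Y_def by (rule nrm2_dmean_flip_le[OF assms])
  \<comment> \<open>Where the product of the squared norms is only of order \<open>p Y^2\<close>,
    the generic exponent yields \<open>p^(3/2) sqrt p Y = p^2 Y\<close>, which is below
    \<open>R p Y\<close>.\<close>
  have gen: "\<bar>BH a b\<bar> \<le> 6 * real p * sqrt (real p) * (2 * sqrt (real p) * Y)" if "nrm2 a * nrm2 b \<le> (2 * sqrt (real p) * Y)^2" for a b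
  proof -
    have "sqrt (nrm2 a) * sqrt (nrm2 b) \<le> 2 * sqrt (real p) * Y"
      using that Y by (intro sqrt_mult_le nrm2_nonneg) auto
    then have "6 * real p * sqrt (real p) * (sqrt (nrm2 a) * sqrt (nrm2 b)) \<le> 6 * real p * sqrt (real p) * (2 * sqrt (real p) * Y)"
      by (intro mult_left_mono) auto
    then show ?thesis using BH_le_generic[of a b] unfolding mult.assoc by linarith
  qed
  have gen': "6 * real p * sqrt (real p) * (2 * sqrt (real p) * Y) = 12 * (real p * (real p * Y))" by simp
  have four: "(2 * sqrt (real p) * Y)^2 = 4 * (real p * Y^2)" by (simp add: power_mult_distrib)
  have b10: "\<bar>BH u1 u0\<bar> \<le> 12 * (real p * (real p * Y))"
    unfolding gen'[symmetric]
  proof (rule gen)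
    have "nrm2 u1 * nrm2 u0 \<le> (2 * Y) * (real p * Y)" using n0 n1 Y nrm2_nonneg by (intro mult_mono) auto
    also have "\<dots> = 2 * (real p * Y^2)" by (simp add: power2_eq_square)
    also have "\<dots> \<le> 4 * (real p * Y^2)" by (rule mult_right_mono) simp_all
    finally show "nrm2 u1 * nrm2 u0 \<le> (2 * sqrt (real p) * Y)^2" unfolding four .
  qed
  have b11: "\<bar>BH u1 u1\<bar> \<le> 12 * (real p * (real p * Y))"
    unfolding gen'[symmetric]
  proof (rule gen)
    have "nrm2 u1 * nrm2 u1 \<le> (2 * Y) * (2 * Y)" using n1 Y nrm2_nonneg by (intro mult_mono) auto
    also have "\<dots> = 4 * (1 * Y^2)" by (simp add: power2_eq_square)
    also have "\<dots> \<le> 4 * (real p * Y^2)" using p_ge_5 by (intro mult_left_mono mult_right_mono) auto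
    finally show "nrm2 u1 * nrm2 u1 \<le> (2 * sqrt (real p) * Y)^2" unfolding four .
  qed
  have bw: "\<bar>BH v w\<bar> \<le> 12 * (real p * (real p * Y))"
    unfolding gen'[symmetric]
  proof (rule gen)
    have "nrm2 v * nrm2 w \<le> (real p * Y) * (3 * Y)" using nv nw Y nrm2_nonneg by (intro mult_mono) auto
    also have "\<dots> = 3 * (real p * Y^2)" by (simp add: power2_eq_square)
    also have "\<dots> \<le> 4 * (real p * Y^2)" by (rule mult_right_mono) simp_all
    finally show "nrm2 v * nrm2 w \<le> (2 * sqrt (real p) * Y)^2" unfolding four .
  qed
  have "\<bar>BH v v - BH v w\<bar> \<le> 12 * R * sqrt (nrm2 v) * sqrt (nrm2 v)"
    unfolding w_def by (rule BH_dmean)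
  also have "\<dots> = 12 * R * nrm2 v" by (simp add: nrm2_nonneg)
  also have "\<dots> \<le> 12 * R * (real p * Y)" using nv by (intro mult_left_mono) auto
  finally have bv: "\<bar>BH v v\<bar> \<le> 12 * R * (real p * Y) + 12 * (real p * (real p * Y))" using bw by linarith
  have "BH (diagf y) (diagf y) = BH (\<lambda>i j. u0 i j + u1 i j) (\<lambda>i j. u0 i j + u1 i j)"
    by (simp add: u1_def)
  also have "\<dots> = BH v v + 2 * BH u1 u0 + BH u1 u1"
    unfolding BH_add_left BH_add_right using flip_preserves(1)[of u0, OF u0z] BH_commute[of u0 u1]
    by (simp add: v_def)
  finally have "\<bar>BH (diagf y) (diagf y)\<bar> \<le> 12 * R * (real p * Y) + 48 * (real p * (real p * Y))"
    using bv b10 b11 by linarith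
  also have "48 * (real p * (real p * Y)) \<le> 48 * (R * (real p * Y))"
    using p_le_R Y by (intro mult_left_mono mult_right_mono) auto
  finally show ?thesis unfolding n by (simp add: ac_simps)
qed

section \<open>The constant direction and the four-cycle bound\<close>

definition offdiag :: "int \<Rightarrow> int \<Rightarrow> real" where "offdiag i j = of_bool (i \<noteq> j)"

text \<open>The kernel factors as \<open>?f i * ?f j\<close>, so the sum over all \<open>i\<close>
  and \<open>j\<close> is the square of an off-diagonal entry of \<open>S^2\<close>, which is 1.
  Excluding \<open>i = j\<close> subtracts at most \<open>p\<close>, so the constant direction is
  nearly annihilated.\<close>

lemma Hop_offdiag_le:
  assumes "k \<in> V" "l \<in> V" "k \<noteq> l"
  shows "\<bar>Hop offdiag k l\<bar> \<le> real p"
proof -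
  let ?f = "\<lambda>i. chi (i - k) * chi (i - l)"
  have "Hop offdiag k l = (\<Sum>i\<in>V. \<Sum>j\<in>V. ?f i * ?f j - (if i = j then ?f i ^ 2 else 0))"
    unfolding Hop_def by (intro sum.cong refl) (auto simp: offdiag_def cyc_def power2_eq_square)
  also have "\<dots> = (\<Sum>i\<in>V. ?f i)^2 - (\<Sum>i\<in>V. ?f i ^ 2)"
    by (simp add: sum_subtractf power2_eq_square[of "sum _ _"] sum_product)
  also have "(\<Sum>i\<in>V. ?f i) = (\<Sum>i\<in>V. chi (k - i) * chi (l - i))"
    by (intro sum.cong refl) (simp only: chi_diff_commute)
  also have "\<dots> = -1" using assms by (simp add: sum_chi_two)
  finally have *: "Hop offdiag k l = 1 - (\<Sum>i\<in>V. ?f i ^ 2)" by simp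
  have "?f i ^ 2 \<le> 1" for i
    using power_mono[OF mult_mono[OF abs_chi_le[of "i - k"] abs_chi_le[of "i - l"]], of 2]
    by (simp add: power_mult_distrib)
  then have "(\<Sum>i\<in>V. ?f i ^ 2) \<le> (\<Sum>i\<in>V. 1)" by (intro sum_mono)
  moreover have "(\<Sum>i\<in>V. ?f i ^ 2) \<ge> 0" by (intro sum_nonneg) simp
  ultimately show ?thesis unfolding * using p_ge_5 by (simp add: abs_le_iff)
qed

lemma sum_le_nrm2: "(\<Sum>i\<in>V. \<Sum>j\<in>V. \<bar>v i j\<bar>) \<le> real p * sqrt (nrm2 v)"
proof -
  have "(\<Sum>i\<in>V. \<Sum>j\<in>V. \<bar>v i j\<bar> * 1)^2 \<le> (\<Sum>i\<in>V. \<Sum>j\<in>V. \<bar>v i j\<bar>^2) * (\<Sum>i\<in>V. \<Sum>j\<in>V. 1^2)"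
    by (rule Cauchy_Schwarz_sum2)
  also have "\<dots> = (real p * sqrt (nrm2 v))^2"
    unfolding power_mult_distrib real_sqrt_pow2[OF nrm2_nonneg] by (simp add: nrm2_def power2_eq_square)
  finally have "(\<Sum>i\<in>V. \<Sum>j\<in>V. \<bar>v i j\<bar>)^2 \<le> (real p * sqrt (nrm2 v))^2" by (simp only: mult_1_right)
  then show ?thesis by (rule power2_le_imp_le) (simp add: nrm2_nonneg)
qed

lemma BH_offdiag_le:
  assumes "\<And>i. i \<in> V \<Longrightarrow> v i i = 0"
  shows "\<bar>BH v offdiag\<bar> \<le> real p * (real p * sqrt (nrm2 v))"
proof -
  have "\<bar>BH v offdiag\<bar> \<le> (\<Sum>i\<in>V. \<Sum>j\<in>V. \<bar>v i j * Hop offdiag i j\<bar>)"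
    unfolding BH_def by (intro order_trans[OF sum_abs] sum_mono sum_abs)
  also have "\<dots> \<le> (\<Sum>i\<in>V. \<Sum>j\<in>V. \<bar>v i j\<bar> * real p)"
  proof (intro sum_mono)
    fix i j assume ij: "i \<in> V" "j \<in> V"
    show "\<bar>v i j * Hop offdiag i j\<bar> \<le> \<bar>v i j\<bar> * real p"
    proof (cases "i = j")
      case True then show ?thesis using assms ij by simp
    next
      case False
      then show ?thesis unfolding abs_mult using Hop_offdiag_le[OF ij] by (intro mult_left_mono) auto
    qed
  qed
  also have "\<dots> = real p * (\<Sum>i\<in>V. \<Sum>j\<in>V. \<bar>v i j\<bar>)"
    by (simp add: sum_distrib_left mult.commute)
  also have "\<dots> \<le> real p * (real p * sqrt (nrm2 v))" by (intro mult_left_mono sum_le_nrm2) simp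
  finally show ?thesis .
qed

text \<open>Replacing \<open>v\<close> by its circulant part \<open>w\<close> in both arguments
  costs \<open>O(R)\<close>. Then \<open>w\<close> is split into \<open>diagf y\<close> with
  \<open>y\<close> of sum zero, covered by \<open>BH_diagf_le\<close>, and a multiple of
  \<open>offdiag\<close>. The zero diagonal gives \<open>dmean v 0 = 0\<close>, which this splitting
  uses.\<close>

theorem four_cycle_bound:
  assumes diag: "\<And>i. i \<in> V \<Longrightarrow> v i i = 0"
  shows "\<bar>BH v v\<bar> \<le> 1000 * R * nrm2 v"
proof -
  define N where "N = sqrt (nrm2 v)"
  define w where "w = diagf (dmean v)"
  \<comment> \<open>The mean over the \<open>p - 1\<close> nonzero diagonals, so that
    \<open>y\<close> vanishes at 0 and still has sum zero.\<close>
  define m where "m = (\<Sum>d\<in>V. dmean v d) / (real p - 1)"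
  define y where "y = (\<lambda>d. if d = 0 then 0 else dmean v d - m)"
  have N: "N \<ge> 0" "N^2 = nrm2 v" by (simp_all add: N_def nrm2_nonneg)
  have d0: "dmean v 0 = 0" unfolding dmean_def using diag by simp
  have w: "w i j = diagf y i j + m * offdiag i j" if "i \<in> V" "j \<in> V" for i j
  proof -
    have "(j - i) mod P = 0 \<longleftrightarrow> i = j" using V_eq_iff[OF that(2,1)] by (auto simp: mod_eq_0_iff_dvd)
    then show ?thesis by (auto simp: w_def diagf_def y_def offdiag_def d0)
  qed
  have BHw: "BH a w = BH a (\<lambda>i j. diagf y i j + m * offdiag i j)" for a
    unfolding BH_def Hop_def by (intro sum.cong refl arg_cong2[of _ _ _ _ "(*)"] ) (simp_all add: w)
  have y0: "y 0 = 0" by (simp add: y_def)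
  have ysum: "(\<Sum>d\<in>V. y d) = 0"
  proof -
    have "(\<Sum>d\<in>V. y d) = (\<Sum>d\<in>V-{0}. dmean v d - m)" unfolding y_def by (rule sum.mono_neutral_cong_right) auto
    also have "\<dots> = (\<Sum>d\<in>V. dmean v d) - (real p - 1) * m"
      using p_ge_5 by (simp add: sum_subtractf sum_diff1 d0 of_nat_diff)
    also have "\<dots> = 0" using p_ge_5 by (simp add: m_def)
    finally show ?thesis .
  qed
  have m: "\<bar>m\<bar> * real p \<le> 2 * N"
  proof -
    have "(\<Sum>d\<in>V. dmean v d) * real p = (\<Sum>i\<in>V. \<Sum>j\<in>V. v i j)"
      unfolding sum_diagonals[of v] dmean_def using p_ge_5 by (simp flip: sum_divide_distrib)
    then have "\<bar>\<Sum>d\<in>V. dmean v d\<bar> * real p = \<bar>\<Sum>i\<in>V. \<Sum>j\<in>V. v i j\<bar>" by (metis abs_mult abs_of_nat)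
    also have "\<dots> \<le> (\<Sum>i\<in>V. \<Sum>j\<in>V. \<bar>v i j\<bar>)" by (intro order_trans[OF sum_abs] sum_mono sum_abs)
    also have "\<dots> \<le> N * real p" using sum_le_nrm2[of v] by (simp add: N_def mult.commute)
    finally have "\<bar>\<Sum>d\<in>V. dmean v d\<bar> \<le> N" using p_ge_5 by simp
    moreover have "\<bar>m\<bar> * (real p - 1) = \<bar>\<Sum>d\<in>V. dmean v d\<bar>" using p_ge_5 by (simp add: m_def abs_divide)
    moreover have "\<bar>m\<bar> * real p \<le> \<bar>m\<bar> * (2 * (real p - 1))" using p_ge_5 by (intro mult_left_mono) auto
    moreover have "\<bar>m\<bar> * (2 * (real p - 1)) = 2 * (\<bar>m\<bar> * (real p - 1))" by simp
    ultimately show ?thesis by linarith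
  qed
  have noff: "nrm2 offdiag \<le> real p ^ 2"
  proof -
    have "nrm2 offdiag \<le> (\<Sum>i\<in>V. \<Sum>j\<in>V. 1)" unfolding nrm2_def offdiag_def by (intro sum_mono) simp
    then show ?thesis by (simp add: power2_eq_square)
  qed
  have ny: "nrm2 (diagf y) \<le> 10 * nrm2 v"
  proof -
    have "nrm2 (diagf y) = nrm2 (\<lambda>i j. w i j - m * offdiag i j)"
      unfolding nrm2_def by (intro sum.cong refl) (simp add: w)
    also have "\<dots> \<le> 2 * nrm2 w + 2 * nrm2 (\<lambda>i j. m * offdiag i j)" by (rule nrm2_diff_le)
    also have "nrm2 (\<lambda>i j. m * offdiag i j) = m^2 * nrm2 offdiag"
      unfolding nrm2_def by (simp add: power_mult_distrib sum_distrib_left)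
    also have "m^2 * nrm2 offdiag \<le> m^2 * real p ^ 2" by (intro mult_left_mono noff) simp
    also have "m^2 * real p ^ 2 = (\<bar>m\<bar> * real p)^2" by (simp add: power_mult_distrib)
    also have "\<dots> \<le> (2 * N)^2" by (intro power_mono m) simp
    also have "(2 * N)^2 = 4 * nrm2 v" by (simp add: power_mult_distrib N)
    also have "nrm2 w \<le> nrm2 v" unfolding w_def by (rule nrm2_dmean_le)
    finally show ?thesis by simp
  qed
  have sy: "sqrt (nrm2 (diagf y)) \<le> 4 * N"
  proof -
    have "nrm2 (diagf y) \<le> (4 * N)^2" using ny nrm2_nonneg[of v] by (simp add: power_mult_distrib N)
    then show ?thesis using N by (intro real_le_lsqrt) auto
  qed
  have b1: "\<bar>BH v v - BH v w\<bar> \<le> 12 * R * nrm2 v"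
    using BH_dmean[of v v] by (simp add: w_def nrm2_nonneg mult.assoc)
  have b2: "\<bar>BH v w - BH w w\<bar> \<le> 12 * R * nrm2 v"
  proof -
    have "\<bar>BH w v - BH w w\<bar> \<le> 12 * R * sqrt (nrm2 w) * sqrt (nrm2 v)" unfolding w_def by (rule BH_dmean)
    also have "\<dots> \<le> 12 * R * sqrt (nrm2 v) * sqrt (nrm2 v)"
      unfolding w_def by (intro mult_right_mono mult_left_mono real_sqrt_le_mono nrm2_dmean_le) (auto simp: nrm2_nonneg)
    also have "\<dots> = 12 * R * nrm2 v" by (simp add: nrm2_nonneg mult.assoc)
    finally show ?thesis by (simp add: BH_commute[of v w])
  qed
  have e: "BH a w = BH a (diagf y) + m * BH a offdiag" for a
    using BHw[of a] BH_add_right[of a "diagf y" "\<lambda>i j. m * offdiag i j"] BH_scale_right[of a m offdiag] by linarith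
  have "BH w w = BH (diagf y) w + m * BH offdiag w"
    using e[of w] BH_commute[of w "diagf y"] BH_commute[of w offdiag] by (simp only:)
  moreover have "m * BH offdiag w = m * BH (diagf y) offdiag + m * (m * BH offdiag offdiag)"
    unfolding e[of offdiag] BH_commute[of offdiag "diagf y"] by (rule distrib_left)
  ultimately have ww: "BH w w = BH (diagf y) (diagf y) + 2 * (m * BH (diagf y) offdiag) + m * (m * BH offdiag offdiag)"
    using e[of "diagf y"] by linarith
  have b3: "\<bar>BH (diagf y) (diagf y)\<bar> \<le> 600 * R * nrm2 v"
  proof -
    have "\<bar>BH (diagf y) (diagf y)\<bar> \<le> 60 * R * nrm2 (diagf y)" by (rule BH_diagf_le[OF y0 ysum])
    also have "\<dots> \<le> 60 * R * (10 * nrm2 v)" by (intro mult_left_mono ny) simp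
    finally show ?thesis by simp
  qed
  have b4: "\<bar>m * BH (diagf y) offdiag\<bar> \<le> 8 * (R * nrm2 v)"
  proof -
    have "\<bar>BH (diagf y) offdiag\<bar> \<le> real p * (real p * sqrt (nrm2 (diagf y)))"
      by (rule BH_offdiag_le) (simp add: diagf_def y0)
    also have "\<dots> \<le> real p * (real p * (4 * N))" by (intro mult_left_mono sy) auto
    finally have "\<bar>m\<bar> * \<bar>BH (diagf y) offdiag\<bar> \<le> \<bar>m\<bar> * (real p * (real p * (4 * N)))" by (rule mult_left_mono) simp
    also have "\<dots> = (\<bar>m\<bar> * real p) * (real p * (4 * N))" by simp
    also have "\<dots> \<le> (2 * N) * (real p * (4 * N))" using N by (intro mult_right_mono m) auto
    also have "\<dots> = 8 * (real p * nrm2 v)" by (simp add: N(2)[symmetric] power2_eq_square)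
    also have "\<dots> \<le> 8 * (R * nrm2 v)" by (intro mult_left_mono mult_right_mono p_le_R nrm2_nonneg) simp
    finally show ?thesis by (simp add: abs_mult)
  qed
  have b5: "\<bar>m * (m * BH offdiag offdiag)\<bar> \<le> 4 * (R * nrm2 v)"
  proof -
    have "\<bar>BH offdiag offdiag\<bar> \<le> real p * (real p * sqrt (nrm2 offdiag))"
      by (rule BH_offdiag_le) (simp add: offdiag_def)
    also have "\<dots> \<le> real p * (real p * real p)" by (intro mult_left_mono real_le_lsqrt noff) auto
    finally have "\<bar>m\<bar> * (\<bar>m\<bar> * \<bar>BH offdiag offdiag\<bar>) \<le> \<bar>m\<bar> * (\<bar>m\<bar> * (real p * (real p * real p)))"
      by (intro mult_left_mono) auto
    also have "\<dots> = (\<bar>m\<bar> * real p)^2 * real p" by (simp add: power2_eq_square)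
    also have "\<dots> \<le> (2 * N)^2 * real p" by (intro mult_right_mono power_mono m) auto
    also have "\<dots> = 4 * (real p * nrm2 v)" by (simp add: power_mult_distrib N)
    also have "\<dots> \<le> 4 * (R * nrm2 v)" by (intro mult_left_mono mult_right_mono p_le_R nrm2_nonneg) simp
    finally show ?thesis by (simp add: abs_mult)
  qed
  have "\<bar>BH v v\<bar> \<le> 12 * R * nrm2 v + 12 * R * nrm2 v + 600 * R * nrm2 v + 2 * (8 * (R * nrm2 v)) + 4 * (R * nrm2 v)"
    using b1 b2 b3 b4 b5 ww by linarith
  also have "\<dots> = 644 * (R * nrm2 v)" by simp
  also have "\<dots> \<le> 1000 * (R * nrm2 v)" by (intro mult_right_mono mult_nonneg_nonneg nrm2_nonneg) auto
  finally show ?thesis by (simp add: mult.assoc)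
qed

end

section \<open>Quadratic forms on conference graphs\<close>

lemma sum_swap_pairs:
  "(\<Sum>a\<in>A. \<Sum>b\<in>B. \<Sum>c\<in>C. \<Sum>d\<in>D. f a b c d) = (\<Sum>c\<in>C. \<Sum>d\<in>D. \<Sum>a\<in>A. \<Sum>b\<in>B. f a b c d)"
  unfolding sum_tuple4[symmetric]
  by (rule sum.reindex_bij_witness[where i = "\<lambda>(c, d, a, b). (a, b, c, d)" and j = "\<lambda>(a, b, c, d). (c, d, a, b)"]) auto

text \<open>\<open>S\<close> is the sign matrix of a conference graph: its rows sum to zero and
  \<open>S^2 = n I - J\<close>. Both bounds on the optimum are derived from these properties and the
  four-cycle estimate with constant \<open>K\<close>; the Paley graph enters with
  \<open>K = 1000\<close>.\<close>

locale conference =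
  fixes V :: "'v set" and S :: "'v \<Rightarrow> 'v \<Rightarrow> real" and K :: real
  assumes finite_V: "finite V"
    and S_sym: "S i j = S j i"
    and S_diag: "S i i = 0"
    and S_values: "i \<in> V \<Longrightarrow> j \<in> V \<Longrightarrow> i \<noteq> j \<Longrightarrow> S i j = 1 \<or> S i j = -1"
    and S_row: "i \<in> V \<Longrightarrow> (\<Sum>k\<in>V. S i k) = 0"
    and S_orth: "i \<in> V \<Longrightarrow> j \<in> V \<Longrightarrow> (\<Sum>k\<in>V. S i k * S j k) = (if i = j then real (card V) else 0) - 1"
    and K_pos: "K \<ge> 0"
    and four_cycle: "(\<And>i. i \<in> V \<Longrightarrow> v i i = 0) \<Longrightarrow>
      \<bar>\<Sum>(i, j, k, l)\<in>V \<times> V \<times> V \<times> V. v i j * v k l * (S i k * S i l * S j k * S j l)\<bar>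
        \<le> K * real (card V) powr (5/4) * (\<Sum>i\<in>V. \<Sum>j\<in>V. v i j ^ 2)"
begin

abbreviation n :: real where "n \<equiv> real (card V)"
abbreviation R :: real where "R \<equiv> n powr (5/4)"
abbreviation VVVV :: "('v \<times> 'v \<times> 'v \<times> 'v) set" where "VVVV \<equiv> V \<times> V \<times> V \<times> V"

definition sq :: "('v \<Rightarrow> real) \<Rightarrow> real" where "sq y = (\<Sum>i\<in>V. y i ^ 2)"
definition sq2 :: "('v \<Rightarrow> 'v \<Rightarrow> real) \<Rightarrow> real" where "sq2 Y = (\<Sum>i\<in>V. \<Sum>j\<in>V. Y i j ^ 2)"
definition dg :: "('v \<Rightarrow> 'v \<Rightarrow> real) \<Rightarrow> 'v \<Rightarrow> real" where "dg Y i = (\<Sum>j\<in>V. Y i j)"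
definition wd :: "('v \<Rightarrow> 'v \<Rightarrow> real) \<Rightarrow> 'v \<Rightarrow> real" where
  "wd Y i = (\<Sum>k\<in>V. \<Sum>l\<in>V. Y k l * (S i k * S i l))"
definition SB :: "('v \<Rightarrow> real) \<Rightarrow> ('v \<Rightarrow> real) \<Rightarrow> real" where
  "SB u v = (\<Sum>i\<in>V. \<Sum>j\<in>V. u i * S i j * v j)"
text \<open>The \<open>of_bool\<close> term corrects the diagonal, where \<open>(1 + S) / 2\<close>
  would be one half.\<close>

definition ad :: "'v \<Rightarrow> 'v \<Rightarrow> real" where
  "ad i j = (1 + S i j - of_bool (i = j)) / 2"

lemma sq_nonneg [simp]: "sq y \<ge> 0" unfolding sq_def by (intro sum_nonneg) simp
lemma sq2_nonneg [simp]: "sq2 Y \<ge> 0" unfolding sq2_def by (intro sum_nonneg) simp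

lemma S_abs: "i \<in> V \<Longrightarrow> j \<in> V \<Longrightarrow> \<bar>S i j\<bar> \<le> 1"
  using S_values[of i j] S_diag[of i] by (cases "i = j") auto

lemma ad_sym: "ad i j = ad j i" by (auto simp: ad_def S_sym[of i j])
lemma ad_diag [simp]: "ad i i = 0" by (simp add: ad_def S_diag)
lemma ad_values: "i \<in> V \<Longrightarrow> j \<in> V \<Longrightarrow> ad i j = 0 \<or> ad i j = 1"
  using S_values[of i j] S_diag[of i] by (cases "i = j") (auto simp: ad_def)

lemma sum_square_le: "(\<Sum>i\<in>V. v i)^2 \<le> n * sq v"
  using Cauchy_Schwarz_ineq_sum[of v "\<lambda>_. 1" V] by (simp add: sq_def mult.commute)

lemma square_sum: "(\<Sum>i\<in>A. f i)^2 = (\<Sum>i\<in>A. \<Sum>j\<in>A. f i * f j)" for f :: "'a \<Rightarrow> real"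
  by (simp add: power2_eq_square sum_product)

lemma sq_S_le: "sq (\<lambda>i. \<Sum>j\<in>V. S i j * v j) \<le> n * sq v"
proof -
  have "sq (\<lambda>i. \<Sum>j\<in>V. S i j * v j) = (\<Sum>i\<in>V. \<Sum>j\<in>V. \<Sum>k\<in>V. v j * v k * (S j i * S k i))"
    unfolding sq_def power2_eq_square sum_product
    by (intro sum.cong refl) (simp add: S_sym[of _ "_ :: 'v"] S_sym ac_simps)
  also have "\<dots> = (\<Sum>j\<in>V. \<Sum>k\<in>V. v j * v k * (\<Sum>i\<in>V. S j i * S k i))"
    unfolding sum_distrib_left by (subst sum.swap) (intro sum.cong refl sum.swap)
  also have "\<dots> = (\<Sum>j\<in>V. \<Sum>k\<in>V. (if j = k then n * v j ^ 2 else 0) - v j * v k)"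
    by (intro sum.cong refl) (auto simp: S_orth algebra_simps power2_eq_square)
  also have "\<dots> = n * sq v - (\<Sum>j\<in>V. v j)^2"
    by (simp add: sum_subtractf sq_def sum_distrib_left square_sum finite_V)
  finally show ?thesis by simp
qed

lemma Cauchy_Schwarz_sqrt:
  fixes f g :: "'a \<Rightarrow> real"
  shows "\<bar>\<Sum>i\<in>A. f i * g i\<bar> \<le> sqrt (\<Sum>i\<in>A. f i ^ 2) * sqrt (\<Sum>i\<in>A. g i ^ 2)"
proof -
  have "sqrt ((\<Sum>i\<in>A. f i * g i)^2) \<le> sqrt ((\<Sum>i\<in>A. f i ^ 2) * (\<Sum>i\<in>A. g i ^ 2))"
    by (intro real_sqrt_le_mono Cauchy_Schwarz_ineq_sum)
  then show ?thesis by (simp add: real_sqrt_mult)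
qed

lemma Cauchy_Schwarz_sq2: "\<bar>\<Sum>i\<in>V. \<Sum>j\<in>V. Y i j * Z i j\<bar> \<le> sqrt (sq2 Y) * sqrt (sq2 Z)"
proof -
  have "sqrt ((\<Sum>i\<in>V. \<Sum>j\<in>V. Y i j * Z i j)^2) \<le> sqrt (sq2 Y * sq2 Z)"
    unfolding sq2_def by (intro real_sqrt_le_mono Cauchy_Schwarz_sum2)
  then show ?thesis by (simp add: real_sqrt_mult)
qed

lemma SB_le: "\<bar>SB u v\<bar> \<le> sqrt n * sqrt (sq u) * sqrt (sq v)"
proof -
  have "SB u v = (\<Sum>i\<in>V. u i * (\<Sum>j\<in>V. S i j * v j))"
    unfolding SB_def by (simp add: sum_distrib_left mult.assoc)
  then have "\<bar>SB u v\<bar> \<le> sqrt (sq u) * sqrt (sq (\<lambda>i. \<Sum>j\<in>V. S i j * v j))"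
    unfolding sq_def by (simp add: Cauchy_Schwarz_sqrt)
  also have "\<dots> \<le> sqrt (sq u) * sqrt (n * sq v)"
    by (intro mult_left_mono real_sqrt_le_mono sq_S_le) simp
  finally show ?thesis by (simp add: real_sqrt_mult ac_simps)
qed

text \<open>The vectors \<open>(S i k S i l)\<close> indexed by \<open>(k, l)\<close> have as Gram
  matrix the entrywise square of \<open>n I - J\<close>: diagonal \<open>(n - 1)^2\<close>, all
  other entries 1. So the wedge map has norm about \<open>n\<close>.\<close>

lemma wedge_le: "\<bar>\<Sum>i\<in>V. u i * wd Y i\<bar> \<le> n * sqrt (sq u) * sqrt (sq2 Y)"
proof -
  let ?Z = "\<lambda>k l. \<Sum>i\<in>V. u i * (S i k * S i l)"
  have "(\<Sum>i\<in>V. u i * wd Y i) = (\<Sum>i\<in>V. \<Sum>k\<in>V. \<Sum>l\<in>V. Y k l * (u i * (S i k * S i l)))"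
    unfolding wd_def sum_distrib_left by (intro sum.cong refl) (simp add: ac_simps)
  also have "\<dots> = (\<Sum>k\<in>V. \<Sum>l\<in>V. Y k l * ?Z k l)"
    unfolding sum_distrib_left by (subst sum.swap) (intro sum.cong refl sum.swap)
  finally have 1: "\<bar>\<Sum>i\<in>V. u i * wd Y i\<bar> \<le> sqrt (sq2 Y) * sqrt (sq2 ?Z)"
    by (simp add: Cauchy_Schwarz_sq2)
  have "sq2 ?Z = (\<Sum>k\<in>V. \<Sum>l\<in>V. \<Sum>i\<in>V. \<Sum>j\<in>V. u i * u j * ((S i k * S j k) * (S i l * S j l)))"
    unfolding sq2_def power2_eq_square sum_product by (intro sum.cong refl) (simp add: ac_simps)
  also have "\<dots> = (\<Sum>i\<in>V. \<Sum>j\<in>V. \<Sum>k\<in>V. \<Sum>l\<in>V. u i * u j * ((S i k * S j k) * (S i l * S j l)))"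
    by (rule sum_swap_pairs)
  also have "\<dots> = (\<Sum>i\<in>V. \<Sum>j\<in>V. u i * u j * ((\<Sum>k\<in>V. S i k * S j k) * (\<Sum>k\<in>V. S i k * S j k)))"
    unfolding sum_product by (simp only: sum_distrib_left)
  also have "\<dots> = (\<Sum>i\<in>V. \<Sum>j\<in>V. (if i = j then ((n - 1)^2 - 1) * u i ^ 2 else 0) + u i * u j)"
    by (intro sum.cong refl) (auto simp: S_orth algebra_simps power2_eq_square)
  also have "\<dots> = ((n - 1)^2 - 1) * sq u + (\<Sum>i\<in>V. u i)^2"
    by (simp add: sum.distrib sq_def sum_distrib_left square_sum finite_V)
  also have "\<dots> \<le> ((n - 1)^2 - 1) * sq u + n * sq u" by (intro add_left_mono sum_square_le)
  also have "\<dots> = (n^2 - n) * sq u" by (simp add: power2_eq_square algebra_simps)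
  also have "\<dots> \<le> n^2 * sq u" by (intro mult_right_mono) auto
  finally have "sqrt (sq2 ?Z) \<le> sqrt (n^2 * sq u)" by (rule real_sqrt_le_mono)
  also have "\<dots> = n * sqrt (sq u)" by (simp add: real_sqrt_mult)
  finally have "sqrt (sq2 Y) * sqrt (sq2 ?Z) \<le> sqrt (sq2 Y) * (n * sqrt (sq u))" by (rule mult_left_mono) simp
  with 1 show ?thesis by (simp add: ac_simps)
qed

section \<open>Sign patterns between two pairs\<close>

definition T4 :: "('v \<Rightarrow> 'v \<Rightarrow> real) \<Rightarrow> ('v \<Rightarrow> 'v \<Rightarrow> 'v \<Rightarrow> 'v \<Rightarrow> real) \<Rightarrow> real" where
  "T4 Y f = (\<Sum>(i, j, k, l)\<in>VVVV. Y i j * Y k l * f i j k l)"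

lemma T4_add: "T4 Y (\<lambda>i j k l. f i j k l + g i j k l) = T4 Y f + T4 Y g"
  unfolding T4_def by (simp add: case_prod_unfold distrib_left sum.distrib)

lemma T4_swap12:
  assumes "\<And>i j. Y i j = Y j i"
  shows "T4 Y (\<lambda>i j k l. f j i k l) = T4 Y f"
  unfolding T4_def
  by (rule sum.reindex_bij_witness[where i = "\<lambda>(i, j, k, l). (j, i, k, l)" and j = "\<lambda>(i, j, k, l). (j, i, k, l)"])
     (auto simp: assms)

lemma T4_swap34:
  assumes "\<And>i j. Y i j = Y j i"
  shows "T4 Y (\<lambda>i j k l. f i j l k) = T4 Y f"
  unfolding T4_def
  by (rule sum.reindex_bij_witness[where i = "\<lambda>(i, j, k, l). (i, j, l, k)" and j = "\<lambda>(i, j, k, l). (i, j, l, k)"])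
     (auto simp: assms)

lemma T4_swap_pairs: "T4 Y (\<lambda>i j k l. f k l i j) = T4 Y f"
  unfolding T4_def
  by (rule sum.reindex_bij_witness[where i = "\<lambda>(i, j, k, l). (k, l, i, j)" and j = "\<lambda>(i, j, k, l). (k, l, i, j)"]) auto

lemma T4_const: "T4 Y (\<lambda>i j k l. 1) = (\<Sum>i\<in>V. dg Y i)^2"
  unfolding T4_def dg_def by (simp add: sum_square_tuple4)

lemma T4_edge: "T4 Y (\<lambda>i j k l. S i k) = SB (dg Y) (dg Y)"
proof -
  have "SB (dg Y) (dg Y) = (\<Sum>i\<in>V. \<Sum>k\<in>V. \<Sum>j\<in>V. \<Sum>l\<in>V. Y i j * Y k l * S i k)"
    unfolding SB_def dg_def by (simp add: sum_distrib_left sum_distrib_right ac_simps)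
  also have "\<dots> = (\<Sum>i\<in>V. \<Sum>j\<in>V. \<Sum>k\<in>V. \<Sum>l\<in>V. Y i j * Y k l * S i k)"
    by (intro sum.cong refl sum.swap)
  finally show ?thesis unfolding T4_def sum_tuple4 ..
qed

lemma T4_wedge: "T4 Y (\<lambda>i j k l. S i k * S i l) = (\<Sum>i\<in>V. dg Y i * wd Y i)"
  unfolding T4_def sum_tuple4 dg_def wd_def sum_product
  by (simp add: sum_distrib_left ac_simps)

lemma sq2_mult_S_le: "sq2 (\<lambda>i k. \<Sum>j\<in>V. Y i j * S j k) \<le> n * sq2 Y"
proof -
  have "sq2 (\<lambda>i k. \<Sum>j\<in>V. Y i j * S j k) = (\<Sum>i\<in>V. sq (\<lambda>k. \<Sum>j\<in>V. S k j * Y i j))"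
    unfolding sq2_def sq_def by (simp add: S_sym[of _ "_::'v"] mult.commute S_sym)
  also have "\<dots> \<le> (\<Sum>i\<in>V. n * sq (Y i))" by (intro sum_mono sq_S_le)
  also have "\<dots> = n * sq2 Y" by (simp add: sq2_def sq_def sum_distrib_left)
  finally show ?thesis .
qed

lemma sq2_transpose: "sq2 (\<lambda>i j. Y j i) = sq2 Y"
  unfolding sq2_def by (rule sum.swap)

text \<open>The form is the trace of \<open>(Y S)^2\<close>, and multiplication by \<open>S\<close>
  raises the squared Frobenius norm by at most a factor \<open>n\<close>.\<close>

lemma T4_matching_le:
  assumes "\<And>i j. Y i j = Y j i"
  shows "\<bar>T4 Y (\<lambda>i j k l. S i k * S j l)\<bar> \<le> n * sq2 Y"
proof -
  let ?Z = "\<lambda>i k. \<Sum>j\<in>V. Y i j * S j k"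
  have "T4 Y (\<lambda>i j k l. S i k * S j l) = (\<Sum>i\<in>V. \<Sum>j\<in>V. \<Sum>k\<in>V. \<Sum>l\<in>V. (Y i j * S j l) * (Y l k * S k i))"
    unfolding T4_def sum_tuple4 by (intro sum.cong refl) (simp add: assms[of _ "_::'v"] S_sym assms ac_simps)
  also have "\<dots> = (\<Sum>i\<in>V. \<Sum>l\<in>V. \<Sum>j\<in>V. \<Sum>k\<in>V. (Y i j * S j l) * (Y l k * S k i))"
  proof (rule sum.cong[OF refl])
    fix i
    have "(\<Sum>j\<in>V. \<Sum>k\<in>V. \<Sum>l\<in>V. (Y i j * S j l) * (Y l k * S k i)) = (\<Sum>j\<in>V. \<Sum>l\<in>V. \<Sum>k\<in>V. (Y i j * S j l) * (Y l k * S k i))"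
      by (intro sum.cong refl sum.swap)
    also have "\<dots> = (\<Sum>l\<in>V. \<Sum>j\<in>V. \<Sum>k\<in>V. (Y i j * S j l) * (Y l k * S k i))" by (rule sum.swap)
    finally show "(\<Sum>j\<in>V. \<Sum>k\<in>V. \<Sum>l\<in>V. (Y i j * S j l) * (Y l k * S k i)) = (\<Sum>l\<in>V. \<Sum>j\<in>V. \<Sum>k\<in>V. (Y i j * S j l) * (Y l k * S k i))" .
  qed
  also have "\<dots> = (\<Sum>i\<in>V. \<Sum>l\<in>V. ?Z i l * ?Z l i)" unfolding sum_product ..
  finally have "\<bar>T4 Y (\<lambda>i j k l. S i k * S j l)\<bar> \<le> sqrt (sq2 ?Z) * sqrt (sq2 (\<lambda>i l. ?Z l i))"
    using Cauchy_Schwarz_sq2[of ?Z "\<lambda>i l. ?Z l i"] by simp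
  also have "\<dots> = sq2 ?Z" unfolding sq2_transpose[of ?Z] by simp
  also have "\<dots> \<le> n * sq2 Y" by (rule sq2_mult_S_le)
  finally show ?thesis .
qed

text \<open>As for the matching, except that one factor is multiplied entrywise by \<open>S\<close>,
  whose entries are at most 1 in absolute value.\<close>

lemma T4_path_le:
  assumes "\<And>i j. Y i j = Y j i"
  shows "\<bar>T4 Y (\<lambda>i j k l. S i k * S i l * S j k)\<bar> \<le> n * sq2 Y"
proof -
  let ?Z = "\<lambda>i k. \<Sum>j\<in>V. Y i j * S j k"
  have "T4 Y (\<lambda>i j k l. S i k * S i l * S j k) = (\<Sum>i\<in>V. \<Sum>j\<in>V. \<Sum>k\<in>V. \<Sum>l\<in>V. S i k * ((Y i j * S j k) * (Y k l * S l i)))"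
    unfolding T4_def sum_tuple4 by (intro sum.cong refl) (simp add: S_sym ac_simps)
  also have "\<dots> = (\<Sum>i\<in>V. \<Sum>k\<in>V. \<Sum>j\<in>V. \<Sum>l\<in>V. S i k * ((Y i j * S j k) * (Y k l * S l i)))"
    by (intro sum.cong refl sum.swap)
  also have "\<dots> = (\<Sum>i\<in>V. \<Sum>k\<in>V. (S i k * ?Z i k) * ?Z k i)"
    unfolding mult.assoc[of "S _ _"] sum_product by (simp only: sum_distrib_left)
  finally have "\<bar>T4 Y (\<lambda>i j k l. S i k * S i l * S j k)\<bar> \<le> sqrt (sq2 (\<lambda>i k. S i k * ?Z i k)) * sqrt (sq2 (\<lambda>i l. ?Z l i))"
    using Cauchy_Schwarz_sq2[of "\<lambda>i k. S i k * ?Z i k" "\<lambda>i l. ?Z l i"] by simp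
  also have "\<dots> \<le> sqrt (sq2 ?Z) * sqrt (sq2 ?Z)"
    unfolding sq2_transpose[of ?Z]
  proof (intro mult_right_mono real_sqrt_le_mono)
    show "sq2 (\<lambda>i k. S i k * ?Z i k) \<le> sq2 ?Z"
      unfolding sq2_def
    proof (intro sum_mono)
      fix i k assume "i \<in> V" "k \<in> V"
      have "(S i k)^2 \<le> 1" using S_abs[OF \<open>i \<in> V\<close> \<open>k \<in> V\<close>] by (simp add: abs_square_le_1)
      then have "S i k ^ 2 * ?Z i k ^ 2 \<le> 1 * ?Z i k ^ 2" by (rule mult_right_mono) simp
      then show "(S i k * ?Z i k)^2 \<le> ?Z i k ^ 2" by (simp add: power_mult_distrib)
    qed
  qed simp
  also have "\<dots> = sq2 ?Z" by simp
  also have "\<dots> \<le> n * sq2 Y" by (rule sq2_mult_S_le)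
  finally show ?thesis .
qed

lemma T4_coincidence_le:
  assumes "\<And>i j. Y i j = Y j i"
  shows "T4 (\<lambda>i j. \<bar>Y i j\<bar>) (\<lambda>i j k l. of_bool (i = k)) \<le> n * sq2 Y"
proof -
  have "T4 (\<lambda>i j. \<bar>Y i j\<bar>) (\<lambda>i j k l. of_bool (i = k)) =
      (\<Sum>i\<in>V. \<Sum>k\<in>V. \<Sum>j\<in>V. \<Sum>l\<in>V. \<bar>Y i j\<bar> * \<bar>Y k l\<bar> * of_bool (i = k))"
    unfolding T4_def sum_tuple4 by (intro sum.cong refl sum.swap)
  also have "\<dots> = (\<Sum>i\<in>V. \<Sum>k\<in>V. if i = k then (\<Sum>j\<in>V. \<bar>Y i j\<bar>)^2 else 0)"
    unfolding power2_eq_square sum_product by (intro sum.cong refl) auto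
  also have "\<dots> = (\<Sum>i\<in>V. (\<Sum>j\<in>V. \<bar>Y i j\<bar>)^2)" using finite_V by simp
  also have "\<dots> \<le> (\<Sum>i\<in>V. n * sq (\<lambda>j. \<bar>Y i j\<bar>))" by (intro sum_mono sum_square_le)
  also have "\<dots> = n * sq2 Y" by (simp add: sq_def sq2_def sum_distrib_left)
  finally show ?thesis .
qed

definition K4 :: "('v \<Rightarrow> 'v \<Rightarrow> real) \<Rightarrow> real" where
  "K4 Y = T4 Y (\<lambda>i j k l. ad i k * ad i l * ad j k * ad j l)"

text \<open>Four factors \<open>(1 + S) / 2\<close> expand into 16 sign patterns on the four-cycle:
  the empty one, 4 edges, 4 wedges, 2 matchings, 4 paths of three edges and the cycle. The first
  three kinds are kept. The error constant is \<open>70 = 16 * 4 + 2 + 4\<close> for coincidences,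
  matchings and paths, and \<open>K\<close> for the cycle.\<close>

lemma K4_expansion:
  assumes sym: "\<And>i j. Y i j = Y j i" and diag: "\<And>i. Y i i = 0" and n1: "n \<ge> 1"
  shows "\<bar>16 * K4 Y - ((\<Sum>i\<in>V. dg Y i)^2 + 4 * SB (dg Y) (dg Y) + 4 * (\<Sum>i\<in>V. dg Y i * wd Y i))\<bar>
    \<le> (70 + K) * R * sq2 Y"
proof -
  define b where "b = (\<lambda>i j. (1 + S i j) / 2)"
  have bsym: "b i j = b j i" for i j by (simp add: b_def S_sym)
  have b01: "0 \<le> b i j" "b i j \<le> 1" if "i \<in> V" "j \<in> V" for i j
    using S_abs[OF that] by (auto simp: b_def)
  \<comment> \<open>\<open>ad\<close> and \<open>b\<close> differ only on the diagonal, so the two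
    products agree unless one of the four cross pairs coincides.\<close>
  have co: "\<bar>T4 Y (\<lambda>i j k l. ad i k * ad i l * ad j k * ad j l) - T4 Y (\<lambda>i j k l. b i k * b i l * b j k * b j l)\<bar> \<le> 4 * (n * sq2 Y)"
  proof -
    let ?A = "\<lambda>i j. \<bar>Y i j\<bar>"
    let ?c = "\<lambda>i j k l. of_bool (i = k) + of_bool (i = l) + of_bool (j = k) + of_bool (j = l) :: real"
    have pt: "\<bar>ad i k * ad i l * ad j k * ad j l - b i k * b i l * b j k * b j l\<bar> \<le> ?c i j k l"
      if "i \<in> V" "j \<in> V" "k \<in> V" "l \<in> V" for i j k l
    proof (cases "i = k \<or> i = l \<or> j = k \<or> j = l")
      case True
      then have "ad i k * ad i l * ad j k * ad j l = 0" by auto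
      moreover have "b i k * b i l * b j k * b j l \<le> 1 * 1 * 1 * 1"
        using that by (intro mult_mono mult_nonneg_nonneg b01) auto
      moreover have "0 \<le> b i k * b i l * b j k * b j l" using that by (intro mult_nonneg_nonneg b01)
      moreover have "1 \<le> ?c i j k l" using True by auto
      ultimately show ?thesis by linarith
    next
      case False
      then show ?thesis by (simp add: ad_def b_def)
    qed
    have "\<bar>T4 Y (\<lambda>i j k l. ad i k * ad i l * ad j k * ad j l) - T4 Y (\<lambda>i j k l. b i k * b i l * b j k * b j l)\<bar>
      = \<bar>\<Sum>(i, j, k, l)\<in>VVVV. Y i j * Y k l * (ad i k * ad i l * ad j k * ad j l - b i k * b i l * b j k * b j l)\<bar>"
      unfolding T4_def by (simp add: case_prod_unfold sum_subtractf right_diff_distrib)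
    also have "\<dots> \<le> (\<Sum>(i, j, k, l)\<in>VVVV. ?A i j * ?A k l * ?c i j k l)"
    proof (rule order_trans[OF sum_abs], rule sum_mono)
      fix x assume "x \<in> VVVV"
      then obtain i j k l where x: "x = (i, j, k, l)" and V: "i \<in> V" "j \<in> V" "k \<in> V" "l \<in> V" by blast
      show "\<bar>case x of (i, j, k, l) \<Rightarrow> Y i j * Y k l * (ad i k * ad i l * ad j k * ad j l - b i k * b i l * b j k * b j l)\<bar>
         \<le> (case x of (i, j, k, l) \<Rightarrow> ?A i j * ?A k l * ?c i j k l)"
        unfolding x prod.case abs_mult[of "Y i j * Y k l"] abs_mult[of "Y i j"]
        by (rule mult_left_mono[OF pt[OF V]]) simp
    qed
    also have "\<dots> = T4 ?A ?c" unfolding T4_def ..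
    also have "\<dots> = T4 ?A (\<lambda>i j k l. of_bool (i = k)) + T4 ?A (\<lambda>i j k l. of_bool (i = l))
       + T4 ?A (\<lambda>i j k l. of_bool (j = k)) + T4 ?A (\<lambda>i j k l. of_bool (j = l))" by (simp only: T4_add)
    also have "\<dots> = 4 * T4 ?A (\<lambda>i j k l. of_bool (i = k))"
      using T4_swap34[of ?A "\<lambda>i j k l. of_bool (i = k)"] T4_swap12[of ?A "\<lambda>i j k l. of_bool (i = k)"]
        T4_swap12[of ?A "\<lambda>i j k l. of_bool (i = l)"] sym by simp
    also have "\<dots> \<le> 4 * (n * sq2 Y)" using T4_coincidence_le[of Y] sym by simp
    finally show ?thesis .
  qed
  have expand: "16 * (b i k * b i l * b j k * b j l) =
      1 + (S i k + S i l + S j k + S j l) + (S i k * S i l + S j k * S j l + S k i * S k j + S l i * S l j)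
      + (S i k * S j l + S i l * S j k)
      + (S i k * S i l * S j k + S j k * S j l * S i k + S i l * S i k * S j l + S j l * S j k * S i l)
      + S i k * S i l * S j k * S j l" for i j k l
    unfolding b_def S_sym[of k i] S_sym[of k j] S_sym[of l i] S_sym[of l j] by (simp add: field_simps)
  have "16 * T4 Y (\<lambda>i j k l. b i k * b i l * b j k * b j l) = T4 Y (\<lambda>i j k l. 16 * (b i k * b i l * b j k * b j l))"
    unfolding T4_def sum_distrib_left by (intro sum.cong refl) (auto simp: ac_simps)
  also have "\<dots> = T4 Y (\<lambda>i j k l. 1) + 4 * T4 Y (\<lambda>i j k l. S i k) + 4 * T4 Y (\<lambda>i j k l. S i k * S i l)
     + 2 * T4 Y (\<lambda>i j k l. S i k * S j l) + 4 * T4 Y (\<lambda>i j k l. S i k * S i l * S j k)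
     + T4 Y (\<lambda>i j k l. S i k * S i l * S j k * S j l)"
  proof -
    have "T4 Y (\<lambda>i j k l. S i l) = T4 Y (\<lambda>i j k l. S i k)" "T4 Y (\<lambda>i j k l. S j k) = T4 Y (\<lambda>i j k l. S i k)"
      "T4 Y (\<lambda>i j k l. S j l) = T4 Y (\<lambda>i j k l. S i l)"
      "T4 Y (\<lambda>i j k l. S j k * S j l) = T4 Y (\<lambda>i j k l. S i k * S i l)"
      "T4 Y (\<lambda>i j k l. S k i * S k j) = T4 Y (\<lambda>i j k l. S i k * S i l)"
      "T4 Y (\<lambda>i j k l. S l i * S l j) = T4 Y (\<lambda>i j k l. S k i * S k j)"
      "T4 Y (\<lambda>i j k l. S i l * S j k) = T4 Y (\<lambda>i j k l. S i k * S j l)"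
      "T4 Y (\<lambda>i j k l. S j k * S j l * S i k) = T4 Y (\<lambda>i j k l. S i k * S i l * S j k)"
      "T4 Y (\<lambda>i j k l. S i l * S i k * S j l) = T4 Y (\<lambda>i j k l. S i k * S i l * S j k)"
      "T4 Y (\<lambda>i j k l. S j l * S j k * S i l) = T4 Y (\<lambda>i j k l. S i l * S i k * S j l)"
      by (rule T4_swap34[OF sym] T4_swap12[OF sym] T4_swap_pairs)+
    then show ?thesis unfolding expand T4_add by simp
  qed
  finally have e: "16 * T4 Y (\<lambda>i j k l. b i k * b i l * b j k * b j l) = \<dots>" .
  have "n \<le> R" using powr_mono[of 1 "5/4" n] n1 by simp
  then have nR: "n * sq2 Y \<le> R * sq2 Y" by (rule mult_right_mono) simp
  have fc: "\<bar>T4 Y (\<lambda>i j k l. S i k * S i l * S j k * S j l)\<bar> \<le> K * R * sq2 Y"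
    unfolding T4_def sq2_def by (rule four_cycle) (rule diag)
  have "(70 + K) * R * sq2 Y = 70 * (R * sq2 Y) + K * R * sq2 Y" by (simp add: algebra_simps)
  moreover have "\<bar>16 * K4 Y - ((\<Sum>i\<in>V. dg Y i)^2 + 4 * SB (dg Y) (dg Y) + 4 * (\<Sum>i\<in>V. dg Y i * wd Y i))\<bar>
    \<le> 16 * (4 * (n * sq2 Y)) + 2 * (n * sq2 Y) + 4 * (n * sq2 Y) + K * R * sq2 Y"
    using co e fc T4_matching_le[of Y] T4_path_le[of Y] sym
    unfolding K4_def T4_const T4_edge T4_wedge by (simp add: abs_le_iff)
  ultimately show ?thesis using nR by linarith
qed

end

section \<open>Pseudomoments as a quadratic form\<close>

definition fk_mu :: "'v set \<Rightarrow> ('v \<Rightarrow> 'v \<Rightarrow> bool) \<Rightarrow> real \<times> real \<times> real \<times> real \<Rightarrow> 'v set \<Rightarrow> real" where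
  "fk_mu V adj a C = (if clique V adj C then fk_coeff a (card C) else 0)"

lemma fk_moment_mu: "fk_moment V adj a m = fk_mu V adj a (Poly_Mapping.keys m)"
  by (simp add: fk_moment_def fk_mu_def)

lemma const_poly_mult_in_polys: "f \<in> polys V d \<Longrightarrow> const_poly c * f \<in> polys V d"
  by (rule polys_mult[of _ V 0 _ d]) (auto simp: const_poly_def polys_def mdeg_def)

lemma const_poly_mult: "const_poly c * const_poly d = const_poly (c * d)"
  by (simp add: const_poly_def mult_single)

lemma fk_functional_scale: "f \<in> polys V 4 \<Longrightarrow> fk_functional V adj a (const_poly c * f) = c * fk_functional V adj a f"
  using fk_functional_linear[of V 4 adj a] by (auto simp: linear_on_polys_def)

lemma fk_functional_product:
  assumes "finite I" "finite J"
    and "\<And>x. x \<in> I \<Longrightarrow> Poly_Mapping.keys (m x) \<subseteq> V \<and> mdeg (m x) \<le> 2"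
    and "\<And>x. x \<in> J \<Longrightarrow> Poly_Mapping.keys (l x) \<subseteq> V \<and> mdeg (l x) \<le> 2"
  shows "fk_functional V adj a ((\<Sum>x\<in>I. const_poly (c x) * monomial (m x)) * (\<Sum>y\<in>J. const_poly (d y) * monomial (l y))) =
     (\<Sum>x\<in>I. \<Sum>y\<in>J. c x * d y * fk_mu V adj a (Poly_Mapping.keys (m x) \<union> Poly_Mapping.keys (l y)))"
proof -
  let ?t = "\<lambda>(x, y). const_poly (c x * d y) * monomial (m x + l y)"
  have mono: "monomial (m x + l y) \<in> polys V 4" if "x \<in> I" "y \<in> J" for x y
    using assms(3)[OF that(1)] assms(4)[OF that(2)] by (intro polys_monomial) (auto simp: keys_add_nat mdeg_add)
  have "(\<Sum>x\<in>I. const_poly (c x) * monomial (m x)) * (\<Sum>y\<in>J. const_poly (d y) * monomial (l y)) =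
      (\<Sum>x\<in>I. \<Sum>y\<in>J. const_poly (c x * d y) * monomial (m x + l y))"
    unfolding sum_product by (simp add: const_poly_mult[symmetric] monomial_mult[symmetric] ac_simps)
  also have "\<dots> = (\<Sum>z\<in>I \<times> J. ?t z)" by (simp add: sum.cartesian_product)
  finally have "fk_functional V adj a ((\<Sum>x\<in>I. const_poly (c x) * monomial (m x)) * (\<Sum>y\<in>J. const_poly (d y) * monomial (l y)))
     = fk_functional V adj a (\<Sum>z\<in>I \<times> J. ?t z)" by simp
  also have "\<dots> = (\<Sum>z\<in>I \<times> J. fk_functional V adj a (?t z))"
    using assms(1,2) mono
    by (intro conjunct2[OF linear_on_polys_sum[OF fk_functional_linear[of V 4]]]) (auto intro!: const_poly_mult_in_polys)
  also have "\<dots> = (\<Sum>(x, y)\<in>I \<times> J. c x * d y * fk_mu V adj a (Poly_Mapping.keys (m x) \<union> Poly_Mapping.keys (l y)))"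
    using mono by (intro sum.cong refl) (auto simp: fk_functional_scale fk_functional_monomial fk_moment_mu keys_add_nat)
  also have "\<dots> = (\<Sum>x\<in>I. \<Sum>y\<in>J. c x * d y * fk_mu V adj a (Poly_Mapping.keys (m x) \<union> Poly_Mapping.keys (l y)))"
    by (simp add: sum.cartesian_product)
  finally show ?thesis .
qed

lemma const_poly_1: "const_poly 1 = 1"
  by (simp add: const_poly_def)

lemma fk_functional_monomial_mult:
  assumes "q \<in> polys V 2" "Poly_Mapping.keys m \<subseteq> V" "mdeg m \<le> 2"
  shows "fk_functional V adj a (monomial m * q) =
    (\<Sum>l\<in>Poly_Mapping.keys q. Poly_Mapping.lookup q l * fk_mu V adj a (Poly_Mapping.keys m \<union> Poly_Mapping.keys l))"
  using fk_functional_product[of "{()}" "Poly_Mapping.keys q" "\<lambda>_. m" V "\<lambda>l. l" adj a "\<lambda>_. 1" "Poly_Mapping.lookup q"]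
    rpoly_expand[of q] assms by (simp add: const_poly_1 polys_def)

lemma fk_functional_diff:
  assumes "f \<in> polys V 4" "g \<in> polys V 4"
  shows "fk_functional V adj a (f - g) = fk_functional V adj a f - fk_functional V adj a g"
proof -
  have "fk_functional V adj a ((f - g) + g) = fk_functional V adj a (f - g) + fk_functional V adj a g"
    using fk_functional_linear[of V 4 adj a] assms polys_diff[OF assms] unfolding linear_on_polys_def by blast
  then show ?thesis by simp
qed

lemma xvar_mult: "xvar i * xvar j = monomial (Poly_Mapping.single i 1 + Poly_Mapping.single j 1)"
  by (simp add: xvar_def monomial_mult)

lemma fk_functional_xvar: "i \<in> V \<Longrightarrow> fk_functional V adj (a1, a2, a3, a4) (xvar i) = a1"
  by (simp add: xvar_def fk_functional_monomial fk_moment_def clique_def fk_coeff_def)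

text \<open>The moments depend only on the variable set of a monomial and vanish unless it is a
  clique. This yields the linear constraints, so positivity is what remains to be checked.\<close>

lemma pseudoexpectation4_fk_functionalI:
  assumes pos: "\<And>q. q \<in> polys V 2 \<Longrightarrow> fk_functional V adj a (q^2) \<ge> 0"
  shows "pseudoexpectation4 V adj (fk_functional V adj a)"
proof -
  have "fk_functional V adj a 1 = 1"
  proof -
    have "fk_functional V adj a (monomial 0) = 1"
      unfolding fk_functional_monomial by (simp add: fk_moment_def clique_def fk_coeff_def case_prod_unfold)
    then show ?thesis by (simp add: monomial_def)
  qed
  moreover have "fk_functional V adj a (((xvar i)^2 - xvar i) * q) = 0" if i: "i \<in> V" and q: "q \<in> polys V 2" for i q
  proof -
    let ?m1 = "Poly_Mapping.single i (1::nat)" and ?m2 = "Poly_Mapping.single i (1::nat) + Poly_Mapping.single i 1"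
    have m: "Poly_Mapping.keys ?m1 = {i}" "Poly_Mapping.keys ?m2 = {i}" "mdeg ?m1 = 1" "mdeg ?m2 = 2"
      by (simp_all only: keys_add_nat mdeg_add mdeg_single) simp_all
    have "((xvar i)^2 - xvar i) * q = monomial ?m2 * q - monomial ?m1 * q"
      unfolding power2_eq_square xvar_mult by (simp add: left_diff_distrib xvar_def)
    moreover have "monomial ?m2 \<in> polys V 2" "monomial ?m1 \<in> polys V 2"
      using m i by (auto intro!: polys_monomial)
    then have "monomial ?m2 * q \<in> polys V 4" "monomial ?m1 * q \<in> polys V 4"
      using q by (auto intro: polys_mult[of _ V 2 _ 2])
    moreover have "fk_functional V adj a (monomial ?m2 * q) = fk_functional V adj a (monomial ?m1 * q)"
      using m i q by (simp add: fk_functional_monomial_mult)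
    ultimately show ?thesis by (simp add: fk_functional_diff)
  qed
  moreover have "fk_functional V adj a (xvar i * xvar j * q) = 0"
    if ij: "i \<in> V" "j \<in> V" "i \<noteq> j" "\<not> adj i j" and q: "q \<in> polys V 2" for i j q
  proof -
    let ?m = "Poly_Mapping.single i (1::nat) + Poly_Mapping.single j 1"
    have m: "Poly_Mapping.keys ?m = {i, j}" "mdeg ?m = 2"
      by (simp_all only: keys_add_nat mdeg_add mdeg_single) auto
    have "fk_mu V adj a ({i, j} \<union> C) = 0" for C using ij by (auto simp: fk_mu_def clique_def)
    then show ?thesis unfolding xvar_mult using m ij q by (simp add: fk_functional_monomial_mult)
  qed
  ultimately show ?thesis
    unfolding pseudoexpectation4_def using pos by (simp add: fk_functional_linear)
qed

section \<open>From polynomials to functions on sets of at most two vertices\<close>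

definition small_sets :: "'v set \<Rightarrow> 'v set set" where
  "small_sets V = {A. A \<subseteq> V \<and> card A \<le> 2}"

lemma finite_small_sets: "finite V \<Longrightarrow> finite (small_sets V)"
  unfolding small_sets_def by (rule finite_subset[of _ "Pow V"]) auto

lemma card_keys_le_mdeg: "card (Poly_Mapping.keys m) \<le> mdeg m"
proof -
  have "card (Poly_Mapping.keys m) = (\<Sum>i\<in>Poly_Mapping.keys m. 1)" by simp
  also have "\<dots> \<le> mdeg m" unfolding mdeg_def by (intro sum_mono) (simp add: in_keys_iff)
  finally show ?thesis .
qed

text \<open>The moments see only variable sets, so coefficients of monomials with the same set are
  added up: \<open>Q\<close> is the multilinear reduction of \<open>q\<close>.\<close>

lemma fk_functional_square:
  assumes V: "finite V" and q: "q \<in> polys V 2"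
  shows "\<exists>Q. fk_functional V adj a (q^2) =
    (\<Sum>A\<in>small_sets V. \<Sum>B\<in>small_sets V. Q A * Q B * fk_mu V adj a (A \<union> B))"
proof -
  let ?k = "Poly_Mapping.keys q" and ?c = "Poly_Mapping.lookup q"
  define Q where "Q A = (\<Sum>m\<in>{m \<in> ?k. Poly_Mapping.keys m = A}. ?c m)" for A
  have sub: "Poly_Mapping.keys ` ?k \<subseteq> small_sets V"
  proof
    fix A assume "A \<in> Poly_Mapping.keys ` ?k"
    then obtain m where m: "m \<in> ?k" "A = Poly_Mapping.keys m" by blast
    have "Poly_Mapping.keys m \<subseteq> V" "mdeg m \<le> 2" using q m(1) by (simp_all add: polys_def)
    then show "A \<in> small_sets V" using card_keys_le_mdeg[of m] by (simp add: small_sets_def m(2))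
  qed
  have g: "(\<Sum>m\<in>?k. ?c m * F (Poly_Mapping.keys m)) = (\<Sum>A\<in>small_sets V. Q A * F A)" for F
  proof -
    have "(\<Sum>m\<in>?k. ?c m * F (Poly_Mapping.keys m)) =
        (\<Sum>A\<in>small_sets V. \<Sum>m\<in>{m \<in> ?k. Poly_Mapping.keys m = A}. ?c m * F (Poly_Mapping.keys m))"
      by (rule sum.group[symmetric]) (use sub finite_small_sets[OF V] in auto)
    also have "\<dots> = (\<Sum>A\<in>small_sets V. Q A * F A)"
      unfolding Q_def sum_distrib_right by (intro sum.cong refl) auto
    finally show ?thesis .
  qed
  have "fk_functional V adj a (q^2) = (\<Sum>x\<in>?k. \<Sum>y\<in>?k. ?c x * ?c y * fk_mu V adj a (Poly_Mapping.keys x \<union> Poly_Mapping.keys y))"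
    unfolding power2_eq_square
    using fk_functional_product[of ?k ?k "\<lambda>m. m" V "\<lambda>m. m" adj a ?c ?c] rpoly_expand[of q] q by (simp add: polys_def)
  also have "\<dots> = (\<Sum>x\<in>?k. ?c x * (\<Sum>y\<in>?k. ?c y * fk_mu V adj a (Poly_Mapping.keys x \<union> Poly_Mapping.keys y)))"
    by (simp add: sum_distrib_left mult.assoc)
  also have "\<dots> = (\<Sum>x\<in>?k. ?c x * (\<Sum>B\<in>small_sets V. Q B * fk_mu V adj a (Poly_Mapping.keys x \<union> B)))"
  proof (rule sum.cong[OF refl])
    fix x
    show "?c x * (\<Sum>y\<in>?k. ?c y * fk_mu V adj a (Poly_Mapping.keys x \<union> Poly_Mapping.keys y)) =
        ?c x * (\<Sum>B\<in>small_sets V. Q B * fk_mu V adj a (Poly_Mapping.keys x \<union> B))"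
      by (simp only: g[of "\<lambda>B. fk_mu V adj a (Poly_Mapping.keys x \<union> B)"])
  qed
  also have "\<dots> = (\<Sum>A\<in>small_sets V. Q A * (\<Sum>B\<in>small_sets V. Q B * fk_mu V adj a (A \<union> B)))"
    by (rule g[of "\<lambda>A. \<Sum>B\<in>small_sets V. Q B * fk_mu V adj a (A \<union> B)"])
  finally show ?thesis by (auto simp: sum_distrib_left mult.assoc)
qed

text \<open>Every \<open>Q\<close> is the coefficient function of a multilinear polynomial of degree
  at most 2, whose square is tested.\<close>

lemma pseudoexpectation4_fk_functionalD:
  assumes V: "finite V" and E: "pseudoexpectation4 V adj (fk_functional V adj a)"
  shows "0 \<le> (\<Sum>A\<in>small_sets V. \<Sum>B\<in>small_sets V. Q A * Q B * fk_mu V adj a (A \<union> B))"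
proof -
  have fin: "finite A" if "A \<in> small_sets V" for A
    using that V by (auto simp: small_sets_def intro: finite_subset)
  have m: "Poly_Mapping.keys (set_monom A) \<subseteq> V \<and> mdeg (set_monom A) \<le> 2" if "A \<in> small_sets V" for A
    using that fin[OF that] by (auto simp: set_monom small_sets_def)
  let ?q = "\<Sum>A\<in>small_sets V. const_poly (Q A) * monomial (set_monom A)"
  have "?q \<in> polys V 2"
    using m by (intro conjunct1[OF linear_on_polys_sum[OF fk_functional_linear]] finite_small_sets V const_poly_mult_in_polys polys_monomial) auto
  then have "0 \<le> fk_functional V adj a (?q^2)" using E by (simp add: pseudoexpectation4_def)
  also have "\<dots> = (\<Sum>A\<in>small_sets V. \<Sum>B\<in>small_sets V. Q A * Q B * fk_mu V adj a (Poly_Mapping.keys (set_monom A) \<union> Poly_Mapping.keys (set_monom B)))"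
    unfolding power2_eq_square using m by (intro fk_functional_product finite_small_sets V) auto
  also have "\<dots> = (\<Sum>A\<in>small_sets V. \<Sum>B\<in>small_sets V. Q A * Q B * fk_mu V adj a (A \<union> B))"
    by (intro sum.cong refl) (simp add: set_monom fin)
  finally show ?thesis .
qed

lemma sum_small_sets:
  fixes F :: "'v set \<Rightarrow> real"
  assumes V: "finite V"
  shows "(\<Sum>A\<in>small_sets V. F A) = F {} + (\<Sum>i\<in>V. F {i}) + (\<Sum>i\<in>V. \<Sum>j\<in>V. of_bool (i \<noteq> j) * F {i, j}) / 2"
proof -
  let ?P = "{A. A \<subseteq> V \<and> card A = 2}" and ?W = "{(i, j) \<in> V \<times> V. i \<noteq> j}"
  have finP: "finite ?P" by (rule finite_subset[of _ "Pow V"]) (use V in auto)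
  have "small_sets V = insert {} ((\<lambda>i. {i}) ` V \<union> ?P)"
  proof -
    have "A \<in> insert {} ((\<lambda>i. {i}) ` V \<union> ?P)" if A: "A \<subseteq> V" "card A \<le> 2" for A
    proof -
      have "finite A" using A(1) V by (rule finite_subset)
      then show ?thesis using A by (auto simp: le_Suc_eq numeral_2_eq_2 card_1_singleton_iff)
    qed
    moreover have "card A \<le> 2" if "A \<in> insert {} ((\<lambda>i. {i}) ` V \<union> ?P)" for A using that by auto
    ultimately show ?thesis by (auto simp: small_sets_def)
  qed
  moreover have "(\<lambda>i. {i}) ` V \<inter> ?P = {}" by auto
  moreover have "{} \<notin> (\<lambda>i. {i}) ` V \<union> ?P" by auto
  ultimately have "(\<Sum>A\<in>small_sets V. F A) = F {} + ((\<Sum>A\<in>(\<lambda>i. {i}) ` V. F A) + (\<Sum>A\<in>?P. F A))"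
    using V finP by (simp add: sum.union_disjoint)
  moreover have "(\<Sum>A\<in>(\<lambda>i. {i}) ` V. F A) = (\<Sum>i\<in>V. F {i})"
    by (subst sum.reindex) (auto simp: inj_on_def)
  moreover have "(\<Sum>i\<in>V. \<Sum>j\<in>V. of_bool (i \<noteq> j) * F {i, j}) = 2 * (\<Sum>A\<in>?P. F A)"
  proof -
    have "(\<Sum>i\<in>V. \<Sum>j\<in>V. of_bool (i \<noteq> j) * F {i, j}) = (\<Sum>(i, j)\<in>V \<times> V. of_bool (i \<noteq> j) * F {i, j})"
      by (simp add: sum.cartesian_product)
    also have "\<dots> = (\<Sum>(i, j)\<in>?W. F {i, j})"
      using V by (intro sum.mono_neutral_cong_right) auto
    also have "\<dots> = (\<Sum>A\<in>?P. \<Sum>(i, j)\<in>{w \<in> ?W. (\<lambda>(i, j). {i, j}) w = A}. F {i, j})"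
      by (rule sum.group[symmetric]) (use V finP in \<open>auto intro: finite_subset[of _ "V \<times> V"]\<close>)
    also have "\<dots> = (\<Sum>A\<in>?P. 2 * F A)"
    proof (rule sum.cong[OF refl])
      fix A assume A: "A \<in> ?P"
      then obtain x y where xy: "A = {x, y}" "x \<noteq> y" by (auto simp: card_2_iff)
      then have "{w \<in> ?W. (\<lambda>(i, j). {i, j}) w = A} = {(x, y), (y, x)}"
        using A by (auto simp: doubleton_eq_iff)
      then show "(\<Sum>(i, j)\<in>{w \<in> ?W. (\<lambda>(i, j). {i, j}) w = A}. F {i, j}) = 2 * F A"
        using xy by (simp add: insert_commute)
    qed
    finally show ?thesis by (simp add: sum_distrib_left)
  qed
  ultimately show ?thesis by simp
qed

section \<open>The moment form of a conference graph\<close>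

context conference
begin

text \<open>Moments of non-cliques vanish, so coefficients of non-edges never reach the form.
  Symmetry and the zero diagonal are demanded on the whole type so that they rewrite without
  membership in \<open>V\<close>.\<close>

definition edgefun :: "('v \<Rightarrow> 'v \<Rightarrow> real) \<Rightarrow> bool" where
  "edgefun Y \<longleftrightarrow> (\<forall>i j. Y i j = Y j i) \<and> (\<forall>i. Y i i = 0) \<and> (\<forall>i\<in>V. \<forall>j\<in>V. Y i j = 0 \<or> S i j = 1)"

lemma edgefunD:
  assumes "edgefun Y"
  shows "Y i j = Y j i" "Y i i = 0" "i \<in> V \<Longrightarrow> j \<in> V \<Longrightarrow> Y i j \<noteq> 0 \<Longrightarrow> S i j = 1"
    "i \<in> V \<Longrightarrow> j \<in> V \<Longrightarrow> Y i j * S i j = Y i j"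
  using assms unfolding edgefun_def by fastforce+

text \<open>The parts of the form by type of overlap: \<open>X1\<close> for two vertices,
  \<open>X2\<close> for a vertex on an edge, \<open>X3\<close> for a vertex off an edge,
  \<open>X4\<close> for two edges that share one vertex. \<open>K4\<close> covers disjoint
  edges.\<close>

definition X1 :: "('v \<Rightarrow> real) \<Rightarrow> real" where "X1 y = (\<Sum>i\<in>V. \<Sum>k\<in>V. y i * (ad i k * y k))"
definition X2 :: "('v \<Rightarrow> real) \<Rightarrow> ('v \<Rightarrow> 'v \<Rightarrow> real) \<Rightarrow> real" where "X2 y Y = (\<Sum>i\<in>V. y i * dg Y i)"
definition X3 :: "('v \<Rightarrow> real) \<Rightarrow> ('v \<Rightarrow> 'v \<Rightarrow> real) \<Rightarrow> real" where
  "X3 y Y = (\<Sum>i\<in>V. \<Sum>k\<in>V. \<Sum>l\<in>V. y i * (Y k l * (ad i k * ad i l)))"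
definition X4 :: "('v \<Rightarrow> 'v \<Rightarrow> real) \<Rightarrow> real" where
  "X4 Y = (\<Sum>i\<in>V. \<Sum>j\<in>V. \<Sum>l\<in>V. Y i j * (Y i l * ad j l))"

text \<open>\<open>Y\<close> lists every edge in both orders. This accounts for the factor 1/2 at
  sums over one edge and 1/4 at the pairs of disjoint edges; in \<open>X4\<close> the common vertex
  already fixes the order.\<close>

definition MQ :: "real \<times> real \<times> real \<times> real \<Rightarrow> real \<Rightarrow> ('v \<Rightarrow> real) \<Rightarrow> ('v \<Rightarrow> 'v \<Rightarrow> real) \<Rightarrow> real" where
  "MQ a y0 y Y = (case a of (a1, a2, a3, a4) \<Rightarrow>
     y0^2 + 2 * y0 * (a1 * (\<Sum>i\<in>V. y i) + a2 / 2 * (\<Sum>i\<in>V. dg Y i))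
     + a1 * sq y + a2 * X1 y + 2 * a2 * X2 y Y + a3 * X3 y Y
     + a2 / 2 * sq2 Y + a3 * X4 Y + a4 / 4 * K4 Y)"

abbreviation adj :: "'v \<Rightarrow> 'v \<Rightarrow> bool" where "adj \<equiv> \<lambda>i j. S i j = 1"
abbreviation mu :: "real \<times> real \<times> real \<times> real \<Rightarrow> 'v set \<Rightarrow> real" where "mu \<equiv> fk_mu V adj"

lemma ad_eq: "i \<in> V \<Longrightarrow> j \<in> V \<Longrightarrow> ad i j = of_bool (S i j = 1)"
  using S_values[of i j] S_diag[of i] by (cases "i = j") (auto simp: ad_def)

lemma mu_0: "mu a {} = 1"
  by (simp add: fk_mu_def clique_def fk_coeff_def case_prod_unfold)

lemma mu_1: "i \<in> V \<Longrightarrow> mu (a1, a2, a3, a4) {i} = a1"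
  by (simp add: fk_mu_def clique_def fk_coeff_def)

lemma mu_2: "i \<in> V \<Longrightarrow> j \<in> V \<Longrightarrow> i \<noteq> j \<Longrightarrow> mu (a1, a2, a3, a4) {i, j} = a2 * ad i j"
  by (auto simp: fk_mu_def clique_def fk_coeff_def ad_eq S_sym)

lemma mu_3:
  assumes "i \<in> V" "j \<in> V" "k \<in> V" "S j k = 1"
  shows "mu (a1, a2, a3, a4) {i, j, k} = a2 * (of_bool (i = j) + of_bool (i = k)) + a3 * (ad i j * ad i k)"
proof -
  have jk: "j \<noteq> k" using assms(4) S_diag by auto
  consider "i = j" | "i = k" | "i \<noteq> j" "i \<noteq> k" by blast
  then show ?thesis
  proof cases
    case 1
    then show ?thesis using mu_2[of j k a1 a2 a3 a4] assms jk by (simp add: ad_eq S_diag)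
  next
    case 2
    then have "{i, j, k} = {j, k}" by auto
    then show ?thesis using 2 mu_2[of j k a1 a2 a3 a4] assms jk by (simp add: ad_eq S_diag)
  next
    case 3
    then show ?thesis using assms jk by (auto simp: fk_mu_def clique_def fk_coeff_def ad_eq S_sym)
  qed
qed

text \<open>Since \<open>ad\<close> vanishes on the diagonal, a coincidence kills the terms meant
  for larger unions, so the sum selects the right one of the cases of 2, 3 or 4 distinct
  vertices.\<close>

lemma mu_4:
  assumes V: "i \<in> V" "j \<in> V" "k \<in> V" "l \<in> V" and e: "S i j = 1" "S k l = 1"
  shows "mu (a1, a2, a3, a4) {i, j, k, l} = a2 * (of_bool (i = k) * of_bool (j = l) + of_bool (i = l) * of_bool (j = k))
    + a3 * (of_bool (i = k) * ad j l + of_bool (i = l) * ad j k + of_bool (j = k) * ad i l + of_bool (j = l) * ad i k)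
    + a4 * (ad i k * ad i l * ad j k * ad j l)"
proof -
  have ne: "i \<noteq> j" "k \<noteq> l" using e S_diag by auto
  consider "i = k" | "i \<noteq> k" "i = l" | "i \<noteq> k" "i \<noteq> l" "j = k \<or> j = l" | "i \<noteq> k" "i \<noteq> l" "j \<noteq> k" "j \<noteq> l" by blast
  then show ?thesis
  proof cases
    case 1
    then have "{i, j, k, l} = {j, k, l}" by auto
    then show ?thesis using 1 mu_3[of j k l a1 a2 a3 a4] V e ne by (auto simp: ad_eq S_diag S_sym)
  next
    case 2
    then have "{i, j, k, l} = {j, k, l}" by auto
    then show ?thesis using 2 mu_3[of j k l a1 a2 a3 a4] V e ne by (auto simp: ad_eq S_diag S_sym)
  next
    case 3
    then have "{i, j, k, l} = {i, k, l}" by auto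
    then show ?thesis using 3 mu_3[of i k l a1 a2 a3 a4] V e ne by (auto simp: ad_eq S_diag S_sym)
  next
    case 4
    then show ?thesis using V e ne by (auto simp: fk_mu_def clique_def fk_coeff_def ad_eq S_sym)
  qed
qed

lemma mu_Un_nonadjacent:
  assumes "k \<noteq> l" "S k l \<noteq> 1"
  shows "mu a (A \<union> {k, l}) = 0"
  using assms by (auto simp: fk_mu_def clique_def)

lemma sum_delta_bool:
  fixes f :: "'v \<Rightarrow> real"
  shows "i \<in> V \<Longrightarrow> (\<Sum>k\<in>V. f k * of_bool (i = k)) = f i" "i \<in> V \<Longrightarrow> (\<Sum>k\<in>V. of_bool (i = k) * f k) = f i"
    "i \<in> V \<Longrightarrow> (\<Sum>k\<in>V. f k * of_bool (k = i)) = f i" "i \<in> V \<Longrightarrow> (\<Sum>k\<in>V. of_bool (k = i) * f k) = f i"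
proof -
  have e: "f k * of_bool (i = k) = (if k = i then f i else 0)" "of_bool (i = k) * f k = (if k = i then f i else 0)"
    "f k * of_bool (k = i) = (if k = i then f i else 0)" "of_bool (k = i) * f k = (if k = i then f i else 0)" for k
    by auto
  show "i \<in> V \<Longrightarrow> (\<Sum>k\<in>V. f k * of_bool (i = k)) = f i" "i \<in> V \<Longrightarrow> (\<Sum>k\<in>V. of_bool (i = k) * f k) = f i"
    "i \<in> V \<Longrightarrow> (\<Sum>k\<in>V. f k * of_bool (k = i)) = f i" "i \<in> V \<Longrightarrow> (\<Sum>k\<in>V. of_bool (k = i) * f k) = f i"
    unfolding e using finite_V by simp_all
qed

lemma sum_small_sets_form:
  fixes Q :: "'v set \<Rightarrow> real"
  defines "Y \<equiv> \<lambda>i j. ad i j * Q {i, j}"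
  shows "(\<Sum>A\<in>small_sets V. \<Sum>B\<in>small_sets V. Q A * Q B * mu (a1, a2, a3, a4) (A \<union> B))
    = MQ (a1, a2, a3, a4) (Q {}) (\<lambda>i. Q {i}) Y"
proof -
  let ?a = "(a1, a2, a3, a4)"
  let ?y = "\<lambda>i. Q {i}"
  \<comment> \<open>\<open>h\<close> is the moment matrix applied to \<open>Q\<close>. It is
    evaluated at the empty set, at points and at edges in \<open>h0\<close>, \<open>h1\<close>,
    \<open>h2\<close>, and then paired with \<open>Q\<close> once more.\<close>
  define h where "h A = (\<Sum>B\<in>small_sets V. Q B * mu ?a (A \<union> B))" for A
  have Ysym: "Y i j = Y j i" for i j by (simp add: Y_def ad_sym insert_commute)
  have pair: "of_bool (k \<noteq> l) * (Q {k, l} * mu ?a (A \<union> {k, l})) = Y k l * mu ?a (A \<union> {k, l})"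
    if "k \<in> V" "l \<in> V" for A k l
    using mu_Un_nonadjacent[of k l ?a A] that by (cases "k = l") (auto simp: Y_def ad_eq S_diag)
  have hA: "h A = Q {} * mu ?a A + (\<Sum>k\<in>V. Q {k} * mu ?a (A \<union> {k})) + (\<Sum>k\<in>V. \<Sum>l\<in>V. Y k l * mu ?a (A \<union> {k, l})) / 2" for A
  proof -
    have "(\<Sum>k\<in>V. \<Sum>l\<in>V. of_bool (k \<noteq> l) * (Q {k, l} * mu ?a (A \<union> {k, l}))) = (\<Sum>k\<in>V. \<Sum>l\<in>V. Y k l * mu ?a (A \<union> {k, l}))"
      by (intro sum.cong refl pair)
    then show ?thesis unfolding h_def sum_small_sets[OF finite_V] by (simp only: Un_empty_right)
  qed
  have Y0: "Y k l = 0 \<or> S k l = 1" if "k \<in> V" "l \<in> V" for k l using that by (auto simp: Y_def ad_eq)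
  have h0: "h {} = Q {} + a1 * (\<Sum>k\<in>V. ?y k) + a2 / 2 * (\<Sum>k\<in>V. dg Y k)"
  proof -
    have 2: "Y k l * mu ?a {k, l} = a2 * Y k l" if "k \<in> V" "l \<in> V" for k l
      using that Y0[OF that] by (cases "k = l") (auto simp: mu_2 Y_def ad_eq S_diag)
    have "(\<Sum>k\<in>V. \<Sum>l\<in>V. Y k l * mu ?a {k, l}) = a2 * (\<Sum>k\<in>V. dg Y k)"
      unfolding dg_def sum_distrib_left by (intro sum.cong refl 2)
    moreover have "(\<Sum>k\<in>V. Q {k} * mu ?a {k}) = a1 * (\<Sum>k\<in>V. ?y k)"
      unfolding sum_distrib_left by (intro sum.cong refl) (simp add: mu_1)
    ultimately show ?thesis unfolding hA[of "{}"] Un_empty_left mu_0 by simp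
  qed
  have h1: "h {i} = a1 * Q {} + a1 * ?y i + a2 * (\<Sum>k\<in>V. ad i k * ?y k) + a2 * dg Y i
      + a3 / 2 * (\<Sum>k\<in>V. \<Sum>l\<in>V. Y k l * (ad i k * ad i l))" if i: "i \<in> V" for i
  proof -
    have 1: "Q {k} * mu ?a ({i} \<union> {k}) = a1 * (?y k * of_bool (i = k)) + a2 * (ad i k * ?y k)" if "k \<in> V" for k
      using mu_1[OF i] mu_2[OF i that] by (cases "i = k") (auto simp: insert_commute)
    have 2: "Y k l * mu ?a ({i} \<union> {k, l}) = a2 * (Y k l * of_bool (i = k)) + a2 * (Y k l * of_bool (i = l)) + a3 * (Y k l * (ad i k * ad i l))"
      if "k \<in> V" "l \<in> V" for k l
    proof (cases "Y k l = 0")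
      case False
      then have e: "S k l = 1" using Y0[OF that] by simp
      have "{i} \<union> {k, l} = {i, k, l}" by auto
      then show ?thesis using mu_3[OF i that e, of a1 a2 a3 a4] by (simp only:) (simp add: algebra_simps)
    qed simp
    have "(\<Sum>k\<in>V. \<Sum>l\<in>V. Y k l * mu ?a ({i} \<union> {k, l})) =
        a2 * (\<Sum>k\<in>V. \<Sum>l\<in>V. Y k l * of_bool (i = k)) + a2 * (\<Sum>k\<in>V. \<Sum>l\<in>V. Y k l * of_bool (i = l))
        + a3 * (\<Sum>k\<in>V. \<Sum>l\<in>V. Y k l * (ad i k * ad i l))"
    proof -
      have "(\<Sum>k\<in>V. \<Sum>l\<in>V. Y k l * mu ?a ({i} \<union> {k, l})) = (\<Sum>k\<in>V. \<Sum>l\<in>V. a2 * (Y k l * of_bool (i = k)) + a2 * (Y k l * of_bool (i = l)) + a3 * (Y k l * (ad i k * ad i l)))"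
        by (intro sum.cong refl 2)
      then show ?thesis by (simp only: sum.distrib sum_distrib_left)
    qed
    moreover have "(\<Sum>k\<in>V. \<Sum>l\<in>V. Y k l * of_bool (i = l)) = dg Y i"
      using i Ysym by (simp add: sum_delta_bool dg_def)
    moreover have "(\<Sum>k\<in>V. \<Sum>l\<in>V. Y k l * of_bool (i = k)) = dg Y i"
      using i sum_delta_bool(1)[of i "\<lambda>k. dg Y k"] by (simp add: dg_def sum_distrib_right)
    moreover have "(\<Sum>k\<in>V. Q {k} * mu ?a ({i} \<union> {k})) = a1 * ?y i + a2 * (\<Sum>k\<in>V. ad i k * ?y k)"
    proof -
      have "(\<Sum>k\<in>V. Q {k} * mu ?a ({i} \<union> {k})) = (\<Sum>k\<in>V. a1 * (?y k * of_bool (i = k)) + a2 * (ad i k * ?y k))"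
        by (rule sum.cong[OF refl 1])
      also have "\<dots> = a1 * (\<Sum>k\<in>V. ?y k * of_bool (i = k)) + a2 * (\<Sum>k\<in>V. ad i k * ?y k)"
        by (simp only: sum.distrib sum_distrib_left)
      finally show ?thesis by (simp only: sum_delta_bool[OF i])
    qed
    ultimately have "h {i} = Q {} * a1 + (a1 * ?y i + a2 * (\<Sum>k\<in>V. ad i k * ?y k)) + (a2 * dg Y i + a2 * dg Y i
        + a3 * (\<Sum>k\<in>V. \<Sum>l\<in>V. Y k l * (ad i k * ad i l))) / 2"
      unfolding hA[of "{i}"] mu_1[OF i] by (simp only:)
    then show ?thesis by (simp add: field_simps)
  qed
  have h2: "Y i j * h {i, j} = a2 * Q {} * Y i j + a2 * (Y i j * ?y i) + a2 * (Y i j * ?y j)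
      + a3 * (\<Sum>k\<in>V. ?y k * (Y i j * (ad k i * ad k j))) + a2 * Y i j ^ 2
      + a3 * (\<Sum>l\<in>V. Y i j * (Y i l * ad j l)) + a3 * (\<Sum>l\<in>V. Y j i * (Y j l * ad i l))
      + a4 / 2 * (\<Sum>k\<in>V. \<Sum>l\<in>V. Y i j * Y k l * (ad i k * ad i l * ad j k * ad j l))" if ij: "i \<in> V" "j \<in> V" for i j
  proof (cases "Y i j = 0")
    case True
    then show ?thesis using Ysym[of i j] by simp
  next
    case False
    then have e: "S i j = 1" using Y0[OF ij] by simp
    then have ne: "i \<noteq> j" using S_diag by auto
    have 0: "mu ?a {i, j} = a2" using mu_2[OF ij ne, of a1 a2 a3 a4] e ij by (simp add: ad_eq)
    have 1: "Q {k} * mu ?a ({i, j} \<union> {k}) = a2 * (?y k * of_bool (k = i)) + a2 * (?y k * of_bool (k = j)) + a3 * (?y k * (ad k i * ad k j))"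
      if "k \<in> V" for k
    proof -
      have "{i, j} \<union> {k} = {k, i, j}" by auto
      then show ?thesis using mu_3[OF that ij e, of a1 a2 a3 a4] by (simp only:) (simp add: algebra_simps)
    qed
    have 2: "Y k l * mu ?a ({i, j} \<union> {k, l}) = a2 * (of_bool (i = k) * (Y k l * of_bool (j = l))) + a2 * (of_bool (j = k) * (Y k l * of_bool (i = l)))
       + a3 * (of_bool (i = k) * (Y k l * ad j l)) + a3 * ((Y k l * ad j k) * of_bool (i = l))
       + a3 * (of_bool (j = k) * (Y k l * ad i l)) + a3 * ((Y k l * ad i k) * of_bool (j = l))
       + a4 * (Y k l * (ad i k * ad i l * ad j k * ad j l))" if "k \<in> V" "l \<in> V" for k l
    proof (cases "Y k l = 0")
      case False
      then have "S k l = 1" using Y0[OF that] by simp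
      moreover have "{i, j} \<union> {k, l} = {i, j, k, l}" by auto
      ultimately show ?thesis using mu_4[OF ij that e, of a1 a2 a3 a4] by (simp only:) (simp add: algebra_simps)
    qed simp
    have s1: "(\<Sum>k\<in>V. Q {k} * mu ?a ({i, j} \<union> {k})) = a2 * ?y i + a2 * ?y j + a3 * (\<Sum>k\<in>V. ?y k * (ad k i * ad k j))"
    proof -
      have "(\<Sum>k\<in>V. Q {k} * mu ?a ({i, j} \<union> {k})) = (\<Sum>k\<in>V. a2 * (?y k * of_bool (k = i)) + a2 * (?y k * of_bool (k = j)) + a3 * (?y k * (ad k i * ad k j)))"
        by (rule sum.cong[OF refl 1])
      also have "\<dots> = a2 * (\<Sum>k\<in>V. ?y k * of_bool (k = i)) + a2 * (\<Sum>k\<in>V. ?y k * of_bool (k = j)) + a3 * (\<Sum>k\<in>V. ?y k * (ad k i * ad k j))"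
        by (simp only: sum.distrib sum_distrib_left)
      finally show ?thesis by (simp only: sum_delta_bool[OF ij(1)] sum_delta_bool[OF ij(2)])
    qed
    have d: "(\<Sum>k\<in>V. \<Sum>l\<in>V. of_bool (x = k) * f k l) = (\<Sum>l\<in>V. f x l)" if "x \<in> V" for x and f :: "'v \<Rightarrow> 'v \<Rightarrow> real"
      using sum_delta_bool(2)[OF that, of "\<lambda>k. \<Sum>l\<in>V. f k l"] by (simp add: sum_distrib_left)
    have s2: "(\<Sum>k\<in>V. \<Sum>l\<in>V. Y k l * mu ?a ({i, j} \<union> {k, l})) = 2 * (a2 * Y i j) + 2 * (a3 * (\<Sum>l\<in>V. Y i l * ad j l))
       + 2 * (a3 * (\<Sum>l\<in>V. Y j l * ad i l)) + a4 * (\<Sum>k\<in>V. \<Sum>l\<in>V. Y k l * (ad i k * ad i l * ad j k * ad j l))"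
    proof -
      have "(\<Sum>k\<in>V. \<Sum>l\<in>V. Y k l * mu ?a ({i, j} \<union> {k, l})) = a2 * (\<Sum>k\<in>V. \<Sum>l\<in>V. of_bool (i = k) * (Y k l * of_bool (j = l)))
         + a2 * (\<Sum>k\<in>V. \<Sum>l\<in>V. of_bool (j = k) * (Y k l * of_bool (i = l)))
         + a3 * (\<Sum>k\<in>V. \<Sum>l\<in>V. of_bool (i = k) * (Y k l * ad j l)) + a3 * (\<Sum>k\<in>V. \<Sum>l\<in>V. (Y k l * ad j k) * of_bool (i = l))
         + a3 * (\<Sum>k\<in>V. \<Sum>l\<in>V. of_bool (j = k) * (Y k l * ad i l)) + a3 * (\<Sum>k\<in>V. \<Sum>l\<in>V. (Y k l * ad i k) * of_bool (j = l))
         + a4 * (\<Sum>k\<in>V. \<Sum>l\<in>V. Y k l * (ad i k * ad i l * ad j k * ad j l))"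
        unfolding sum_distrib_left sum.distrib[symmetric] by (intro sum.cong refl 2)
      also have "\<dots> = a2 * Y i j + a2 * Y j i + a3 * (\<Sum>l\<in>V. Y i l * ad j l) + a3 * (\<Sum>k\<in>V. Y k i * ad j k)
         + a3 * (\<Sum>l\<in>V. Y j l * ad i l) + a3 * (\<Sum>k\<in>V. Y k j * ad i k)
         + a4 * (\<Sum>k\<in>V. \<Sum>l\<in>V. Y k l * (ad i k * ad i l * ad j k * ad j l))"
        by (simp only: d[OF ij(1)] d[OF ij(2)] sum_delta_bool[OF ij(1)] sum_delta_bool[OF ij(2)])
      finally have "(\<Sum>k\<in>V. \<Sum>l\<in>V. Y k l * mu ?a ({i, j} \<union> {k, l})) = \<dots>" .
      moreover have "(\<Sum>k\<in>V. Y k i * ad j k) = (\<Sum>l\<in>V. Y i l * ad j l)" "(\<Sum>k\<in>V. Y k j * ad i k) = (\<Sum>l\<in>V. Y j l * ad i l)"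
        by (intro sum.cong refl, subst Ysym, rule refl)+
      moreover have "Y j i = Y i j" by (rule Ysym)
      ultimately show ?thesis by simp
    qed
    show ?thesis
      unfolding hA 0 s1 s2 Ysym[of j i]
      by (simp add: algebra_simps power2_eq_square sum_distrib_left)
  qed
  have t1: "(\<Sum>i\<in>V. ?y i * h {i}) = a1 * Q {} * (\<Sum>i\<in>V. ?y i) + a1 * sq ?y + a2 * X1 ?y + a2 * X2 ?y Y + a3 / 2 * X3 ?y Y"
  proof -
    have "(\<Sum>i\<in>V. ?y i * h {i}) = (\<Sum>i\<in>V. a1 * Q {} * ?y i + a1 * ?y i ^ 2 + a2 * (\<Sum>k\<in>V. ?y i * (ad i k * ?y k))
        + a2 * (?y i * dg Y i) + a3 / 2 * (\<Sum>k\<in>V. \<Sum>l\<in>V. ?y i * (Y k l * (ad i k * ad i l))))"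
      by (intro sum.cong refl, simp only: h1 sum_distrib_left[symmetric]) (simp add: algebra_simps power2_eq_square)
    then show ?thesis unfolding sq_def X1_def X2_def X3_def by (simp only: sum.distrib sum_distrib_left[symmetric])
  qed
  have t2: "(\<Sum>i\<in>V. \<Sum>j\<in>V. Y i j * h {i, j}) = a2 * Q {} * (\<Sum>i\<in>V. dg Y i) + 2 * (a2 * X2 ?y Y)
      + a3 * X3 ?y Y + a2 * sq2 Y + 2 * (a3 * X4 Y) + a4 / 2 * K4 Y"
  proof -
    have "(\<Sum>i\<in>V. \<Sum>j\<in>V. Y i j * h {i, j}) = a2 * Q {} * (\<Sum>i\<in>V. \<Sum>j\<in>V. Y i j) + a2 * (\<Sum>i\<in>V. \<Sum>j\<in>V. Y i j * ?y i) + a2 * (\<Sum>i\<in>V. \<Sum>j\<in>V. Y i j * ?y j)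
      + a3 * (\<Sum>i\<in>V. \<Sum>j\<in>V. \<Sum>k\<in>V. ?y k * (Y i j * (ad k i * ad k j))) + a2 * (\<Sum>i\<in>V. \<Sum>j\<in>V. Y i j ^ 2)
      + a3 * (\<Sum>i\<in>V. \<Sum>j\<in>V. \<Sum>l\<in>V. Y i j * (Y i l * ad j l)) + a3 * (\<Sum>i\<in>V. \<Sum>j\<in>V. \<Sum>l\<in>V. Y j i * (Y j l * ad i l))
      + a4 / 2 * (\<Sum>i\<in>V. \<Sum>j\<in>V. \<Sum>k\<in>V. \<Sum>l\<in>V. Y i j * Y k l * (ad i k * ad i l * ad j k * ad j l))"
    proof -
      have "(\<Sum>i\<in>V. \<Sum>j\<in>V. Y i j * h {i, j}) = (\<Sum>i\<in>V. \<Sum>j\<in>V. a2 * Q {} * Y i j + a2 * (Y i j * ?y i) + a2 * (Y i j * ?y j)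
      + a3 * (\<Sum>k\<in>V. ?y k * (Y i j * (ad k i * ad k j))) + a2 * Y i j ^ 2
      + a3 * (\<Sum>l\<in>V. Y i j * (Y i l * ad j l)) + a3 * (\<Sum>l\<in>V. Y j i * (Y j l * ad i l))
      + a4 / 2 * (\<Sum>k\<in>V. \<Sum>l\<in>V. Y i j * Y k l * (ad i k * ad i l * ad j k * ad j l)))"
        by (intro sum.cong refl h2)
      then show ?thesis by (simp only: sum.distrib sum_distrib_left[symmetric])
    qed
    moreover have "(\<Sum>i\<in>V. \<Sum>j\<in>V. Y i j * ?y i) = X2 ?y Y"
      unfolding X2_def dg_def sum_distrib_left by (intro sum.cong refl) (rule mult.commute)
    moreover have "(\<Sum>i\<in>V. \<Sum>j\<in>V. Y i j * ?y j) = X2 ?y Y"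
      unfolding X2_def dg_def sum_distrib_left
      by (subst sum.swap) (intro sum.cong refl, subst Ysym, rule mult.commute)
    moreover have "(\<Sum>i\<in>V. \<Sum>j\<in>V. \<Sum>k\<in>V. ?y k * (Y i j * (ad k i * ad k j))) = X3 ?y Y"
    proof -
      have "(\<Sum>i\<in>V. \<Sum>j\<in>V. \<Sum>k\<in>V. ?y k * (Y i j * (ad k i * ad k j))) = (\<Sum>i\<in>V. \<Sum>k\<in>V. \<Sum>j\<in>V. ?y k * (Y i j * (ad k i * ad k j)))"
        by (intro sum.cong refl sum.swap)
      also have "\<dots> = X3 ?y Y" unfolding X3_def by (rule sum.swap)
      finally show ?thesis .
    qed
    moreover have "(\<Sum>i\<in>V. \<Sum>j\<in>V. \<Sum>l\<in>V. Y j i * (Y j l * ad i l)) = X4 Y"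
      unfolding X4_def by (rule sum.swap)
    moreover have "(\<Sum>i\<in>V. \<Sum>j\<in>V. \<Sum>k\<in>V. \<Sum>l\<in>V. Y i j * Y k l * (ad i k * ad i l * ad j k * ad j l)) = K4 Y"
      unfolding K4_def T4_def sum_tuple4 ..
    ultimately show ?thesis by (simp add: X4_def sq2_def dg_def)
  qed
  have "(\<Sum>A\<in>small_sets V. \<Sum>B\<in>small_sets V. Q A * Q B * mu ?a (A \<union> B)) = (\<Sum>A\<in>small_sets V. Q A * h A)"
    unfolding h_def by (simp add: sum_distrib_left mult.assoc)
  also have "\<dots> = Q {} * h {} + (\<Sum>i\<in>V. ?y i * h {i}) + (\<Sum>i\<in>V. \<Sum>j\<in>V. of_bool (i \<noteq> j) * (Q {i, j} * h {i, j})) / 2"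
    by (rule sum_small_sets[OF finite_V])
  also have "(\<Sum>i\<in>V. \<Sum>j\<in>V. of_bool (i \<noteq> j) * (Q {i, j} * h {i, j})) = (\<Sum>i\<in>V. \<Sum>j\<in>V. Y i j * h {i, j})"
  proof (intro sum.cong refl)
    fix i j assume ij: "i \<in> V" "j \<in> V"
    have "h {i, j} = 0" if "i \<noteq> j" "S i j \<noteq> 1"
    proof -
      have "mu ?a ({i, j} \<union> B) = 0" for B using mu_Un_nonadjacent[OF that, of ?a B] by (simp add: Un_commute)
      then show ?thesis unfolding h_def by simp
    qed
    then show "of_bool (i \<noteq> j) * (Q {i, j} * h {i, j}) = Y i j * h {i, j}"
      using ij by (cases "i = j") (auto simp: Y_def ad_eq S_diag)
  qed
  finally show ?thesis unfolding h0 t1 t2 MQ_def prod.case by (simp add: field_simps power2_eq_square)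
qed

lemma pseudoexpectation4_if_MQ:
  assumes "\<And>y0 y Y. edgefun Y \<Longrightarrow> MQ (a1, a2, a3, a4) y0 y Y \<ge> 0"
  shows "pseudoexpectation4 V adj (fk_functional V adj (a1, a2, a3, a4))"
proof (rule pseudoexpectation4_fk_functionalI)
  fix q assume "q \<in> polys V 2"
  from fk_functional_square[OF finite_V this, of adj "(a1, a2, a3, a4)"] obtain Q where
    Q: "fk_functional V adj (a1, a2, a3, a4) (q^2) = (\<Sum>A\<in>small_sets V. \<Sum>B\<in>small_sets V. Q A * Q B * mu (a1, a2, a3, a4) (A \<union> B))"
    by blast
  have "edgefun (\<lambda>i j. ad i j * Q {i, j})"
    unfolding edgefun_def by (auto simp: ad_sym insert_commute ad_eq)
  then show "0 \<le> fk_functional V adj (a1, a2, a3, a4) (q^2)"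
    unfolding Q sum_small_sets_form by (rule assms)
qed

lemma MQ_if_pseudoexpectation4:
  assumes E: "pseudoexpectation4 V adj (fk_functional V adj (a1, a2, a3, a4))" and Y: "edgefun Y"
  shows "MQ (a1, a2, a3, a4) y0 y Y \<ge> 0"
proof -
  \<comment> \<open>On a pair the double sum runs over both orders of the edge and a zero diagonal,
    so half of it is \<open>Y i j\<close>; no choice of order is involved.\<close>
  define Q where "Q A = (if card A = 2 then (\<Sum>i\<in>A. \<Sum>j\<in>A. Y i j) / 2 else if card A = 1 then \<Sum>i\<in>A. y i else y0)" for A
  have Q2: "Q {i, j} = Y i j" if "i \<noteq> j" for i j
    using that edgefunD(1)[OF Y, of i j] edgefunD(2)[OF Y] by (simp add: Q_def)
  have ad: "ad i j * Q {i, j} = Y i j" if "i \<in> V" "j \<in> V" for i j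
    using edgefunD(2,3)[OF Y, of i] that by (cases "i = j") (auto simp: Q2 ad_eq S_diag)
  have "MQ (a1, a2, a3, a4) (Q {}) (\<lambda>i. Q {i}) (\<lambda>i j. ad i j * Q {i, j}) = MQ (a1, a2, a3, a4) y0 y Y"
  proof -
    have Q0: "Q {} = y0" "Q {i} = y i" for i by (simp_all add: Q_def)
    have "T4 (\<lambda>i j. ad i j * Q {i, j}) f = T4 Y f" for f
      unfolding T4_def by (intro sum.cong refl) (auto simp: ad)
    then show ?thesis
      unfolding MQ_def dg_def X1_def X2_def X3_def X4_def K4_def sq_def sq2_def Q0 prod.case
      by (simp add: ad)
  qed
  then show ?thesis
    using pseudoexpectation4_fk_functionalD[OF finite_V E, of Q] unfolding sum_small_sets_form by simp
qed

lemma FK4_ge: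
  assumes "\<And>y0 y Y. edgefun Y \<Longrightarrow> MQ (a1, a2, a3, a4) y0 y Y \<ge> 0"
  shows "n * a1 \<le> FK4 V adj"
proof -
  obtain E where E: "(\<Sum>i\<in>V. E (xvar i)) = FK4 V adj"
    "\<And>F. pseudoexpectation4 V adj F \<Longrightarrow> FK_pseudomoments4 V adj F \<Longrightarrow> (\<Sum>i\<in>V. F (xvar i)) \<le> (\<Sum>i\<in>V. E (xvar i))"
    using FK4_attained[OF finite_V, of adj] by metis
  have "(\<Sum>i\<in>V. fk_functional V adj (a1, a2, a3, a4) (xvar i)) \<le> (\<Sum>i\<in>V. E (xvar i))"
    by (intro E(2) pseudoexpectation4_if_MQ assms FK_pseudomoments4_fk_functional)
  then show ?thesis unfolding E(1) by (simp add: fk_functional_xvar)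
qed

lemma FK4_le:
  assumes "\<And>a1 a2 a3 a4. (\<And>y0 y Y. edgefun Y \<Longrightarrow> MQ (a1, a2, a3, a4) y0 y Y \<ge> 0) \<Longrightarrow> n * a1 \<le> B"
  shows "FK4 V adj \<le> B"
proof -
  obtain E where E: "pseudoexpectation4 V adj E" "FK_pseudomoments4 V adj E" "(\<Sum>i\<in>V. E (xvar i)) = FK4 V adj"
    using FK4_attained[OF finite_V, of adj] by metis
  obtain a where a: "\<And>f. f \<in> polys V 4 \<Longrightarrow> fk_functional V adj a f = E f"
    using FK_as_fk_functional[OF finite_V E(1,2)] by metis
  obtain a1 a2 a3 a4 where aa: "a = (a1, a2, a3, a4)" by (cases a)
  have "pseudoexpectation4 V adj (fk_functional V adj a)"
    by (rule pseudoexpectation4_cong[OF E(1) fk_functional_linear a])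
  then have "n * a1 \<le> B" unfolding aa by (intro assms MQ_if_pseudoexpectation4)
  moreover have "(\<Sum>i\<in>V. E (xvar i)) = (\<Sum>i\<in>V. a1)"
    by (intro sum.cong refl) (simp add: a[symmetric] polys_xvar aa fk_functional_xvar)
  ultimately show ?thesis using E(3) by simp
qed

section \<open>Expanding adjacency in signs\<close>

lemma X1_eq: "X1 y = ((\<Sum>i\<in>V. y i)^2 - sq y + SB y y) / 2"
proof -
  have "X1 y = (\<Sum>i\<in>V. \<Sum>k\<in>V. y i * y k / 2 + y i * S i k * y k / 2 - (y i * of_bool (i = k)) * y k / 2)"
    unfolding X1_def ad_def by (intro sum.cong refl) (simp add: field_simps)
  also have "\<dots> = (\<Sum>i\<in>V. y i)^2 / 2 + SB y y / 2 - (\<Sum>i\<in>V. \<Sum>k\<in>V. of_bool (i = k) * (y i * y k)) / 2"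
    unfolding square_sum SB_def by (simp add: sum.distrib sum_subtractf ac_simps flip: sum_divide_distrib)
  also have "(\<Sum>i\<in>V. \<Sum>k\<in>V. of_bool (i = k) * (y i * y k)) = sq y"
    unfolding sq_def power2_eq_square by (intro sum.cong refl) (rule sum_delta_bool(2))
  finally show ?thesis by (simp add: field_simps)
qed

lemma X4_eq: "X4 Y = (sq (dg Y) - sq2 Y + (\<Sum>i\<in>V. SB (Y i) (Y i))) / 2"
proof -
  have "X4 Y = (\<Sum>i\<in>V. X1 (Y i))"
    unfolding X4_def X1_def by (intro sum.cong refl) (simp add: ac_simps)
  also have "\<dots> = (sq (dg Y) - sq2 Y + (\<Sum>i\<in>V. SB (Y i) (Y i))) / 2"
    unfolding X1_eq sq_def sq2_def dg_def by (simp add: sum.distrib sum_subtractf flip: sum_divide_distrib)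
  finally show ?thesis .
qed

lemma X3_eq:
  assumes Y: "edgefun Y"
  shows "X3 y Y = ((\<Sum>i\<in>V. y i) * (\<Sum>i\<in>V. dg Y i) + 2 * SB y (dg Y) + (\<Sum>i\<in>V. y i * wd Y i)) / 4 - X2 y Y"
proof -
  note sym = edgefunD(1)[OF Y]
  have "X3 y Y = (\<Sum>i\<in>V. y i * ((\<Sum>k\<in>V. \<Sum>l\<in>V. Y k l) + (\<Sum>k\<in>V. S i k * dg Y k) + (\<Sum>k\<in>V. S i k * dg Y k) + wd Y i - 4 * dg Y i) / 4)"
    unfolding X3_def
  proof (rule sum.cong[OF refl])
    fix i assume i: "i \<in> V"
    \<comment> \<open>For \<open>i = k\<close> or \<open>i = l\<close> the left side is zero, while
      on an edge the expanded product leaves \<open>1 + S k l = 2\<close>. This is where the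
      coefficient 2 comes from.\<close>
    have pt: "y i * (Y k l * (ad i k * ad i l)) = y i / 4 * (Y k l + Y k l * S i k + Y k l * S i l + Y k l * (S i k * S i l)
        - 2 * (of_bool (i = k) * Y k l) - 2 * (Y k l * of_bool (i = l)))" if kl: "k \<in> V" "l \<in> V" for k l
    proof (cases "Y k l = 0")
      case False
      then have e: "S k l = 1" "S l k = 1" "k \<noteq> l" using edgefunD(2,3)[OF Y] kl S_sym[of k l] by auto
      consider "i = k" | "i = l" | "i \<noteq> k" "i \<noteq> l" by blast
      then show ?thesis using e by cases (auto simp: ad_def S_diag field_simps)
    qed simp
    have 1: "(\<Sum>k\<in>V. \<Sum>l\<in>V. Y k l * S i k) = (\<Sum>k\<in>V. S i k * dg Y k)"
      unfolding dg_def sum_distrib_left by (intro sum.cong refl) (rule mult.commute)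
    have 2: "(\<Sum>k\<in>V. \<Sum>l\<in>V. Y k l * S i l) = (\<Sum>k\<in>V. S i k * dg Y k)"
      unfolding dg_def sum_distrib_left by (subst sum.swap) (intro sum.cong refl, subst sym, rule mult.commute)
    have 3: "(\<Sum>k\<in>V. \<Sum>l\<in>V. of_bool (i = k) * Y k l) = dg Y i"
      using sum_delta_bool(2)[OF i, of "dg Y"] by (simp add: dg_def sum_distrib_left)
    have 4: "(\<Sum>k\<in>V. \<Sum>l\<in>V. Y k l * of_bool (i = l)) = dg Y i"
      unfolding sum_delta_bool(1)[OF i] dg_def by (intro sum.cong refl sym)
    have "(\<Sum>k\<in>V. \<Sum>l\<in>V. y i * (Y k l * (ad i k * ad i l))) = (\<Sum>k\<in>V. \<Sum>l\<in>V. y i / 4 * (Y k l + Y k l * S i k + Y k l * S i l + Y k l * (S i k * S i l)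
        - 2 * (of_bool (i = k) * Y k l) - 2 * (Y k l * of_bool (i = l))))"
      by (intro sum.cong refl pt)
    also have "\<dots> = y i / 4 * ((\<Sum>k\<in>V. \<Sum>l\<in>V. Y k l) + (\<Sum>k\<in>V. \<Sum>l\<in>V. Y k l * S i k) + (\<Sum>k\<in>V. \<Sum>l\<in>V. Y k l * S i l)
        + (\<Sum>k\<in>V. \<Sum>l\<in>V. Y k l * (S i k * S i l)) - 2 * (\<Sum>k\<in>V. \<Sum>l\<in>V. of_bool (i = k) * Y k l) - 2 * (\<Sum>k\<in>V. \<Sum>l\<in>V. Y k l * of_bool (i = l)))"
      by (simp only: sum.distrib sum_subtractf sum_distrib_left[symmetric])
    also have "\<dots> = y i * ((\<Sum>k\<in>V. \<Sum>l\<in>V. Y k l) + (\<Sum>k\<in>V. S i k * dg Y k) + (\<Sum>k\<in>V. S i k * dg Y k) + wd Y i - 4 * dg Y i) / 4"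
      unfolding 1 2 3 4 wd_def[symmetric] by (simp add: field_simps)
    finally show "(\<Sum>k\<in>V. \<Sum>l\<in>V. y i * (Y k l * (ad i k * ad i l))) =
      y i * ((\<Sum>k\<in>V. \<Sum>l\<in>V. Y k l) + (\<Sum>k\<in>V. S i k * dg Y k) + (\<Sum>k\<in>V. S i k * dg Y k) + wd Y i - 4 * dg Y i) / 4" .
  qed
  also have "\<dots> = ((\<Sum>i\<in>V. y i) * (\<Sum>i\<in>V. dg Y i) + 2 * (\<Sum>i\<in>V. y i * (\<Sum>k\<in>V. S i k * dg Y k)) + (\<Sum>i\<in>V. y i * wd Y i) - 4 * X2 y Y) / 4"
    unfolding X2_def dg_def[of Y] sum_distrib_right[of y]
    by (simp only: distrib_left right_diff_distrib sum.distrib sum_subtractf mult.left_commute[of _ 4]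
        sum_distrib_left[symmetric] sum_divide_distrib[symmetric]) simp
  also have "(\<Sum>i\<in>V. y i * (\<Sum>k\<in>V. S i k * dg Y k)) = SB y (dg Y)"
    unfolding SB_def by (simp add: sum_distrib_left mult.assoc)
  finally show ?thesis by (simp add: field_simps)
qed

end

section \<open>The lower bound\<close>

context conference
begin

text \<open>The last step of \<open>MQ_nonneg\<close> made linear: \<open>a\<close>,
  \<open>b\<close>, \<open>c\<close> stand for the squares of \<open>A\<close>, \<open>B\<close>,
  \<open>C\<close>, and \<open>x\<close>, \<open>y\<close>, \<open>z\<close> for the products
  \<open>A * B\<close>, \<open>A * C\<close>, \<open>B * C\<close>.\<close>

lemma combination_nonneg:
  fixes a x y c b z m :: real
  assumes "a - 2 * (2 * (1 / 8192) * a) - (8 + 1 / 32) * x - 1 / 64 * x - 1 / 512 * y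
     + (2 * c - 1 / 64 * c) + 128 * b - 1 / 64 * c - 1 / 4 * c - 1 / 2 * b - 1 / 8 * z \<le> m"
    "16 * x \<le> a + 64 * b" "2 * y \<le> a + c" "2 * z \<le> b + c" "0 \<le> a" "0 \<le> b" "0 \<le> c"
  shows "0 \<le> m"
proof -
  have "(8 + 1 / 32) * x = 8 * x + x / 32" by (simp add: distrib_right)
  moreover have "2 * (2 * (1 / 8192) * a) = a / 2048" by simp
  ultimately show ?thesis using assms by linarith
qed

lemma X2_le: "\<bar>X2 y Y\<bar> \<le> sqrt (sq y) * sqrt (sq (dg Y))"
  unfolding X2_def sq_def by (rule Cauchy_Schwarz_sqrt)

lemma sum_SB_le: "\<bar>\<Sum>i\<in>V. SB (Y i) (Y i)\<bar> \<le> sqrt n * sq2 Y"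
proof -
  have "\<bar>\<Sum>i\<in>V. SB (Y i) (Y i)\<bar> \<le> (\<Sum>i\<in>V. sqrt n * sq (Y i))"
  proof (intro order_trans[OF sum_abs] sum_mono)
    fix i
    have "\<bar>SB (Y i) (Y i)\<bar> \<le> sqrt n * sqrt (sq (Y i)) * sqrt (sq (Y i))" by (rule SB_le)
    then show "\<bar>SB (Y i) (Y i)\<bar> \<le> sqrt n * sq (Y i)" by (simp add: mult.assoc)
  qed
  then show ?thesis by (simp add: sq2_def sq_def sum_distrib_left)
qed

text \<open>Completing the square in \<open>y0\<close> isolates it. The term \<open>s^2\<close> is
  split off from \<open>16 * K4 Y\<close>, so that the totals \<open>\<sigma>\<close> and
  \<open>s\<close> form a separate block of size two.\<close>

lemma MQ_expand:
  fixes y :: "'v \<Rightarrow> real" and Y :: "'v \<Rightarrow> 'v \<Rightarrow> real"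
  assumes Y: "edgefun Y"
  defines "\<sigma> \<equiv> \<Sum>i\<in>V. y i" and "s \<equiv> \<Sum>i\<in>V. dg Y i"
  shows "MQ (a1, a2, a3, a4) y0 y Y = (y0 + a1 * \<sigma> + a2 / 2 * s)^2
    + ((a2 / 2 - a1^2) * \<sigma>^2 + (a3 / 4 - a1 * a2) * \<sigma> * s + (a4 / 64 - a2^2 / 4) * s^2)
    + (a1 - a2 / 2) * sq y + a2 / 2 * SB y y + (2 * a2 - a3) * X2 y Y + a3 / 2 * SB y (dg Y)
    + a3 / 4 * (\<Sum>i\<in>V. y i * wd Y i) + (a2 / 2 - a3 / 2) * sq2 Y + a3 / 2 * sq (dg Y)
    + a3 / 2 * (\<Sum>i\<in>V. SB (Y i) (Y i)) + a4 / 64 * (16 * K4 Y - s^2)"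
  unfolding MQ_def prod.case X1_eq X3_eq[OF Y] X4_eq \<sigma>_def[symmetric] s_def[symmetric]
  by (simp add: field_simps power2_eq_square)

text \<open>The moments \<open>\<kappa>, 4\<kappa>\<^sup>2, 256\<kappa>\<^sup>3, 65536\<kappa>\<^sup>4\<close> with \<open>\<kappa> = t\<^sup>2\<close>; the growing constants
  make the block of \<open>\<sigma>\<close> and \<open>s\<close> and the block of \<open>y\<close> and the degrees positive semidefinite.\<close>

lemma MQ_nonneg:
  assumes Y: "edgefun Y" and n1: "n \<ge> 1" and t: "t > 0"
    and h1: "t^2 * sqrt n \<le> 1 / 8192" and h2: "t^3 * n \<le> 1 / 32768"
    and h3: "t^4 * ((70 + K) * R) \<le> 1 / 4096"
  shows "MQ (t^2, 4 * t^4, 256 * t^6, 65536 * t^8) y0 y Y \<ge> 0"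
proof -
  define u where "u = sqrt (sq y)"
  define e where "e = sqrt (sq (dg Y))"
  define z where "z = sqrt (sq2 Y)"
  define \<sigma> where "\<sigma> = (\<Sum>i\<in>V. y i)"
  define s where "s = (\<Sum>i\<in>V. dg Y i)"
  \<comment> \<open>In these units the positive terms of the form are essentially
    \<open>A^2\<close>, \<open>128 B^2\<close> and \<open>2 C^2\<close>, and each error is a product
    of two units times a quantity made small by \<open>h1\<close>, \<open>h2\<close>,
    \<open>h3\<close> or \<open>tn\<close>.\<close>
  define A where "A = t * u"
  define B where "B = t^3 * e"
  define C where "C = t^2 * z"
  have nn: "u \<ge> 0" "e \<ge> 0" "z \<ge> 0" "A \<ge> 0" "B \<ge> 0" "C \<ge> 0"
    using t by (auto simp: u_def e_def z_def A_def B_def C_def)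
  have sqs: "sq y = u^2" "sq (dg Y) = e^2" "sq2 Y = z^2" by (simp_all add: u_def e_def z_def)
  have tn: "t^2 \<le> 1 / 8192"
  proof -
    have "t^2 * 1 \<le> t^2 * sqrt n" using n1 by (intro mult_left_mono) auto
    then show ?thesis using h1 by simp
  qed
  have b: "c * r * w \<le> c * q * w" if "r \<le> q" "0 \<le> c" "0 \<le> w" for c r q w :: real
    using that by (intro mult_right_mono mult_left_mono)
  have e1: "4 * t^4 / 2 * u^2 \<le> 2 * (1 / 8192) * A^2"
  proof -
    have "4 * t^4 / 2 * u^2 = 2 * t^2 * A^2" by (simp add: A_def eval_nat_numeral algebra_simps)
    also have "\<dots> \<le> 2 * (1 / 8192) * A^2" using tn by (rule b) auto
    finally show ?thesis .
  qed
  have e2: "4 * t^4 / 2 * \<bar>SB y y\<bar> \<le> 2 * (1 / 8192) * A^2"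
  proof -
    have "2 * t^4 * \<bar>SB y y\<bar> \<le> 2 * t^4 * (sqrt n * u * u)" using SB_le[of y y] t by (intro mult_left_mono) (auto simp: u_def)
    also have "\<dots> = 2 * (t^2 * sqrt n) * A^2" by (simp add: A_def eval_nat_numeral algebra_simps)
    also have "\<dots> \<le> 2 * (1 / 8192) * A^2" using h1 by (rule b) auto
    finally show ?thesis by simp
  qed
  have e3: "(8 * t^4 + 256 * t^6) * \<bar>X2 y Y\<bar> \<le> (8 + 1 / 32) * (A * B)"
  proof -
    have "(8 * t^4 + 256 * t^6) * \<bar>X2 y Y\<bar> \<le> (8 * t^4 + 256 * t^6) * (u * e)"
      using X2_le[of y Y] t by (intro mult_left_mono) (auto simp: u_def e_def)
    also have "\<dots> = 8 * (A * B) + 256 * t^2 * (A * B)" by (simp add: A_def B_def eval_nat_numeral algebra_simps)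
    also have "256 * t^2 * (A * B) \<le> 256 * (1 / 8192) * (A * B)" using tn nn by (intro b) auto
    finally show ?thesis by simp
  qed
  have e4: "256 * t^6 / 2 * \<bar>SB y (dg Y)\<bar> \<le> 1 / 64 * (A * B)"
  proof -
    have "128 * t^6 * \<bar>SB y (dg Y)\<bar> \<le> 128 * t^6 * (sqrt n * u * e)" using SB_le[of y "dg Y"] t by (intro mult_left_mono) (auto simp: u_def e_def)
    also have "\<dots> = 128 * (t^2 * sqrt n) * (A * B)" by (simp add: A_def B_def eval_nat_numeral algebra_simps)
    also have "\<dots> \<le> 128 * (1 / 8192) * (A * B)" using h1 nn by (intro b) auto
    finally show ?thesis by simp
  qed
  \<comment> \<open>This wedge term dictates the scale: it needs \<open>t^3 n\<close> bounded, that
    is \<open>t^2 = O(n^(-2/3))\<close>.\<close>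
  have e5: "256 * t^6 / 4 * \<bar>\<Sum>i\<in>V. y i * wd Y i\<bar> \<le> 1 / 512 * (A * C)"
  proof -
    have "64 * t^6 * \<bar>\<Sum>i\<in>V. y i * wd Y i\<bar> \<le> 64 * t^6 * (n * u * z)" using wedge_le[of y Y] t by (intro mult_left_mono) (auto simp: u_def z_def)
    also have "\<dots> = 64 * (t^3 * n) * (A * C)" by (simp add: A_def C_def eval_nat_numeral algebra_simps)
    also have "\<dots> \<le> 64 * (1 / 32768) * (A * C)" using h2 nn by (intro b) auto
    finally show ?thesis by simp
  qed
  have e6: "256 * t^6 / 2 * z^2 \<le> 1 / 64 * C^2"
  proof -
    have "256 * t^6 / 2 * z^2 = 128 * t^2 * C^2" by (simp add: C_def eval_nat_numeral algebra_simps)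
    also have "\<dots> \<le> 128 * (1 / 8192) * C^2" using tn by (rule b) auto
    finally show ?thesis by simp
  qed
  have e7: "256 * t^6 / 2 * \<bar>\<Sum>i\<in>V. SB (Y i) (Y i)\<bar> \<le> 1 / 64 * C^2"
  proof -
    have "128 * t^6 * \<bar>\<Sum>i\<in>V. SB (Y i) (Y i)\<bar> \<le> 128 * t^6 * (sqrt n * z^2)" using sum_SB_le[of Y] t by (intro mult_left_mono) (auto simp: sqs)
    also have "\<dots> = 128 * (t^2 * sqrt n) * C^2" by (simp add: C_def eval_nat_numeral algebra_simps)
    also have "\<dots> \<le> 128 * (1 / 8192) * C^2" using h1 by (intro b) auto
    finally show ?thesis by simp
  qed
  have e8: "4096 * t^8 * \<bar>SB (dg Y) (dg Y)\<bar> \<le> 1 / 2 * B^2"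
  proof -
    have "4096 * t^8 * \<bar>SB (dg Y) (dg Y)\<bar> \<le> 4096 * t^8 * (sqrt n * e * e)" using SB_le[of "dg Y" "dg Y"] t by (intro mult_left_mono) (auto simp: e_def)
    also have "\<dots> = 4096 * (t^2 * sqrt n) * B^2" by (simp add: B_def eval_nat_numeral algebra_simps)
    also have "\<dots> \<le> 4096 * (1 / 8192) * B^2" using h1 by (intro b) auto
    finally show ?thesis by simp
  qed
  have e9: "4096 * t^8 * \<bar>\<Sum>i\<in>V. dg Y i * wd Y i\<bar> \<le> 1 / 8 * (B * C)"
  proof -
    have "4096 * t^8 * \<bar>\<Sum>i\<in>V. dg Y i * wd Y i\<bar> \<le> 4096 * t^8 * (n * e * z)" using wedge_le[of "dg Y" Y] t by (intro mult_left_mono) (auto simp: e_def z_def)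
    also have "\<dots> = 4096 * (t^3 * n) * (B * C)" by (simp add: B_def C_def eval_nat_numeral algebra_simps)
    also have "\<dots> \<le> 4096 * (1 / 32768) * (B * C)" using h2 nn by (intro b) auto
    finally show ?thesis by simp
  qed
  have e10: "1024 * t^8 * \<bar>16 * K4 Y - (s^2 + 4 * SB (dg Y) (dg Y) + 4 * (\<Sum>i\<in>V. dg Y i * wd Y i))\<bar> \<le> 1 / 4 * C^2"
  proof -
    have "1024 * t^8 * \<bar>16 * K4 Y - (s^2 + 4 * SB (dg Y) (dg Y) + 4 * (\<Sum>i\<in>V. dg Y i * wd Y i))\<bar> \<le> 1024 * t^8 * ((70 + K) * R * z^2)"
      using K4_expansion[of Y] edgefunD(1,2)[OF Y] n1 t by (intro mult_left_mono) (auto simp: s_def sqs)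
    also have "\<dots> = 1024 * (t^4 * ((70 + K) * R)) * C^2" by (simp add: C_def eval_nat_numeral algebra_simps)
    also have "\<dots> \<le> 1024 * (1 / 4096) * C^2" using h3 by (intro b) auto
    finally show ?thesis by simp
  qed
  have K: "65536 * t^8 / 64 * (16 * K4 Y - s^2) \<ge> - (1 / 4 * C^2) - 1 / 2 * B^2 - 1 / 8 * (B * C)"
  proof -
    let ?r = "16 * K4 Y - (s^2 + 4 * SB (dg Y) (dg Y) + 4 * (\<Sum>i\<in>V. dg Y i * wd Y i))"
    have "65536 * t^8 / 64 * (16 * K4 Y - s^2) = 1024 * t^8 * ?r + 4096 * t^8 * SB (dg Y) (dg Y) + 4096 * t^8 * (\<Sum>i\<in>V. dg Y i * wd Y i)"
      by (simp add: algebra_simps)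
    moreover have lo: "- (c * \<bar>x\<bar>) \<le> c * x" if "c \<ge> 0" for c x :: real
      using mult_left_mono[of "- \<bar>x\<bar>" x c] that by simp
    have "- (1024 * t^8 * \<bar>?r\<bar>) \<le> 1024 * t^8 * ?r" "- (4096 * t^8 * \<bar>SB (dg Y) (dg Y)\<bar>) \<le> 4096 * t^8 * SB (dg Y) (dg Y)"
      "- (4096 * t^8 * \<bar>\<Sum>i\<in>V. dg Y i * wd Y i\<bar>) \<le> 4096 * t^8 * (\<Sum>i\<in>V. dg Y i * wd Y i)"
      using t by (intro lo; simp)+
    ultimately show ?thesis using e8 e9 e10 by linarith
  qed
  have lo: "- (c * \<bar>x\<bar>) \<le> c * x" if "c \<ge> 0" for c x :: real
    using mult_left_mono[of "- \<bar>x\<bar>" x c] that by simp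
  have lo2: "- m \<le> c * x" if "c \<ge> 0" "c * \<bar>x\<bar> \<le> m" for c x m :: real
    using lo[OF that(1), of x] that(2) by linarith
  have l2: "- (2 * (1 / 8192) * A^2) \<le> 4 * t^4 / 2 * SB y y" using e2 by (rule lo2[rotated]) simp
  have l3: "- ((8 + 1 / 32) * (A * B)) \<le> (2 * (4 * t^4) - 256 * t^6) * X2 y Y"
  proof -
    have "\<bar>2 * (4 * t^4) - 256 * t^6\<bar> \<le> 8 * t^4 + 256 * t^6" using t by (simp add: abs_le_iff)
    then have "\<bar>(2 * (4 * t^4) - 256 * t^6) * X2 y Y\<bar> \<le> (8 * t^4 + 256 * t^6) * \<bar>X2 y Y\<bar>"
      unfolding abs_mult by (rule mult_right_mono) simp
    then show ?thesis using e3 by linarith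
  qed
  have l4: "- (1 / 64 * (A * B)) \<le> 256 * t^6 / 2 * SB y (dg Y)" using e4 by (rule lo2[rotated]) simp
  have l5: "- (1 / 512 * (A * C)) \<le> 256 * t^6 / 4 * (\<Sum>i\<in>V. y i * wd Y i)"
    using e5 by (rule lo2[rotated]) simp
  have l7: "- (1 / 64 * C^2) \<le> 256 * t^6 / 2 * (\<Sum>i\<in>V. SB (Y i) (Y i))"
    using e7 by (rule lo2[rotated]) simp
  \<comment> \<open>In the units \<open>t^2 \<sigma>\<close> and \<open>t^4 s\<close> the
    coefficients are 1, 60 and 1020, and \<open>1020 = 30^2 + 120\<close>.\<close>
  have J: "(4 * t^4 / 2 - (t^2)^2) * \<sigma>^2 + (256 * t^6 / 4 - t^2 * (4 * t^4)) * \<sigma> * s + (65536 * t^8 / 64 - (4 * t^4)^2 / 4) * s^2 \<ge> 0"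
  proof -
    have "(4 * t^4 / 2 - (t^2)^2) * \<sigma>^2 + (256 * t^6 / 4 - t^2 * (4 * t^4)) * \<sigma> * s + (65536 * t^8 / 64 - (4 * t^4)^2 / 4) * s^2
       = (t^2 * \<sigma> + 30 * t^4 * s)^2 + 120 * (t^4 * s)^2"
      by (simp add: eval_nat_numeral algebra_simps)
    then show ?thesis by simp
  qed
  have main: "A^2 - 2 * (2 * (1 / 8192) * A^2) - (8 + 1 / 32) * (A * B) - 1 / 64 * (A * B) - 1 / 512 * (A * C)
     + (2 * C^2 - 1 / 64 * C^2) + 128 * B^2 - 1 / 64 * C^2 - 1 / 4 * C^2 - 1 / 2 * B^2 - 1 / 8 * (B * C)
      \<le> MQ (t^2, 4 * t^4, 256 * t^6, 65536 * t^8) y0 y Y"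
  proof -
    have m1: "(t^2 - 4 * t^4 / 2) * sq y = A^2 - 4 * t^4 / 2 * u^2" unfolding sqs by (simp add: A_def power_mult_distrib algebra_simps)
    have m2: "(4 * t^4 / 2 - 256 * t^6 / 2) * sq2 Y = 2 * C^2 - 256 * t^6 / 2 * z^2" unfolding sqs by (simp add: C_def power_mult_distrib algebra_simps)
    have m3: "256 * t^6 / 2 * sq (dg Y) = 128 * B^2" unfolding sqs by (simp add: B_def power_mult_distrib)
    show ?thesis
      using MQ_expand[OF Y, of "t^2" "4 * t^4" "256 * t^6" "65536 * t^8" y0 y]
        zero_le_power2[of "y0 + t^2 * \<sigma> + 4 * t^4 / 2 * s"] J l2 l3 l4 l5 l7 K e1 e6
      unfolding m1 m2 m3 \<sigma>_def[symmetric] s_def[symmetric] by linarith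
  qed
  \<comment> \<open>The coefficient of \<open>A * B\<close> is just above 8, so this uses about half
    of \<open>A^2\<close> and 32 of the 128 units of \<open>B^2\<close>, which the constant 256 of
    the third moment supplies.\<close>
  have "16 * (A * B) \<le> A^2 + 64 * B^2" using sum_squares_bound[of A "8 * B"] by (simp add: power_mult_distrib)
  moreover have "2 * (A * C) \<le> A^2 + C^2" "2 * (B * C) \<le> B^2 + C^2"
    using sum_squares_bound[of A C] sum_squares_bound[of B C] by simp_all
  ultimately show ?thesis by (intro combination_nonneg[OF main]) auto
qed

lemma FK4_lower:
  assumes "n \<ge> 1" "t > 0" "t^2 * sqrt n \<le> 1 / 8192" "t^3 * n \<le> 1 / 32768" "t^4 * ((70 + K) * R) \<le> 1 / 4096"
  shows "n * t^2 \<le> FK4 V adj"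
  by (rule FK4_ge) (rule MQ_nonneg[OF _ assms])

end

section \<open>The upper bound\<close>

lemma discriminant_le:
  fixes A B C :: real
  assumes "\<And>x y. A * x^2 + B * (x * y) + C * y^2 \<ge> 0"
  shows "B^2 \<le> 4 * A * C"
proof -
  have A: "A \<ge> 0" using assms[of 1 0] by simp
  have "A * (B^2 - 4 * A * C) \<le> 0"
    using assms[of "- B" "2 * A"] by (simp add: power2_eq_square algebra_simps)
  then have "B^2 \<le> 4 * A * C" if "A > 0" using that by (simp add: mult_le_0_iff)
  moreover have "B = 0" if "A = 0"
  proof (rule ccontr)
    assume "B \<noteq> 0"
    then show False using assms[of "- (C + 1) / B" 1] that by (simp add: field_simps)
  qed
  ultimately show ?thesis using A by (cases "A = 0") auto
qed

section \<open>Test functions at a vertex\<close>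

context conference
begin

text \<open>The edges at \<open>c\<close>, in both orders because edge functions are symmetric. In
  what follows \<open>p\<close> and \<open>q\<close> are real coefficients of \<open>star c\<close>
  and \<open>sc c\<close>.\<close>

definition star :: "'v \<Rightarrow> 'v \<Rightarrow> 'v \<Rightarrow> real" where
  "star c i j = of_bool (i = c) * ad c j + of_bool (j = c) * ad c i"

text \<open>Between neighbours of \<open>c\<close> the sign is 1, so \<open>sc c\<close> correlates
  fully with the triangles at \<open>c\<close>. Over all vertices the signs cancel in every row
  (\<open>dg_sc_le\<close>), which keeps the cost of the test low; the plain indicator of those
  edges would not cancel.\<close>

definition sc :: "'v \<Rightarrow> 'v \<Rightarrow> 'v \<Rightarrow> real" where
  "sc c i j = S c i * S c j * ad i j"

text \<open>Ordered counts: \<open>tri c\<close> is twice the number of triangles at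
  \<open>c\<close>, and \<open>k4 c\<close> below is six times the number of 4-cliques that contain
  \<open>c\<close>.\<close>

definition tri :: "'v \<Rightarrow> real" where "tri c = X1 (ad c)"

definition k4 :: "'v \<Rightarrow> real" where
  "k4 c = (\<Sum>j\<in>V. ad c j * X1 (\<lambda>k. ad c k * ad j k))"

lemma edgefun_test:
  assumes "c \<in> V"
  shows "edgefun (\<lambda>i j. p * star c i j + q * sc c i j)"
proof -
  have "p * star c i j + q * sc c i j = 0 \<or> S i j = 1" if "i \<in> V" "j \<in> V" for i j
  proof (cases "S i j = 1")
    case False
    then have "ad i j = 0" using that by (simp add: ad_eq)
    moreover have "star c i j = of_bool (i = c) * ad i j + of_bool (j = c) * ad i j"
      by (auto simp: star_def ad_sym)
    ultimately show ?thesis by (simp add: sc_def)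
  qed simp
  moreover have "sc c i j = sc c j i" "star c i j = star c j i" "sc c i i = 0" "star c i i = 0" for i j
    by (auto simp: sc_def star_def ad_sym)
  ultimately show ?thesis unfolding edgefun_def by auto
qed

lemma sum_ad: "c \<in> V \<Longrightarrow> (\<Sum>j\<in>V. ad c j) = (n - 1) / 2"
proof -
  assume c: "c \<in> V"
  have "(\<Sum>j\<in>V. ad c j) = ((\<Sum>j\<in>V. 1) + (\<Sum>j\<in>V. S c j) - (\<Sum>j\<in>V. 1 * of_bool (c = j))) / 2"
    unfolding ad_def by (simp only: sum_divide_distrib[symmetric] sum.distrib sum_subtractf mult_1)
  also have "\<dots> = (n - 1) / 2" unfolding sum_delta_bool(1)[OF c] S_row[OF c] by simp
  finally show ?thesis .
qed

lemma ad_sq: "i \<in> V \<Longrightarrow> j \<in> V \<Longrightarrow> ad i j * ad i j = ad i j"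
  using ad_values[of i j] by auto

lemma ad_S: "i \<in> V \<Longrightarrow> j \<in> V \<Longrightarrow> ad i j * S i j = ad i j"
  by (simp add: ad_eq)

lemma dg_star: "c \<in> V \<Longrightarrow> dg (star c) c = (n - 1) / 2"
  unfolding dg_def star_def by (simp add: sum_ad)

lemma sc_c [simp]: "sc c c j = 0" "sc c i c = 0"
  by (simp_all add: sc_def S_diag)

lemma sum_double_star:
  assumes "c \<in> V"
  shows "(\<Sum>i\<in>V. \<Sum>j\<in>V. star c i j * f i j) = (\<Sum>j\<in>V. ad c j * f c j) + (\<Sum>i\<in>V. ad c i * f i c)"
proof -
  have "(\<Sum>i\<in>V. \<Sum>j\<in>V. star c i j * f i j) = (\<Sum>i\<in>V. of_bool (i = c) * (\<Sum>j\<in>V. ad c j * f i j)) + (\<Sum>i\<in>V. \<Sum>j\<in>V. of_bool (j = c) * (ad c i * f i j))"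
    unfolding star_def distrib_right sum.distrib by (simp only: sum_distrib_left mult.assoc)
  then show ?thesis by (simp only: sum_delta_bool(4)[OF assms])
qed

text \<open>The supports are disjoint: \<open>star c\<close> lives on pairs that contain
  \<open>c\<close>, where \<open>sc c\<close> vanishes.\<close>

lemma sq2_test:
  assumes c: "c \<in> V"
  shows "sq2 (\<lambda>i j. p * star c i j + q * sc c i j) = p^2 * (n - 1) + q^2 * sq2 (sc c)"
proof -
  have 1: "star c i j * sc c i j = 0" for i j by (auto simp: star_def)
  have 2: "(\<Sum>i\<in>V. \<Sum>j\<in>V. star c i j * star c i j) = n - 1"
  proof -
    have e: "ad c j * star c c j = ad c j" "ad c j * star c j c = ad c j" if "j \<in> V" for j
      using ad_sq[OF c that] by (auto simp: star_def)
    have "(\<Sum>j\<in>V. ad c j * star c c j) = (n - 1) / 2" "(\<Sum>j\<in>V. ad c j * star c j c) = (n - 1) / 2"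
      unfolding sum_ad[OF c, symmetric] by (intro sum.cong refl e, assumption)+
    then show ?thesis unfolding sum_double_star[OF c] by simp
  qed
  have 3: "(p * star c i j + q * sc c i j)^2 = p^2 * (star c i j * star c i j) + q^2 * sc c i j ^ 2" for i j
    using 1[of i j] by (simp add: power2_eq_square algebra_simps)
  show ?thesis unfolding sq2_def 3 2[symmetric] by (simp only: sum.distrib sum_distrib_left[symmetric])
qed

lemma X1_add: "X1 (\<lambda>j. f j + g j) = X1 f + 2 * (\<Sum>i\<in>V. \<Sum>k\<in>V. f i * (ad i k * g k)) + X1 g"
proof -
  have "X1 (\<lambda>j. f j + g j) = X1 f + (\<Sum>i\<in>V. \<Sum>k\<in>V. f i * (ad i k * g k)) + (\<Sum>i\<in>V. \<Sum>k\<in>V. g i * (ad i k * f k)) + X1 g"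
    unfolding X1_def by (simp only: distrib_left distrib_right sum.distrib)
  moreover have "(\<Sum>i\<in>V. \<Sum>k\<in>V. g i * (ad i k * f k)) = (\<Sum>i\<in>V. \<Sum>k\<in>V. f i * (ad i k * g k))"
    by (subst sum.swap) (intro sum.cong refl, subst ad_sym, simp only: ac_simps)
  ultimately show ?thesis by simp
qed

lemma X1_scale: "X1 (\<lambda>j. r * f j) = r^2 * X1 f"
  unfolding X1_def sum_distrib_left by (intro sum.cong refl) (simp add: power2_eq_square)

lemma tri_eq: "tri c = (\<Sum>i\<in>V. \<Sum>k\<in>V. ad c i * (ad i k * ad c k))"
  unfolding tri_def X1_def ..

lemma X4_X1: "X4 Y = (\<Sum>i\<in>V. X1 (Y i))"
  unfolding X4_def X1_def by (intro sum.cong refl) (simp add: ac_simps)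

lemma sum_ad_sc:
  assumes c: "c \<in> V"
  shows "(\<Sum>k\<in>V. \<Sum>l\<in>V. sc c k l * (ad c k * ad c l)) = tri c"
  unfolding tri_eq
proof (intro sum.cong refl)
  fix k l assume "k \<in> V" "l \<in> V"
  then show "sc c k l * (ad c k * ad c l) = ad c k * (ad k l * ad c l)"
    using ad_S[OF c, of k] ad_S[OF c, of l] by (auto simp: sc_def)
qed

text \<open>Row \<open>c\<close> is \<open>p\<close> times \<open>ad c\<close> and gives the
  \<open>p^2\<close> term. In any other row the star has a single entry, at \<open>c\<close>, and
  its pairing with \<open>sc c\<close> gives the mixed term through
  \<open>sum_ad_sc\<close>.\<close>

lemma X4_test:
  assumes c: "c \<in> V"
  shows "X4 (\<lambda>i j. p * star c i j + q * sc c i j) = p^2 * tri c + 2 * (p * q) * tri c + q^2 * X4 (sc c)"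
proof -
  have row: "X1 (\<lambda>j. p * star c i j + q * sc c i j) = of_bool (i = c) * (p^2 * tri c) + 2 * (p * q) * (\<Sum>l\<in>V. sc c i l * (ad c i * ad c l)) + q^2 * X1 (sc c i)"
    if i: "i \<in> V" for i
  proof (cases "i = c")
    case True
    have e: "p * star c c j + q * sc c c j = p * ad c j" for j by (simp add: star_def)
    show ?thesis unfolding True e X1_scale by (simp add: tri_def X1_def[of "sc c c"])
  next
    case False
    have e: "p * star c i j + q * sc c i j = (p * ad c i) * of_bool (j = c) + q * sc c i j" for j
      using False by (simp add: star_def)
    have z0: "X1 (\<lambda>j. of_bool (j = c)) = 0"
      unfolding X1_def by (rule sum.neutral, rule ballI, rule sum.neutral) auto
    have cr: "(\<Sum>j\<in>V. \<Sum>k\<in>V. (p * ad c i) * of_bool (j = c) * (ad j k * (q * sc c i k))) = (p * q) * (\<Sum>l\<in>V. sc c i l * (ad c i * ad c l))"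
    proof -
      have "(\<Sum>j\<in>V. \<Sum>k\<in>V. (p * ad c i) * of_bool (j = c) * (ad j k * (q * sc c i k))) = (\<Sum>j\<in>V. of_bool (j = c) * (\<Sum>k\<in>V. (p * ad c i) * (ad j k * (q * sc c i k))))"
        unfolding sum_distrib_left by (intro sum.cong refl) (simp only: ac_simps)
      also have "\<dots> = (\<Sum>k\<in>V. (p * ad c i) * (ad c k * (q * sc c i k)))" by (rule sum_delta_bool(4)[OF c])
      also have "\<dots> = (p * q) * (\<Sum>l\<in>V. sc c i l * (ad c i * ad c l))"
        unfolding sum_distrib_left by (intro sum.cong refl) (simp only: ac_simps)
      finally show ?thesis .
    qed
    show ?thesis unfolding e X1_add X1_scale z0 cr using False by simp
  qed
  have "X4 (\<lambda>i j. p * star c i j + q * sc c i j) = (\<Sum>i\<in>V. of_bool (i = c) * (p^2 * tri c) + 2 * (p * q) * (\<Sum>l\<in>V. sc c i l * (ad c i * ad c l)) + q^2 * X1 (sc c i))"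
    unfolding X4_X1 by (intro sum.cong refl row)
  also have "\<dots> = (\<Sum>i\<in>V. of_bool (i = c) * (p^2 * tri c)) + 2 * (p * q) * (\<Sum>i\<in>V. \<Sum>l\<in>V. sc c i l * (ad c i * ad c l)) + q^2 * X4 (sc c)"
    unfolding X4_X1 by (simp only: sum.distrib sum_distrib_left[symmetric])
  finally show ?thesis unfolding sum_ad_sc[OF c] sum_delta_bool(4)[OF c] .
qed

text \<open>Two edges through \<open>c\<close> are never disjoint, so there is no \<open>p^2\<close>
  term. The 4 arises because \<open>star c\<close> lists each edge twice and either factor may be
  the star.\<close>

lemma K4_test:
  assumes c: "c \<in> V"
  shows "K4 (\<lambda>i j. p * star c i j + q * sc c i j) = 4 * (p * q) * k4 c + q^2 * K4 (sc c)"
proof -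
  let ?f = "\<lambda>i j k l. ad i k * ad i l * ad j k * ad j l"
  let ?M = "\<Sum>(i, j, k, l)\<in>VVVV. star c i j * sc c k l * ?f i j k l"
  have z: "star c i j * star c k l * ?f i j k l = 0" for i j k l by (auto simp: star_def)
  have "K4 (\<lambda>i j. p * star c i j + q * sc c i j) = (\<Sum>(i, j, k, l)\<in>VVVV. (p * q) * (star c i j * sc c k l * ?f i j k l)
      + (p * q) * (star c k l * sc c i j * ?f k l i j) + q^2 * (sc c i j * sc c k l * ?f i j k l))"
    unfolding K4_def T4_def
  proof (rule sum.cong[OF refl], clarify)
    fix i j k l
    have fs: "?f k l i j = ?f i j k l"
      unfolding ad_sym[of k i] ad_sym[of k j] ad_sym[of l i] ad_sym[of l j] by (simp only: ac_simps)
    have "(p * star c i j + q * sc c i j) * (p * star c k l + q * sc c k l) * ?f i j k l = p^2 * (star c i j * star c k l * ?f i j k l)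
       + (p * q) * (star c i j * sc c k l * ?f i j k l) + (p * q) * (star c k l * sc c i j * ?f i j k l) + q^2 * (sc c i j * sc c k l * ?f i j k l)"
      by (simp add: algebra_simps power2_eq_square)
    then show "(p * star c i j + q * sc c i j) * (p * star c k l + q * sc c k l) * ?f i j k l = (p * q) * (star c i j * sc c k l * ?f i j k l)
      + (p * q) * (star c k l * sc c i j * ?f k l i j) + q^2 * (sc c i j * sc c k l * ?f i j k l)"
      unfolding z fs by (simp only: mult_zero_right add_0_left)
  qed
  also have "\<dots> = (p * q) * ?M + (p * q) * (\<Sum>(i, j, k, l)\<in>VVVV. star c k l * sc c i j * ?f k l i j) + q^2 * K4 (sc c)"
    unfolding K4_def T4_def by (simp add: case_prod_unfold sum.distrib sum_distrib_left)
  also have "(\<Sum>(i, j, k, l)\<in>VVVV. star c k l * sc c i j * ?f k l i j) = ?M"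
    by (rule sum.reindex_bij_witness[where i = "\<lambda>(i, j, k, l). (k, l, i, j)" and j = "\<lambda>(i, j, k, l). (k, l, i, j)"]) auto
  also have "?M = 2 * k4 c"
  proof -
    have "?M = (\<Sum>i\<in>V. \<Sum>j\<in>V. star c i j * (\<Sum>k\<in>V. \<Sum>l\<in>V. sc c k l * ?f i j k l))"
      unfolding sum_tuple4 by (simp add: sum_distrib_left mult.assoc)
    also have "\<dots> = (\<Sum>j\<in>V. ad c j * (\<Sum>k\<in>V. \<Sum>l\<in>V. sc c k l * ?f c j k l)) + (\<Sum>j\<in>V. ad c j * (\<Sum>k\<in>V. \<Sum>l\<in>V. sc c k l * ?f j c k l))"
      by (rule sum_double_star[OF c])
    also have "\<dots> = (\<Sum>j\<in>V. ad c j * X1 (\<lambda>k. ad c k * ad j k)) + (\<Sum>j\<in>V. ad c j * X1 (\<lambda>k. ad c k * ad j k))"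
    proof -
      have t: "sc c k l * (ad c k * ad c l) = ad k l * (ad c k * ad c l)" if "k \<in> V" "l \<in> V" for k l
        using ad_S[OF c that(1)] ad_S[OF c that(2)] by (auto simp: sc_def)
      have g: "sc c k l * ?f c j k l = (ad c k * ad j k) * (ad k l * (ad c l * ad j l))"
        "sc c k l * ?f j c k l = (ad c k * ad j k) * (ad k l * (ad c l * ad j l))" if "k \<in> V" "l \<in> V" for j k l
      proof -
        have "sc c k l * ?f c j k l = (sc c k l * (ad c k * ad c l)) * (ad j k * ad j l)"
          "sc c k l * ?f j c k l = (sc c k l * (ad c k * ad c l)) * (ad j k * ad j l)" by (simp_all only: ac_simps)
        then show "sc c k l * ?f c j k l = (ad c k * ad j k) * (ad k l * (ad c l * ad j l))"
          "sc c k l * ?f j c k l = (ad c k * ad j k) * (ad k l * (ad c l * ad j l))"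
          unfolding t[OF that] by (simp_all only: ac_simps)
      qed
      have "(\<Sum>k\<in>V. \<Sum>l\<in>V. sc c k l * ?f c j k l) = X1 (\<lambda>k. ad c k * ad j k)"
        "(\<Sum>k\<in>V. \<Sum>l\<in>V. sc c k l * ?f j c k l) = X1 (\<lambda>k. ad c k * ad j k)" for j
        unfolding X1_def by (intro sum.cong refl g, assumption, assumption)+
      then show ?thesis by (simp only:)
    qed
    finally show ?thesis by (simp add: k4_def)
  qed
  finally show ?thesis by simp
qed

text \<open>The value of the form at \<open>sc c\<close> alone, that is, the cost of the test;
  \<open>Wt_le\<close> bounds it through the cancellation in \<open>sc c\<close>.\<close>

definition Wt :: "real \<Rightarrow> real \<Rightarrow> real \<Rightarrow> 'v \<Rightarrow> real" where
  "Wt a2 a3 a4 c = a2 / 2 * sq2 (sc c) + a3 * X4 (sc c) + a4 / 4 * K4 (sc c)"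

lemma MQ_test:
  assumes c: "c \<in> V"
  shows "MQ (a1, a2, a3, a4) 0 (\<lambda>i. x * of_bool (i = c)) (\<lambda>i j. p * star c i j + q * sc c i j) =
    a1 * x^2 + 2 * a2 * ((n - 1) / 2) * (x * p) + a3 * tri c * (x * q) + p^2 * (a2 * ((n - 1) / 2) + a3 * tri c)
    + q^2 * Wt a2 a3 a4 c + (p * q) * (2 * a3 * tri c + a4 * k4 c)"
proof -
  let ?y = "\<lambda>i. x * of_bool (i = c)" and ?Y = "\<lambda>i j. p * star c i j + q * sc c i j"
  have s1: "sq ?y = x^2"
  proof -
    have "sq ?y = (\<Sum>i\<in>V. x^2 * of_bool (i = c))" unfolding sq_def by (intro sum.cong refl) auto
    then show ?thesis by (simp only: sum_delta_bool(3)[OF c])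
  qed
  have s2: "X1 ?y = 0"
    unfolding X1_def by (rule sum.neutral, rule ballI, rule sum.neutral) auto
  have s3: "X2 ?y ?Y = x * (p * ((n - 1) / 2))"
  proof -
    have "X2 ?y ?Y = (\<Sum>i\<in>V. of_bool (i = c) * (x * dg ?Y i))" unfolding X2_def by (intro sum.cong refl) (simp only: ac_simps)
    also have "\<dots> = x * dg ?Y c" by (rule sum_delta_bool(4)[OF c])
    also have "dg ?Y c = p * dg (star c) c" unfolding dg_def by (simp add: sum_distrib_left)
    finally show ?thesis by (simp only: dg_star[OF c])
  qed
  have s4: "X3 ?y ?Y = x * (q * tri c)"
  proof -
    have "X3 ?y ?Y = (\<Sum>i\<in>V. of_bool (i = c) * (\<Sum>k\<in>V. \<Sum>l\<in>V. x * (?Y k l * (ad i k * ad i l))))"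
      unfolding X3_def sum_distrib_left by (intro sum.cong refl) (simp only: ac_simps)
    also have "\<dots> = (\<Sum>k\<in>V. \<Sum>l\<in>V. x * (?Y k l * (ad c k * ad c l)))" by (rule sum_delta_bool(4)[OF c])
    also have "\<dots> = (\<Sum>k\<in>V. \<Sum>l\<in>V. x * (q * (sc c k l * (ad c k * ad c l))))"
    proof (intro sum.cong refl)
      fix k l
      have "star c k l * (ad c k * ad c l) = 0" by (auto simp: star_def)
      then show "x * (?Y k l * (ad c k * ad c l)) = x * (q * (sc c k l * (ad c k * ad c l)))" by (simp add: distrib_right)
    qed
    also have "\<dots> = x * (q * (\<Sum>k\<in>V. \<Sum>l\<in>V. sc c k l * (ad c k * ad c l)))" by (simp only: sum_distrib_left)
    finally show ?thesis by (simp only: sum_ad_sc[OF c])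
  qed
  show ?thesis
    unfolding MQ_def prod.case s1 s2 s3 s4 sq2_test[OF c] X4_test[OF c] K4_test[OF c] Wt_def
    by (simp add: field_simps)
qed

end

text \<open>Here \<open>x\<close> is the number of vertices, \<open>s\<close> its square root,
  \<open>g\<close> the degree and \<open>m\<close> the number of common neighbours of two adjacent
  vertices. The right-hand sides are twice the lower bounds of \<open>X1_01_ge\<close>; the factor
  31 comes from \<open>31^2 \<le> 1000\<close>.\<close>

lemma degree_estimates:
  fixes x s :: real
  assumes x: "x \<ge> 1000" and s: "31 * s \<le> x"
  shows "2 * g = x - 1 \<Longrightarrow> x^2 / 8 \<le> g^2 - g - s * g"
    and "4 * m = x - 5 \<Longrightarrow> 6 / 125 * x^2 \<le> m^2 - m - s * m"
proof -
  show "x^2 / 8 \<le> g^2 - g - s * g" if g: "2 * g = x - 1"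
  proof -
    have "49 / 100 * x \<le> g" "3 / 10 * x \<le> g - 1 - s" using x s g by simp_all
    then have *: "(49 / 100 * x) * (3 / 10 * x) \<le> g * (g - 1 - s)" using x by (intro mult_mono) simp_all
    have "x^2 / 8 \<le> 147 / 1000 * x^2" by simp
    also have "\<dots> = (49 / 100 * x) * (3 / 10 * x)" by (simp add: power2_eq_square)
    also note *
    also have "g * (g - 1 - s) = g^2 - g - s * g" by (simp add: power2_eq_square algebra_simps)
    finally show ?thesis .
  qed
  show "6 / 125 * x^2 \<le> m^2 - m - s * m" if m: "4 * m = x - 5"
  proof -
    have "24 / 100 * x \<le> m" "2 / 10 * x \<le> m - 1 - s" using x s m by simp_all
    then have *: "(24 / 100 * x) * (2 / 10 * x) \<le> m * (m - 1 - s)" using x by (intro mult_mono) simp_all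
    have "6 / 125 * x^2 = (24 / 100 * x) * (2 / 10 * x)" by (simp add: power2_eq_square)
    also note *
    also have "m * (m - 1 - s) = m^2 - m - s * m" by (simp add: power2_eq_square algebra_simps)
    finally show ?thesis .
  qed
qed

text \<open>Up to constants, \<open>t1\<close> gives \<open>a1^2 \<le> a2\<close>, \<open>d2\<close>
  gives \<open>a2^2 \<le> a1 a3\<close>, and \<open>d3\<close> gives
  \<open>a3^2 n^2 \<le> a1 w\<close> with \<open>W \<le> n^2 w\<close>. From \<open>d4\<close>
  follows a bound on \<open>a4\<close>, and with it \<open>w \<le> a2 + G e\<close> for
  \<open>e = a3 sqrt n\<close>. If \<open>a2\<close> dominates, these combine to
  \<open>a1^3 n^2 = O(1)\<close>; if \<open>G e\<close> does, to
  \<open>a1^2 n^2 = O(sqrt n)\<close>. The assumption \<open>N\<close> makes the lower-order terms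
  of \<open>t1\<close> and \<open>d2\<close> negligible.\<close>

lemma moment_inequalities_bound:
  fixes n a1 a2 a3 a4 g T F W L r :: real
  assumes n: "n \<ge> 1000" and N: "n * a1 > 64" and g_def: "g = (n - 1) / 2"
    and T: "n^2 / 16 \<le> T" "T \<le> g^2" and F: "n^3 / 400 \<le> F"
    and t1: "a1^2 * n^2 \<le> a1 * n + a2 / 2 * (n^2 - n)"
    and d2: "(2 * a2 * g)^2 \<le> 4 * a1 * (a2 * g + a3 * T)"
    and d3: "(a3 * T)^2 \<le> 4 * a1 * W"
    and d4: "(2 * a3 * T + a4 * F)^2 \<le> 4 * (a2 * g + a3 * T) * W"
    and W': "a2 \<ge> 0 \<Longrightarrow> a3 \<ge> 0 \<Longrightarrow> W \<le> n^2 * (a2 / 2 + 2 * (a3 * sqrt n) + L * (\<bar>a4\<bar> * r))"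
    and L: "L \<ge> 0" and r: "r \<ge> 0" and R2: "r^2 = n^2 * sqrt n"
  defines "G \<equiv> 5 + (L * 1200)^2"
  shows "(n * a1)^3 \<le> 8192 * n \<or> (n * a1)^2 \<le> 4096 * G * sqrt n"
proof -
  define e where "e = a3 * sqrt n"
  define v where "v = L * (\<bar>a4\<bar> * r)"
  define w where "w = a2 / 2 + 2 * e + v"
  have n0 [simp]: "0 \<le> n" "0 < n" using n by auto
  have Tpos: "T > 0"
  proof -
    have "0 < n^2 / 16" using n by simp
    then show ?thesis using T(1) by linarith
  qed
  have g: "n / 4 \<le> g" "g \<le> n / 2" using n by (simp_all add: g_def field_simps)
  have g2: "g^2 \<le> n^2 / 4" using power_mono[OF g(2), of 2] n g by (simp add: power_divide)
  have a1: "a1 > 0"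
  proof -
    have "n * a1 > 0" using N by linarith
    then show ?thesis using n by (simp add: zero_less_mult_iff)
  qed
  have a2: "a2 \<ge> a1^2"
  proof -
    have "64 * (n * a1) \<le> (n * a1) * (n * a1)" using N by (intro mult_right_mono) auto
    then have 1: "a1 * n \<le> a1^2 * n^2 / 64" by (simp add: power2_eq_square field_simps)
    have 2: "a1^2 * n^2 \<le> a1 * n + a2 / 2 * (n^2 - n)" by (rule t1)
    have p: "0 < a1^2 * n^2" using a1 n by simp
    then have "0 < a2 / 2 * (n^2 - n)" using 1 2 by linarith
    moreover have nn: "n^2 - n > 0" using n by (simp add: power2_eq_square)
    ultimately have a2p: "a2 > 0" by (simp add: zero_less_mult_iff)
    have "a2 / 2 * (n^2 - n) \<le> a2 / 2 * n^2" using a2p by (intro mult_left_mono) auto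
    then have "a1^2 * n^2 \<le> a2 * n^2" using 1 2 p by linarith
    then show ?thesis using n by simp
  qed
  have a2p: "a2 > 0" using a2 a1 zero_less_power[of a1 2] by linarith
  have a3: "a2^2 \<le> 2 * a1 * a3"
  proof -
    have "2 * a1 \<le> a2 * g"
    proof -
      have "2 * a1 \<le> a1 * (a1 * n / 4)" using mult_left_mono[of 2 "a1 * n / 4" a1] N a1 by (simp add: mult.commute)
      also have "\<dots> = a1^2 * (n / 4)" by (simp add: power2_eq_square)
      also have "\<dots> \<le> a2 * g" using a2 g a2p n by (intro mult_mono) auto
      finally show ?thesis .
    qed
    then have "2 * a1 * (a2 * g) \<le> (a2 * g) * (a2 * g)" using a2p g n by (intro mult_right_mono) auto
    moreover have "(a2 * g)^2 \<le> a1 * (a2 * g) + a1 * (a3 * T)"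
      using d2 by (simp add: power2_eq_square algebra_simps)
    ultimately have 1: "(a2 * g)^2 \<le> 2 * (a1 * (a3 * T))" by (simp add: power2_eq_square)
    have gp: "g > 0" using g n by linarith
    then have "0 < (a2 * g)^2" using a2p by simp
    then have "0 < a1 * (a3 * T)" using 1 by linarith
    then have "0 < a3 * T" using a1 by (simp add: zero_less_mult_iff)
    moreover have "T > 0" using Tpos .
    ultimately have "a3 > 0" by (simp add: zero_less_mult_iff)
    then have "a1 * (a3 * T) \<le> a1 * (a3 * g^2)" using T(2) a1 by (intro mult_left_mono) auto
    then have "a2^2 * g^2 \<le> (2 * a1 * a3) * g^2" using 1 by (simp add: power_mult_distrib)
    then show ?thesis using gp by simp
  qed
  have a3p: "a3 > 0"
  proof -
    have "0 < a2^2" using a2p by simp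
    then have "0 < a1 * a3" using a3 unfolding mult.assoc by linarith
    then show ?thesis using a1 by (simp add: zero_less_mult_iff)
  qed
  have e0: "e \<ge> 0" using a3p by (simp add: e_def)
  have v0: "v \<ge> 0" using L r by (simp add: v_def)
  have w0: "w \<ge> 0" using e0 v0 a2p by (simp add: w_def)
  have W: "W \<le> n^2 * w"
    unfolding w_def v_def e_def using a2p a3p by (intro W') auto
  have i: "a3^2 * n^2 \<le> 1024 * a1 * w"
  proof -
    have "(a3 * (n^2 / 16))^2 \<le> (a3 * T)^2" using T a3p by (intro power_mono mult_left_mono) auto
    also have "\<dots> \<le> 4 * a1 * W" by (rule d3)
    also have "\<dots> \<le> 4 * a1 * (n^2 * w)" using W a1 by (intro mult_left_mono) auto
    finally have "(a3^2 * n^2) * n^2 \<le> (1024 * a1 * w) * n^2" by (simp add: power2_eq_square field_simps)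
    then show ?thesis using n by simp
  qed
  have a23: "a2 * g \<le> a3 * T"
  proof -
    have "a1 * (a2 * g) \<le> a1 * (a2 * (n / 2))" using g a1 a2p by (intro mult_left_mono) auto
    also have "\<dots> = a2 * (n / 2) * a1" by simp
    also have "\<dots> \<le> a2 * (n / 2) * (a1 * (n * a1 / 64))" using N a1 a2p n by (intro mult_left_mono) auto
    also have "\<dots> \<le> a2 * (a1^2 * (n^2 / 32))" using a1 a2p n by (simp add: power2_eq_square field_simps)
    also have "\<dots> \<le> a2 * (a2 * (n^2 / 32))" using a2 a2p by (intro mult_left_mono mult_right_mono) auto
    also have "\<dots> = a2^2 * (n^2 / 32)" by (simp add: power2_eq_square)
    also have "\<dots> \<le> (2 * a1 * a3) * (n^2 / 32)" using a3 by (intro mult_right_mono) auto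
    also have "\<dots> = a1 * (a3 * (n^2 / 16))" by simp
    also have "\<dots> \<le> a1 * (a3 * T)" using T a1 a3p by (intro mult_left_mono) auto
    finally show ?thesis using a1 by simp
  qed
  have ii: "(2 * a3 * T + a4 * F)^2 \<le> 2 * (a3 * w) * n^4"
  proof -
    have Tp: "0 \<le> a3 * T" using a3p Tpos by simp
    have gp: "0 \<le> a2 * g" using a2p g n by auto
    have "(2 * a3 * T + a4 * F)^2 \<le> 4 * (a2 * g + a3 * T) * W" by (rule d4)
    also have "\<dots> \<le> 4 * (a2 * g + a3 * T) * (n^2 * w)" using W Tp gp by (intro mult_left_mono) auto
    also have "\<dots> \<le> 4 * (2 * (a3 * T)) * (n^2 * w)"
    proof (rule mult_right_mono)
      have "4 * (x + y) \<le> 4 * (2 * y)" if "x \<le> y" for x y :: real using that by simp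
      from this[OF a23] show "4 * (a2 * g + a3 * T) \<le> 4 * (2 * (a3 * T))" .
    qed (use w0 in simp)
    also have "\<dots> \<le> 4 * (2 * (a3 * (n^2 / 4))) * (n^2 * w)" using T g2 a3p w0 by (intro mult_right_mono mult_left_mono) auto
    also have "\<dots> = 2 * (a3 * w) * n^4" by (simp add: power4_eq_xxxx power2_eq_square)
    finally show ?thesis .
  qed
  \<comment> \<open>Either \<open>a4 F\<close> is at most of the order of \<open>a3 T\<close>, so
    that \<open>a4\<close> is \<open>O(a3 / n)\<close>, or it outweighs \<open>2 a3 T\<close> and
    \<open>ii\<close> bounds \<open>a4^2\<close>. The two cases need the constants
    \<open>400^2\<close> and 1280000, both below \<open>1200^2\<close>.\<close>
  have aR: "(\<bar>a4\<bar> * r)^2 \<le> 1200^2 * (e * (e + w))"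
  proof (cases "\<bar>a4\<bar> * F \<le> 4 * (a3 * T)")
    case True
    have "\<bar>a4\<bar> * (n^3 / 400) \<le> \<bar>a4\<bar> * F" using F by (intro mult_left_mono) auto
    also have "\<dots> \<le> 4 * (a3 * T)" by (rule True)
    also have "\<dots> \<le> 4 * (a3 * (n^2 / 4))" using T g2 a3p by (intro mult_left_mono) auto
    finally have "(\<bar>a4\<bar> * n) * n^2 \<le> (400 * a3) * n^2" by (simp add: power2_eq_square power3_eq_cube field_simps)
    then have 1: "\<bar>a4\<bar> * n \<le> 400 * a3" using n by simp
    have "(\<bar>a4\<bar> * r)^2 = (\<bar>a4\<bar> * n)^2 * sqrt n" by (simp add: power_mult_distrib R2)
    also have "\<dots> \<le> (400 * a3)^2 * sqrt n" using 1 by (intro mult_right_mono power_mono) auto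
    also have "\<dots> \<le> (400 * a3)^2 * n" using n real_sqrt_le_mono[of n "n^2"] by (intro mult_left_mono) (auto simp: power2_eq_square)
    also have "\<dots> = 400^2 * (e * e)" by (simp add: e_def power2_eq_square)
    also have "\<dots> \<le> 1200^2 * (e * (e + w))" using e0 w0 by (intro mult_mono mult_left_mono) auto
    finally show ?thesis .
  next
    case False
    have "\<bar>a4\<bar> * F / 2 \<le> \<bar>2 * a3 * T + a4 * F\<bar>"
    proof -
      have "0 \<le> n^3 / 400" using n by simp
      then have "F \<ge> 0" using F by linarith
      then have "\<bar>a4 * F\<bar> = \<bar>a4\<bar> * F" by (simp add: abs_mult)
      moreover have "\<bar>a4 * F\<bar> \<le> \<bar>2 * a3 * T + a4 * F\<bar> + \<bar>2 * a3 * T\<bar>" by linarith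
      moreover have "\<bar>2 * a3 * T\<bar> = 2 * (a3 * T)"
        using a3p Tpos by (simp add: abs_mult)
      ultimately show ?thesis using False by linarith
    qed
    moreover have "\<bar>a4\<bar> * (n^3 / 400) / 2 \<le> \<bar>a4\<bar> * F / 2" using F by (intro divide_right_mono mult_left_mono) auto
    ultimately have "(\<bar>a4\<bar> * (n^3 / 400) / 2)^2 \<le> \<bar>2 * a3 * T + a4 * F\<bar>^2" using n by (intro power_mono) auto
    also have "\<dots> \<le> 2 * (a3 * w) * n^4" using ii by simp
    finally have "(\<bar>a4\<bar> * n)^2 * n^4 \<le> (1280000 * (a3 * w)) * n^4"
      by (simp add: power_mult_distrib power_divide field_simps flip: power_mult power_add)
    then have 1: "(\<bar>a4\<bar> * n)^2 \<le> 1280000 * (a3 * w)" using n by simp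
    have "(\<bar>a4\<bar> * r)^2 = (\<bar>a4\<bar> * n)^2 * sqrt n" by (simp add: power_mult_distrib R2)
    also have "\<dots> \<le> 1280000 * (a3 * w) * sqrt n" using 1 by (intro mult_right_mono) auto
    also have "\<dots> = 1280000 * (e * w)" by (simp add: e_def)
    also have "\<dots> \<le> 1200^2 * (e * (e + w))" using e0 w0 by (intro mult_mono mult_left_mono) auto
    finally show ?thesis .
  qed
  \<comment> \<open>By \<open>aR\<close>, \<open>v\<close> is at most the geometric mean of
    \<open>x\<close> and \<open>e + w\<close>. Their arithmetic mean contains only half of
    \<open>w\<close>, which is absorbed into the left side.\<close>
  have wle: "w \<le> a2 + G * e"
  proof -
    define x where "x = (L * 1200)^2 * e"
    have x0: "x \<ge> 0" using e0 by (simp add: x_def)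
    have "v^2 = L^2 * (\<bar>a4\<bar> * r)^2" by (simp add: v_def power_mult_distrib)
    also have "\<dots> \<le> L^2 * (1200^2 * (e * (e + w)))" by (intro mult_left_mono aR) simp
    also have "\<dots> = x * (e + w)" by (simp add: x_def power_mult_distrib)
    also have "\<dots> \<le> ((x + (e + w)) / 2)^2" using sum_squares_bound[of x "e + w"] by (simp add: power2_eq_square field_simps)
    finally have "v^2 \<le> ((x + (e + w)) / 2)^2" .
    then have "v \<le> (x + (e + w)) / 2" by (rule power2_le_imp_le) (use x0 e0 w0 in simp)
    then have "2 * v \<le> x + e + w" by simp
    then have "w \<le> a2 + (5 * e + x)" using w_def e0 by linarith
    also have "5 * e + x = G * e" by (simp add: G_def x_def distrib_right)
    finally show ?thesis .
  qed
  have iii: "a3^2 * n^2 \<le> 1024 * a1 * (a2 + G * e)"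
    by (rule order_trans[OF i]) (use wle a1 in \<open>intro mult_left_mono, auto\<close>)
  show ?thesis
  proof (cases "G * e \<le> a2")
    case True
    have "1024 * a1 * (a2 + G * e) \<le> 1024 * a1 * (2 * a2)" using True a1 by (intro mult_left_mono) auto
    then have 1: "a3^2 * n^2 \<le> 2048 * (a1 * a2)" using iii by simp
    have "(a2^2)^2 * n^2 \<le> (2 * a1 * a3)^2 * n^2" using a3 by (intro mult_right_mono power_mono) auto
    also have "\<dots> = 4 * a1^2 * (a3^2 * n^2)" by (simp add: power_mult_distrib)
    also have "\<dots> \<le> 4 * a1^2 * (2048 * (a1 * a2))" using 1 by (intro mult_left_mono) auto
    finally have "a2 * (a2^3 * n^2) \<le> a2 * (8192 * a1^3)" by (simp add: power2_eq_square power3_eq_cube ac_simps)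
    then have "a2^3 * n^2 \<le> 8192 * a1^3" using a2p by simp
    moreover have "(a1^2)^3 * n^2 \<le> a2^3 * n^2" using a2 by (intro mult_right_mono power_mono) auto
    ultimately have "(a1^2)^3 * n^2 \<le> 8192 * a1^3" by (rule order_trans[rotated])
    then have "a1^3 * (a1^3 * n^2) \<le> a1^3 * 8192" by (simp add: power2_eq_square power3_eq_cube ac_simps)
    then have "a1^3 * n^2 \<le> 8192" by (rule mult_left_le_imp_le) (use a1 in simp)
    then have "n * (a1^3 * n^2) \<le> n * 8192" using n by (intro mult_left_mono) auto
    then have "(n * a1)^3 \<le> 8192 * n" by (simp add: power_mult_distrib power2_eq_square power3_eq_cube ac_simps)
    then show ?thesis ..
  next
    case False
    have "1024 * a1 * (a2 + G * e) \<le> 1024 * a1 * (2 * (G * e))" using False a1 by (intro mult_left_mono) auto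
    then have "a3 * (a3 * n^2) \<le> a3 * (2048 * a1 * G * sqrt n)" using iii by (simp add: e_def power2_eq_square ac_simps)
    then have 1: "a3 * n^2 \<le> 2048 * a1 * G * sqrt n" using a3p by (rule mult_left_le_imp_le)
    have "(a1^2)^2 * n^2 \<le> a2^2 * n^2" using a2 by (intro mult_right_mono power_mono) auto
    also have "\<dots> \<le> (2 * a1 * a3) * n^2" using a3 by (intro mult_right_mono) auto
    also have "\<dots> = 2 * a1 * (a3 * n^2)" by simp
    also have "\<dots> \<le> 2 * a1 * (2048 * a1 * G * sqrt n)" using 1 a1 by (intro mult_left_mono) auto
    finally have "a1^2 * (a1^2 * n^2) \<le> a1^2 * (4096 * G * sqrt n)" by (simp add: power2_eq_square ac_simps)
    then have "a1^2 * n^2 \<le> 4096 * G * sqrt n" by (rule mult_left_le_imp_le) (use a1 in simp)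
    then have "(n * a1)^2 \<le> 4096 * G * sqrt n" by (simp add: power_mult_distrib mult.commute)
    then show ?thesis ..
  qed
qed


section \<open>Clique counts and norms at a vertex\<close>

context conference
begin

text \<open>For an indicator, \<open>X1 u\<close> is twice the number of edges inside its support.
  As in the expander mixing lemma, \<open>SB_le\<close> bounds the deviation from density one
  half.\<close>

lemma X1_01_ge:
  assumes u: "\<And>i. i \<in> V \<Longrightarrow> u i = 0 \<or> u i = 1" and m: "(\<Sum>i\<in>V. u i) = m"
  shows "X1 u \<ge> (m^2 - m - sqrt n * m) / 2"
proof -
  have "sq u = m" unfolding sq_def m[symmetric] using u by (intro sum.cong refl) fastforce
  moreover have "m \<ge> 0" unfolding m[symmetric] using u by (intro sum_nonneg) fastforce
  moreover have "\<bar>SB u u\<bar> \<le> sqrt n * sqrt (sq u) * sqrt (sq u)" by (rule SB_le)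
  ultimately have "\<bar>SB u u\<bar> \<le> sqrt n * m" by (simp add: mult.assoc)
  then have "m^2 - m - sqrt n * m \<le> m^2 - m + SB u u" by linarith
  then show ?thesis unfolding X1_eq m \<open>sq u = m\<close> by (rule divide_right_mono) simp
qed

text \<open>Expanding both adjacencies in signs leaves row sums, which vanish, and one off-diagonal
  entry of \<open>S^2\<close>. The number 5 collects this entry and the corrections at
  \<open>k = c\<close> and \<open>k = j\<close>.\<close>

lemma codegree:
  assumes V: "c \<in> V" "j \<in> V" and e: "S c j = 1"
  shows "(\<Sum>k\<in>V. ad c k * ad j k) = (n - 5) / 4"
proof -
  have cj: "c \<noteq> j" using e S_diag by auto
  have pt: "ad c k * ad j k = (1 + S c k + S j k + S c k * S j k - of_bool (c = k) * (1 + S j k) - of_bool (j = k) * (1 + S c k)) / 4" for k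
    using cj by (cases "c = k"; cases "j = k") (auto simp: ad_def S_diag field_simps)
  have "(\<Sum>k\<in>V. ad c k * ad j k) = ((\<Sum>k\<in>V. 1) + (\<Sum>k\<in>V. S c k) + (\<Sum>k\<in>V. S j k) + (\<Sum>k\<in>V. S c k * S j k)
      - (\<Sum>k\<in>V. of_bool (c = k) * (1 + S j k)) - (\<Sum>k\<in>V. of_bool (j = k) * (1 + S c k))) / 4"
    unfolding pt by (simp only: sum_divide_distrib[symmetric] sum.distrib sum_subtractf)
  also have "\<dots> = (n + 0 + 0 + (0 - 1) - (1 + S j c) - (1 + S c j)) / 4"
    unfolding S_row[OF V(1)] S_row[OF V(2)] S_orth[OF V] sum_delta_bool(2)[OF V(1)] sum_delta_bool(2)[OF V(2)]
    using cj by simp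
  finally show ?thesis using e S_sym[of j c] by simp
qed

lemma sqrt_n_le: "n \<ge> 1000 \<Longrightarrow> 31 * sqrt n \<le> n"
proof -
  assume "n \<ge> 1000"
  then have "31 * sqrt n \<le> sqrt n * sqrt n" by (intro mult_right_mono real_le_rsqrt) auto
  then show ?thesis by simp
qed

lemma tri_bounds:
  assumes c: "c \<in> V" and n: "n \<ge> 1000"
  shows "n^2 / 16 \<le> tri c" "tri c \<le> ((n - 1) / 2)^2"
proof -
  let ?g = "(n - 1) / 2"
  have "n^2 / 16 = n^2 / 8 / 2" by simp
  also have "\<dots> \<le> (?g^2 - ?g - sqrt n * ?g) / 2"
    by (intro divide_right_mono degree_estimates(1)[OF n sqrt_n_le[OF n]]) simp_all
  also have "\<dots> \<le> tri c"
    unfolding tri_def using ad_values[OF c] sum_ad[OF c] by (intro X1_01_ge) auto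
  finally show "n^2 / 16 \<le> tri c" .
  have "tri c \<le> (\<Sum>i\<in>V. \<Sum>k\<in>V. ad c i * ad c k)"
    unfolding tri_eq
  proof (intro sum_mono)
    fix i k assume "i \<in> V" "k \<in> V"
    then show "ad c i * (ad i k * ad c k) \<le> ad c i * ad c k"
      using ad_values[OF c, of i] ad_values[OF c, of k] ad_values[of i k] by auto
  qed
  also have "\<dots> = ?g^2" unfolding sum_ad[OF c, symmetric] power2_eq_square sum_product ..
  finally show "tri c \<le> ?g^2" .
qed

text \<open>The common neighbourhood of \<open>c\<close> and a neighbour \<open>j\<close> has
  \<open>(n - 5) / 4\<close> vertices, so by \<open>X1_01_ge\<close> it contains a positive
  proportion of its possible edges. Summing over the neighbours gives the order
  \<open>n^3\<close>.\<close>

lemma k4_ge: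
  assumes c: "c \<in> V" and n: "n \<ge> 1000"
  shows "n^3 / 400 \<le> k4 c"
proof -
  let ?m = "(n - 5) / 4"
  let ?h = "3 / 125 * n^2"
  have h: "?h \<le> (?m^2 - ?m - sqrt n * ?m) / 2"
  proof -
    have "6 / 125 * n^2 \<le> ?m^2 - ?m - sqrt n * ?m"
      by (rule degree_estimates(2)[OF n sqrt_n_le[OF n]]) simp
    then have "6 / 125 * n^2 / 2 \<le> (?m^2 - ?m - sqrt n * ?m) / 2" by (rule divide_right_mono) simp
    then show ?thesis by simp
  qed
  have "ad c j * ?h \<le> ad c j * X1 (\<lambda>k. ad c k * ad j k)" if j: "j \<in> V" for j
  proof (cases "S c j = 1")
    case True
    have "(?m^2 - ?m - sqrt n * ?m) / 2 \<le> X1 (\<lambda>k. ad c k * ad j k)"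
      using ad_values[OF c] ad_values[OF j] codegree[OF c j True] by (intro X1_01_ge) fastforce+
    from order_trans[OF h this] show ?thesis by (rule mult_left_mono) (use ad_values[OF c j] in auto)
  next
    case False
    then show ?thesis using c j by (simp add: ad_eq)
  qed
  then have *: "(\<Sum>j\<in>V. ad c j * ?h) \<le> k4 c" unfolding k4_def by (intro sum_mono)
  have "n^3 / 400 \<le> 6 / 1000 * n^3" by simp
  also have "\<dots> = n / 4 * ?h" by (simp add: power2_eq_square power3_eq_cube)
  also have "\<dots> \<le> (n - 1) / 2 * ?h" by (rule mult_right_mono) (use n in \<open>simp_all add: field_simps\<close>)
  also have "\<dots> = (\<Sum>j\<in>V. ad c j * ?h)" unfolding sum_ad[OF c, symmetric] by (rule sum_distrib_right)
  also note *
  finally show ?thesis .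
qed

lemma abs_sc_le: "c \<in> V \<Longrightarrow> i \<in> V \<Longrightarrow> j \<in> V \<Longrightarrow> \<bar>sc c i j\<bar> \<le> 1"
  unfolding sc_def abs_mult using S_abs[of c i] S_abs[of c j] ad_values[of i j]
  by (intro mult_le_one) auto

lemma sq2_sc_le:
  assumes "c \<in> V"
  shows "sq2 (sc c) \<le> n^2"
proof -
  have "sq2 (sc c) \<le> (\<Sum>i\<in>V. \<Sum>j\<in>V. 1)"
    unfolding sq2_def by (intro sum_mono) (use abs_sc_le[OF assms] in \<open>simp add: abs_square_le_1\<close>)
  then show ?thesis by (simp add: power2_eq_square)
qed

text \<open>By \<open>S_row\<close> and \<open>S_orth\<close> the row sum collapses to
  \<open>S c k * (- 1 - S c k) / 2\<close>, which is 0 or -1. This cancellation is the reason for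
  the signs in \<open>sc\<close>.\<close>

lemma dg_sc_le:
  assumes c: "c \<in> V" and k: "k \<in> V"
  shows "\<bar>dg (sc c) k\<bar> \<le> 1"
proof (cases "k = c")
  case True
  then show ?thesis by (simp add: dg_def)
next
  case False
  have "dg (sc c) k = (\<Sum>l\<in>V. S c k * (S c l + S k l * S c l - S c l * of_bool (k = l)) / 2)"
    unfolding dg_def sc_def ad_def by (intro sum.cong refl) (simp add: field_simps)
  also have "\<dots> = S c k * ((\<Sum>l\<in>V. S c l) + (\<Sum>l\<in>V. S k l * S c l) - (\<Sum>l\<in>V. S c l * of_bool (k = l))) / 2"
    by (simp only: sum_divide_distrib[symmetric] sum_distrib_left[symmetric] sum.distrib sum_subtractf)
  also have "\<dots> = S c k * (- 1 - S c k) / 2"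
    unfolding S_row[OF c] S_orth[OF k c] sum_delta_bool(1)[OF k] using False by simp
  finally show ?thesis using S_values[OF c k] False by auto
qed

lemma sq_dg_sc_le: "c \<in> V \<Longrightarrow> sq (dg (sc c)) \<le> n"
proof -
  assume c: "c \<in> V"
  have "sq (dg (sc c)) \<le> (\<Sum>i\<in>V. 1)"
    unfolding sq_def by (intro sum_mono) (use dg_sc_le[OF c] in \<open>simp add: abs_square_le_1\<close>)
  then show ?thesis by simp
qed

lemma X4_sc_le:
  assumes c: "c \<in> V" and n1: "n \<ge> 1"
  shows "\<bar>X4 (sc c)\<bar> \<le> 2 * (n^2 * sqrt n)"
proof -
  have "sqrt n \<ge> 1" using n1 by simp
  have b: "n \<le> n^2" "n^2 * 1 \<le> n^2 * sqrt n" using n1 \<open>sqrt n \<ge> 1\<close> by (auto simp: power2_eq_square intro!: mult_left_mono)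
  have "\<bar>\<Sum>i\<in>V. SB (sc c i) (sc c i)\<bar> \<le> sqrt n * sq2 (sc c)" by (rule sum_SB_le)
  also have "\<dots> \<le> sqrt n * n^2" by (intro mult_left_mono sq2_sc_le c) simp
  finally have "\<bar>\<Sum>i\<in>V. SB (sc c i) (sc c i)\<bar> \<le> n^2 * sqrt n" by (simp add: mult.commute)
  moreover have "sq (dg (sc c)) \<le> n^2 * sqrt n"
    using sq_dg_sc_le[OF c] b unfolding mult_1_right by (rule order_trans[OF _ order_trans])
  moreover have "sq2 (sc c) \<le> n^2 * sqrt n"
    using sq2_sc_le[OF c] b(2) unfolding mult_1_right by (rule order_trans)
  ultimately have "\<bar>sq (dg (sc c)) - sq2 (sc c) + (\<Sum>i\<in>V. SB (sc c i) (sc c i))\<bar> \<le> 4 * (n^2 * sqrt n)"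
    using sq_nonneg[of "dg (sc c)"] sq2_nonneg[of "sc c"] by linarith
  then show ?thesis unfolding X4_eq abs_divide by simp
qed

text \<open>With bounded degrees, the three explicit terms of \<open>K4_expansion\<close> are of
  order at most \<open>R n^2\<close>, the size of its remainder.\<close>

lemma K4_sc_le:
  assumes c: "c \<in> V" and n1: "n \<ge> 1"
  shows "\<bar>K4 (sc c)\<bar> \<le> (5 + K) * (R * n^2)"
proof -
  have s1: "sqrt n \<ge> 1" using n1 by simp
  have s2: "sqrt n \<le> n" using n1 real_sqrt_le_mono[of n "n^2"] by (simp add: power2_eq_square)
  have "n \<le> R" using powr_mono[of 1 "5/4" n] n1 by simp
  have R1: "R \<ge> 1" using \<open>n \<le> R\<close> n1 by linarith
  have b1: "n^2 \<le> R * n^2" using R1 by (simp add: mult_le_cancel_right1)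
  have d: "\<bar>\<Sum>i\<in>V. dg (sc c) i\<bar> \<le> n"
  proof -
    have "\<bar>\<Sum>i\<in>V. dg (sc c) i\<bar> \<le> (\<Sum>i\<in>V. 1)" by (intro order_trans[OF sum_abs] sum_mono dg_sc_le c)
    then show ?thesis by simp
  qed
  then have t1: "(\<Sum>i\<in>V. dg (sc c) i)^2 \<le> n^2" by (simp add: abs_le_square_iff[symmetric])
  have t2: "\<bar>SB (dg (sc c)) (dg (sc c))\<bar> \<le> n^2"
  proof -
    have "\<bar>SB (dg (sc c)) (dg (sc c))\<bar> \<le> sqrt n * sq (dg (sc c))" using SB_le[of "dg (sc c)" "dg (sc c)"] by (simp add: mult.assoc)
    also have "\<dots> \<le> n * n" using s2 sq_dg_sc_le[OF c] by (intro mult_mono) auto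
    finally show ?thesis by (simp add: power2_eq_square)
  qed
  have t3: "\<bar>\<Sum>i\<in>V. dg (sc c) i * wd (sc c) i\<bar> \<le> R * n^2"
  proof -
    have "\<bar>\<Sum>i\<in>V. dg (sc c) i * wd (sc c) i\<bar> \<le> n * sqrt (sq (dg (sc c))) * sqrt (sq2 (sc c))" by (rule wedge_le)
    also have "\<dots> \<le> n * sqrt n * sqrt (n^2)"
      using sq_dg_sc_le[OF c] sq2_sc_le[OF c] by (intro mult_mono real_sqrt_le_mono mult_nonneg_nonneg) auto
    also have "\<dots> = sqrt n * n^2" by (simp add: power2_eq_square)
    also have "\<dots> \<le> R * n^2" using s2 \<open>n \<le> R\<close> by (intro mult_right_mono) auto
    finally show ?thesis .
  qed
  have "edgefun (sc c)" using edgefun_test[OF c, of 0 1] by simp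
  then have "\<bar>16 * K4 (sc c) - ((\<Sum>i\<in>V. dg (sc c) i)^2 + 4 * SB (dg (sc c)) (dg (sc c)) + 4 * (\<Sum>i\<in>V. dg (sc c) i * wd (sc c) i))\<bar>
    \<le> (70 + K) * R * sq2 (sc c)" using n1 by (intro K4_expansion edgefunD) auto
  also have "\<dots> \<le> (70 + K) * R * n^2" using K_pos by (intro mult_left_mono sq2_sc_le c) auto
  also have "\<dots> = 70 * (R * n^2) + K * (R * n^2)" by (simp add: algebra_simps)
  \<comment> \<open>\<open>79 = 70 + 1 + 4 + 4\<close>, from the remainder and the bounds
    \<open>t1\<close>, \<open>t2\<close>, \<open>t3\<close>; a sixteenth of it is below 5.\<close>
  finally have "16 * \<bar>K4 (sc c)\<bar> \<le> 79 * (R * n^2) + K * (R * n^2)"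
    using t1 t2 t3 b1 zero_le_power2[of "\<Sum>i\<in>V. dg (sc c) i"] by linarith
  moreover have "0 \<le> K * (R * n^2)" "0 \<le> R * n^2" using K_pos by auto
  ultimately show ?thesis unfolding distrib_right by linarith
qed

lemma Wt_le:
  assumes c: "c \<in> V" and n1: "n \<ge> 1" and "a2 \<ge> 0" "a3 \<ge> 0"
  shows "Wt a2 a3 a4 c \<le> n^2 * (a2 / 2 + 2 * (a3 * sqrt n) + (5 + K) / 4 * (\<bar>a4\<bar> * R))"
proof -
  have "a2 / 2 * sq2 (sc c) \<le> a2 / 2 * n^2" using assms sq2_sc_le by (intro mult_left_mono) auto
  moreover have "a3 * X4 (sc c) \<le> a3 * (2 * (n^2 * sqrt n))"
    using X4_sc_le[OF c n1] assms by (intro mult_left_mono) auto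
  moreover have "a4 / 4 * K4 (sc c) \<le> \<bar>a4\<bar> / 4 * ((5 + K) * (R * n^2))"
  proof -
    have "a4 / 4 * K4 (sc c) \<le> \<bar>a4 / 4 * K4 (sc c)\<bar>" by (rule abs_ge_self)
    also have "\<dots> = \<bar>a4\<bar> / 4 * \<bar>K4 (sc c)\<bar>" by (simp add: abs_mult)
    also have "\<dots> \<le> \<bar>a4\<bar> / 4 * ((5 + K) * (R * n^2))" using K4_sc_le[OF c n1] by (intro mult_left_mono) auto
    finally show ?thesis .
  qed
  ultimately have "Wt a2 a3 a4 c \<le> a2 / 2 * n^2 + a3 * (2 * (n^2 * sqrt n)) + \<bar>a4\<bar> / 4 * ((5 + K) * (R * n^2))"
    unfolding Wt_def by linarith
  also have "\<dots> = n^2 * (a2 / 2 + 2 * (a3 * sqrt n) + (5 + K) / 4 * (\<bar>a4\<bar> * R))" by (simp add: algebra_simps)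
  finally show ?thesis .
qed

text \<open>Positivity on the square of \<open>\<Sum> x\<^sub>i - n a1\<close>: the variance of the
  clique size is nonnegative. The sign part vanishes because the rows of \<open>S\<close> sum to
  zero.\<close>

lemma first_two_moments_relation:
  assumes MQ: "\<And>y0 y Y. edgefun Y \<Longrightarrow> MQ (a1, a2, a3, a4) y0 y Y \<ge> 0"
  shows "a1^2 * n^2 \<le> a1 * n + a2 / 2 * (n^2 - n)"
proof -
  have 0: "edgefun (\<lambda>i j. 0)" by (simp add: edgefun_def)
  have SB1: "SB (\<lambda>i. 1) (\<lambda>i. 1) = 0"
    unfolding SB_def using S_row by simp
  have "MQ (a1, a2, a3, a4) (- (a1 * n)) (\<lambda>i. 1) (\<lambda>i j. 0) = (a2 / 2 - a1^2) * n^2 + (a1 - a2 / 2) * n"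
    unfolding MQ_expand[OF 0] SB1
    by (simp add: dg_def wd_def X2_def sq2_def sq_def SB_def K4_def T4_def)
  then have "(a2 / 2 - a1^2) * n^2 + (a1 - a2 / 2) * n \<ge> 0" using MQ[OF 0, of "- (a1 * n)" "\<lambda>i. 1"] by simp
  then show ?thesis by (simp add: algebra_simps)
qed

text \<open>\<open>MQ_test\<close> is a quadratic form in \<open>x\<close>, \<open>p\<close> and
  \<open>q\<close>. Setting \<open>q\<close>, \<open>p\<close> or \<open>x\<close> to zero leaves a
  nonnegative binary form, and its discriminant gives one inequality.\<close>

lemma test_discriminants:
  assumes MQ: "\<And>y0 y Y. edgefun Y \<Longrightarrow> MQ (a1, a2, a3, a4) y0 y Y \<ge> 0" and c: "c \<in> V"
  defines "g \<equiv> (n - 1) / 2"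
  shows "a1 \<ge> 0"
    and "(2 * a2 * g)^2 \<le> 4 * a1 * (a2 * g + a3 * tri c)"
    and "(a3 * tri c)^2 \<le> 4 * a1 * Wt a2 a3 a4 c"
    and "(2 * a3 * tri c + a4 * k4 c)^2 \<le> 4 * (a2 * g + a3 * tri c) * Wt a2 a3 a4 c"
proof -
  have f: "a1 * x^2 + 2 * a2 * g * (x * p) + a3 * tri c * (x * q) + p^2 * (a2 * g + a3 * tri c)
    + q^2 * Wt a2 a3 a4 c + (p * q) * (2 * a3 * tri c + a4 * k4 c) \<ge> 0" for x p q
    using MQ[OF edgefun_test[OF c, of p q], of 0 "\<lambda>i. x * of_bool (i = c)"] unfolding MQ_test[OF c] g_def .
  show "a1 \<ge> 0" using f[of 1 0 0] by simp
  show "(2 * a2 * g)^2 \<le> 4 * a1 * (a2 * g + a3 * tri c)"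
    by (rule discriminant_le) (use f[of _ _ 0] in \<open>simp add: mult.commute\<close>)
  show "(a3 * tri c)^2 \<le> 4 * a1 * Wt a2 a3 a4 c"
    by (rule discriminant_le) (use f[of _ 0 _] in \<open>simp add: mult.commute\<close>)
  show "(2 * a3 * tri c + a4 * k4 c)^2 \<le> 4 * (a2 * g + a3 * tri c) * Wt a2 a3 a4 c"
    by (rule discriminant_le) (use f[of 0 _ _] in \<open>simp add: ac_simps\<close>)
qed

definition Gc :: real where "Gc = 5 + ((5 + K) / 4 * 1200)^2"

lemma first_moment_le:
  assumes MQ: "\<And>y0 y Y. edgefun Y \<Longrightarrow> MQ (a1, a2, a3, a4) y0 y Y \<ge> 0" and n: "n \<ge> 1000" and N: "n * a1 > 64"
  shows "(n * a1)^3 \<le> 8192 * n \<or> (n * a1)^2 \<le> 4096 * Gc * sqrt n"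
proof -
  obtain c where c: "c \<in> V" using n by (cases "V = {}") auto
  have R2: "R^2 = n^2 * sqrt n"
  proof -
    have "R^2 = n powr (2 + 1/2)" using n by (simp add: powr_power)
    also have "\<dots> = n powr 2 * n powr (1/2)" by (rule powr_add)
    finally show ?thesis using n by (simp add: powr_half_sqrt)
  qed
  have n1: "n \<ge> 1" using n by linarith
  have t1: "a1^2 * n^2 \<le> a1 * n + a2 / 2 * (n^2 - n)"
    by (rule first_two_moments_relation) (rule MQ)
  have d2: "(2 * a2 * ((n - 1) / 2))^2 \<le> 4 * a1 * (a2 * ((n - 1) / 2) + a3 * tri c)"
    by (rule test_discriminants(2)[OF _ c]) (rule MQ)
  have d3: "(a3 * tri c)^2 \<le> 4 * a1 * Wt a2 a3 a4 c"
    by (rule test_discriminants(3)[OF _ c]) (rule MQ)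
  have d4: "(2 * a3 * tri c + a4 * k4 c)^2 \<le> 4 * (a2 * ((n - 1) / 2) + a3 * tri c) * Wt a2 a3 a4 c"
    by (rule test_discriminants(4)[OF _ c]) (rule MQ)
  show ?thesis
    unfolding Gc_def
    by (rule moment_inequalities_bound[OF n N refl tri_bounds[OF c n] k4_ge[OF c n] t1 d2 d3 d4 Wt_le[OF c n1] _ powr_ge_zero R2])
       (use K_pos in simp_all)
qed

lemma FK4_upper:
  assumes n: "n \<ge> 1000"
  shows "FK4 V adj \<le> 64 * sqrt Gc * n powr (1/3)"
proof (rule FK4_le)
  fix a1 a2 a3 a4
  assume MQ: "\<And>y0 y Y. edgefun Y \<Longrightarrow> MQ (a1, a2, a3, a4) y0 y Y \<ge> 0"
  let ?B = "64 * sqrt Gc * n powr (1/3)"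
  have G: "Gc \<ge> 1" by (simp add: Gc_def)
  have n3: "n powr (1/3) \<ge> 1" using n by (intro ge_one_powr_ge_zero) auto
  \<comment> \<open>Covers the case \<open>n * a1 \<le> 64\<close>, which
    \<open>first_moment_le\<close> excludes.\<close>
  have B64: "64 * 1 * 1 \<le> ?B" using G n3 by (intro mult_mono) auto
  show "n * a1 \<le> ?B"
  proof (cases "n * a1 > 64")
    case True
    from first_moment_le[OF MQ n True] show ?thesis
    proof
      assume *: "(n * a1)^3 \<le> 8192 * n"
      have "(n powr (1/3))^3 = n" using n by (simp add: powr_power)
      then have "?B^3 = (64 * sqrt Gc)^3 * n" by (simp add: power_mult_distrib)
      moreover have "64^3 \<le> (64 * sqrt Gc)^3" using G by (intro power_mono) auto
      ultimately have "64^3 * n \<le> ?B^3" using n by (simp add: mult_right_mono)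
      then have "(n * a1)^3 \<le> ?B^3" using * n by simp
      then have "\<not> ?B < n * a1" using power_strict_mono[of ?B "n * a1" 3] B64 by linarith
      then show ?thesis by simp
    next
      \<comment> \<open>This alternative bounds \<open>n * a1\<close> by a multiple of
        \<open>n^(1/4)\<close>, so the exponent 1/3 is decided by the other one.\<close>
      assume *: "(n * a1)^2 \<le> 4096 * Gc * sqrt n"
      have "sqrt n = n powr (1/2)" using n by (simp add: powr_half_sqrt)
      also have "\<dots> \<le> n powr (2/3)" using n by (intro powr_mono) auto
      also have "\<dots> = (n powr (1/3))^2" using n by (simp add: powr_power)
      finally have "4096 * Gc * sqrt n \<le> 4096 * Gc * (n powr (1/3))^2" using G by (intro mult_left_mono) auto
      also have "\<dots> = ?B^2" using G by (simp add: power_mult_distrib)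
      finally have "(n * a1)^2 \<le> ?B^2" using * by linarith
      then show ?thesis by (rule power2_le_imp_le) (use B64 in auto)
    qed
  next
    case False
    then show ?thesis using B64 by linarith
  qed
qed

end

section \<open>Paley graphs\<close>

context paley
begin

lemma conference_paley: "conference V (\<lambda>i j. chi (i - j)) 1000"
proof
  show "finite V" by simp
  show "chi (i - j) = chi (j - i)" for i j by (rule chi_diff_commute)
  show "chi (i - i) = 0" for i using chi_eq_0_iff[of 0] by simp
  show "chi (i - j) = 1 \<or> chi (i - j) = -1" if "i \<in> V" "j \<in> V" "i \<noteq> j" for i j
    using chi_values[of "i - j"] chi_eq_0_iff[of "i - j"] V_eq_iff[OF that(1,2)] that(3) by auto
  show "(\<Sum>k\<in>V. chi (i - k)) = 0" for i
    using sum_chi_affine[of "-1" i] p_ge_5 by simp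
  show "(\<Sum>k\<in>V. chi (i - k) * chi (j - k)) = (if i = j then real (card V) else 0) - 1" if "i \<in> V" "j \<in> V" for i j
    using sum_chi_two[OF that] by simp
  show "\<bar>\<Sum>(i, j, k, l)\<in>V \<times> V \<times> V \<times> V. v i j * v k l * (chi (i - k) * chi (i - l) * chi (j - k) * chi (j - l))\<bar>
     \<le> 1000 * real (card V) powr (5 / 4) * (\<Sum>i\<in>V. \<Sum>j\<in>V. v i j ^ 2)" if "\<And>i. i \<in> V \<Longrightarrow> v i i = 0" for v
  proof -
    have "BH v v = (\<Sum>(i, j, k, l)\<in>V \<times> V \<times> V \<times> V. v i j * v k l * cyc i j k l)"
      unfolding sum_tuple4 BH_def Hop_def by (simp add: sum_distrib_left cyc_commute mult.assoc)
    then show ?thesis using four_cycle_bound[of v] that unfolding cyc_def nrm2_def by simp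
  qed
qed simp

lemma paley_adj_iff: "paley_adj p = (\<lambda>i j. chi (i - j) = 1)"
  unfolding paley_adj_def chi_def Legendre_def by (auto simp: fun_eq_iff)

sublocale conf: conference V "\<lambda>i j. chi (i - j)" 1000
  by (rule conference_paley)

lemma FK4_paley_lower:
  assumes "t > 0" "t^2 * sqrt (real p) \<le> 1 / 8192" "t^3 * real p \<le> 1 / 32768"
    "t^4 * (1070 * real p powr (5/4)) \<le> 1 / 4096"
  shows "real p * t^2 \<le> FK4 (paley_vertices p) (paley_adj p)"
  using conf.FK4_lower[of t] assms p_ge_5 by (simp add: paley_adj_iff)

lemma FK4_paley_upper:
  assumes "p \<ge> 1000"
  shows "FK4 (paley_vertices p) (paley_adj p) \<le> 64 * sqrt (5 + (1005 / 4 * 1200)^2) * real p powr (1/3)"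
  using conf.FK4_upper assms by (simp add: paley_adj_iff conf.Gc_def)

end

theorem theorem5p1:
  shows "\<exists>c1 c2 :: real. 0 < c1 \<and> c1 \<le> c2 \<and>
    (\<exists>N. \<forall>p::nat. p \<ge> N \<and> prime p \<and> [p = 1] (mod 4) \<longrightarrow>
       c1 * real p powr (1/3) \<le> FK4 (paley_vertices p) (paley_adj p) \<and>
       FK4 (paley_vertices p) (paley_adj p) \<le> c2 * real p powr (1/3))"
proof -
  \<comment> \<open>For \<open>t = u p^(-1/3)\<close> the quantity \<open>t^3 p\<close> equals
    \<open>u^3 = 1 / 32768\<close>, just what the lower bound allows. The other two quantities decay
    like \<open>p^(-1/6)\<close> and \<open>p^(-1/12)\<close>, so their bounds hold for large
    \<open>p\<close>.\<close>
  define u :: real where "u = 1 / 32"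
  have "eventually (\<lambda>x::real. (u * x powr (-1/3))^2 * sqrt x \<le> 1 / 8192) at_top"
    unfolding u_def by real_asymp
  moreover have "eventually (\<lambda>x::real. (u * x powr (-1/3))^4 * (1070 * x powr (5/4)) \<le> 1 / 4096) at_top"
    unfolding u_def by real_asymp
  ultimately have "eventually (\<lambda>x::real. (u * x powr (-1/3))^2 * sqrt x \<le> 1 / 8192 \<and>
      (u * x powr (-1/3))^4 * (1070 * x powr (5/4)) \<le> 1 / 4096) at_top"
    by (rule eventually_conj)
  then obtain N where N: "\<And>x. x \<ge> N \<Longrightarrow> (u * x powr (-1/3))^2 * sqrt x \<le> 1 / 8192 \<and>
      (u * x powr (-1/3))^4 * (1070 * x powr (5/4)) \<le> 1 / 4096"
    unfolding eventually_at_top_linorder by blast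
  define c2 :: real where "c2 = 64 * sqrt (5 + (1005 / 4 * 1200)^2)"
  have "u^2 \<le> c2"
  proof -
    have "64 * 1 \<le> c2" unfolding c2_def by (intro mult_left_mono) auto
    then show ?thesis by (simp add: u_def power2_eq_square)
  qed
  moreover have "u^2 * real p powr (1/3) \<le> FK4 (paley_vertices p) (paley_adj p) \<and>
      FK4 (paley_vertices p) (paley_adj p) \<le> c2 * real p powr (1/3)"
    if p: "p \<ge> max 1000 (nat \<lceil>N\<rceil>)" "prime p" "[p = 1] (mod 4)" for p
  proof -
    interpret paley p using p by unfold_locales
    have p1000: "p \<ge> 1000" and "p \<ge> nat \<lceil>N\<rceil>" using p(1) by simp_all
    then have pN: "real p \<ge> N" using real_nat_ceiling_ge[of N] by (meson of_nat_le_iff order_trans)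
    define t where "t = u * real p powr (-1/3)"
    have "t > 0" using p1000 by (simp add: t_def u_def)
    have t2: "real p * t^2 = u^2 * real p powr (1/3)"
    proof -
      have "t^2 = u^2 * real p powr (-2/3)" using p1000 by (simp add: t_def power_mult_distrib powr_power)
      moreover have "real p * real p powr (-2/3) = real p powr (1/3)"
        using p1000 powr_add[of "real p" 1 "-2/3"] by simp
      ultimately show ?thesis by simp
    qed
    have t3: "t^3 * real p = u^3"
    proof -
      have "t^3 = u^3 * real p powr (-1)" using p1000 by (simp add: t_def power_mult_distrib powr_power)
      then show ?thesis using p1000 by (simp add: powr_minus)
    qed
    have "real p * t^2 \<le> FK4 (paley_vertices p) (paley_adj p)"
    proof (rule FK4_paley_lower)
      show "t^3 * real p \<le> 1 / 32768" unfolding t3 by (simp add: u_def power_divide)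
      show "t^2 * sqrt (real p) \<le> 1 / 8192" "t^4 * (1070 * real p powr (5/4)) \<le> 1 / 4096"
        unfolding t_def using N[OF pN] by blast+
    qed (rule \<open>t > 0\<close>)
    then show ?thesis using FK4_paley_upper[OF p1000] unfolding t2 c2_def by simp
  qed
  moreover have "u^2 > 0" by (simp add: u_def)
  ultimately show ?thesis by blast
qed

end
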